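(* Let $X$ be a Stone space, that is, the dual of a (not necessarily unital) Boolean algebra, and let $\rho=(\{V_t\}_{t\in\mathbb{F}},\{\rho_t\}_{t\in\mathbb{F}})$ be a semi-saturated, orthogonal topological partial action of a free group $\mathbb{F}$ (on a given set of generators) on $X$ such that $V_\alpha$ is clopen for all generators $\alpha$ of $\mathbb{F}$. Then there exist a Boolean dynamical system $(\mathcal{B},\mathcal{L},\theta)$, with $\mathcal{L}$ the set of generators of $\mathbb{F}$, and a homeomorphism $f:X\to\partial E$ such that $f$ is equivariant with respect to the partial actions $\rho$ and $\varphi$, where $\partial E$ is the boundary path space associated with $(\mathcal{B},\mathcal{L},\theta,\mathcal{R}_\alpha)$ and $\varphi$ is the partial action of $\mathbb{F}$ on $\partial E$ described in the context. In particular, $\mathbb{F}\ltimes_\rho X$ and $\mathbb{F}\ltimes_\varphi\partial E$ are isomorphic as topological groupoids.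
   Context: Boolean algebras. A Boolean algebra is a set $\mathcal{B}$ with an element $\emptyset$ and operations $\cap,\cup,\setminus$ such that $(\mathcal{B},\cap,\cup)$ is a distributive lattice, $A\cap\emptyset=\emptyset$, $(A\cap B)\cup(A\setminus B)=A$ and $(A\cap B)\cap(A\setminus B)=\emptyset$ (no unit is required). $A\subseteq B$ means $A\cap B=A$. An ideal is a non-empty subset closed under $\cup$ and under intersection with arbitrary elements of $\mathcal{B}$; it is itself a Boolean algebra. A filter is a non-empty subset not containing $\emptyset$, upward closed and closed under $\cap$; an ultrafilter is a maximal filter. The dual $\widehat{\mathcal{B}}$ of $\mathcal{B}$ is the set of ultrafilters with the topology generated by the sets $\{\xi:A\in\xi\}$, $A\in\mathcal{B}$ (a totally disconnected locally compact Hausdorff space). An action on $\mathcal{B}$ is a map $\mathcal{B}\to\mathcal{B}$ preserving $\cap,\cup,\setminus$ and $\emptyset$. Boolean dynamical systems. A Boolean dynamical system is a triple $(\mathcal{B},\mathcal{L},\theta)$ with $\mathcal{B}$ a Boolean algebra, $\mathcal{L}$ a set and $\{\theta_\alpha\}_{\alpha\in\mathcal{L}}$ actions on $\mathcal{B}$. Put $\mathcal{R}_\alpha:=\{A\in\mathcal{B}:A\subseteq\theta_\alpha(B)\text{ for some }B\in\mathcal{B}\}$, an ideal, and below take $\mathcal{I}_\alpha=\mathcal{R}_\alpha$ for $\alpha\in\mathcal{L}$. $\mathcal{L}^*$ is the set of finite words in $\mathcal{L}$, including the empty word $\emptyset$; $|\alpha|$ is length. For $\alpha=\alpha_1\cdots\alpha_n$,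 $n\ge1$: $\theta_\alpha=\theta_{\alpha_n}\circ\cdots\circ\theta_{\alpha_1}$, $\theta_\emptyset=\mathrm{id}$, $\mathcal{I}_\alpha=\{A\in\mathcal{B}:A\subseteq\theta_{\alpha_2\cdots\alpha_n}(B)\text{ for some }B\in\mathcal{I}_{\alpha_1}\}$, $\mathcal{I}_\emptyset=\mathcal{B}$. $\mathcal{W}^*=\{\alpha\in\mathcal{L}^*:\mathcal{I}_\alpha\ne\{\emptyset\}\}$ and $\mathcal{W}^{\ge1}$ is the set of words of length $\ge1$ in $\mathcal{W}^*$. $X_\alpha$ is the set of ultrafilters in $\mathcal{I}_\alpha$ with the topology generated by the sets $\{\mathcal{F}\in X_\alpha:A\in\mathcal{F}\}$, $A\in\mathcal{I}_\alpha$. Boundary path space. $E^0=X_\emptyset$; $F^0=X_\emptyset\cup\{\emptyset\}$, where $\emptyset$ is an isolated point if $\mathcal{B}$ is unital and the point at infinity of the one-point compactification of $X_\emptyset$ otherwise. $E^1=\{e^\alpha_\eta:\alpha\in\mathcal{L},\eta\in X_\alpha\}$ with the topology of the disjoint union of the $X_\alpha$. For $\alpha\in\mathcal{L}$ put $f_{\emptyset[\alpha]}(\eta)=\{A\in\mathcal{B}:\theta_\alpha(A)\in\eta\}$ (an ultrafilter of $\mathcal{B}$ or $\emptyset$). Define $d:E^1\to E^0$, $d(e^\alpha_\eta)=\{B\in\mathcal{B}:A\subseteq B\text{ for some }A\in\eta\}$ and $r:E^1\to F^0$, $r(e^\alpha_\eta)=f_{\emptyset[\alpha]}(\eta)$.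 For $n\ge 2$, $E^n$ is the subspace of $\prod_{i=1}^nE^1$ of $(e_1,\dots,e_n)$ with $d(e_i)=r(e_{i+1})$; $E^*=\bigsqcup_{n\ge0}E^n$; $E^\infty$ is the set of infinite sequences in $E^1$ with $d(e_i)=r(e_{i+1})$ for all $i$. For a path, $r$ is $r$ of its first edge, $d$ of a finite path is $d$ of its last edge; $r(v)=d(v)=v$ for $v\in E^0$. Put $F^0_{sce}=F^0\setminus\overline{r(E^1)}$, $F^0_{fin}=\{v\in F^0: v\text{ has a neighborhood }V\text{ with }r^{-1}(V)\text{ compact}\}$, $F^0_{rg}=F^0_{fin}\setminus\overline{F^0_{sce}}$, $E^0_{sg}=E^0\setminus F^0_{rg}$. Then $\partial E=E^\infty\sqcup\{\mu\in E^*:d(\mu)\in E^0_{sg}\}$. For $S\subseteq E^*$ let $\mathcal{Z}(S)$ be the set of $\mu\in\partial E$ with $r(\mu)\in S$ or $\mu_1\cdots\mu_i\in S$ for some $1\le i\le|\mu|$; the topology of $\partial E$ is generated by the sets $\mathcal{Z}(U)\cap\mathcal{Z}(K)^c$, $U\subseteq E^*$ open, $K\subseteq E^*$ compact. Partial actions. A (topological) partial action of a group $G$ on a space $X$ is a pair $(\{U_t\}_{t\in G},\{\phi_t\}_{t\in G})$ of open sets $U_t\subseteq X$ and homeomorphisms $\phi_t:U_{t^{-1}}\to U_t$ with $U_e=X$, $\phi_e=\mathrm{id}$; $\phi_s(U_{s^{-1}}\cap U_t)=U_s\cap U_{st}$; and $\phi_s(\phi_t(x))=\phi_{st}(x)$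 for $x\in U_{t^{-1}}\cap U_{(st)^{-1}}$. When $G$ is a free group, it is semi-saturated if $\phi_s\circ\phi_t=\phi_{st}$ (as partially defined maps) whenever $|st|=|s|+|t|$, and orthogonal if $U_a\cap U_b=\emptyset$ for distinct generators $a,b$. $f$ is equivariant if $f(V_t)=U_t$ and $f(\rho_t(x))=\varphi_t(f(x))$ for all $t\in\mathbb{F}$, $x\in V_{t^{-1}}$. The groupoid of a partial action is $G\ltimes_\phi X=\{(x,t,y)\in X\times G\times X:y\in U_{t^{-1}},x=\phi_t(y)\}$ with $(x,t,y)(y,s,z)=(x,ts,z)$, $(x,t,y)^{-1}=(y,t^{-1},x)$ and the topology inherited from the product topology ($G$ discrete). The partial action $\varphi$ on $\partial E$. Words are regarded as elements of the free group $\mathbb{F}$ generated by $\mathcal{L}$, with $\emptyset$ the identity. $U_\emptyset=\partial E$. For $\alpha,\beta\in\mathcal{W}^{\ge1}$ with $\alpha\beta^{-1}$ in reduced form, $U_{\alpha\beta^{-1}}$ is the set of $(e^{\gamma_k}_{\eta_k})_{k=1}^N\in\partial E$ with $\gamma_1\cdots\gamma_{|\alpha|}=\alpha$ and $\eta_{|\alpha|}\cap\mathcal{I}_\beta\ne\emptyset$. For $\alpha\in\mathcal{W}^{\ge1}$, $U_\alpha=\{(e^{\gamma_k}_{\eta_k})_{k=1}^N\in\partial E:\gamma_1\cdots\gamma_{|\alpha|}=\alpha\}$. For $\beta\in\mathcal{W}^{\ge1}$, $U_{\beta^{-1}}=\{\mu\in\partial E:r(\mu)\cap\mathcal{I}_\beta\ne\emptyset\}$.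 For all other $t\in\mathbb{F}$, $U_t=\emptyset$. The homeomorphisms $\varphi_t:U_{t^{-1}}\to U_t$ are: $\varphi_\emptyset=\mathrm{id}$; for $\beta\in\mathcal{W}^{\ge1}$, $\varphi_{\beta^{-1}}$ removes the first $|\beta|$ edges (if $|\mu|=|\beta|$ the result is $d(\mu)\in E^0$); for $\alpha=\alpha_1\cdots\alpha_n\in\mathcal{W}^{\ge1}$ and $\beta\in\mathcal{W}^*$ with $\alpha\beta^{-1}$ reduced and $U_{\beta\alpha^{-1}}\neq\emptyset$, $\varphi_{\alpha\beta^{-1}}(\mu)$ is obtained by removing the first $|\beta|$ edges of $\mu$ and adding at the beginning $e^{\alpha_1}_{\eta_1}\cdots e^{\alpha_n}_{\eta_n}$, where $\eta_n=\zeta\cap\mathcal{I}_{\alpha_n}$ with $\zeta=d(\mu_{|\beta|})$ if $\beta\ne\emptyset$ and $\zeta=r(\mu)$ if $\beta=\emptyset$, and $\eta_i=f_{\emptyset[\alpha_{i+1}]}(\eta_{i+1})\cap\mathcal{I}_{\alpha_i}$ for $i=n-1,\dots,1$; all other $\varphi_t$ are empty maps. *)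

theory Defs
  imports "HOL-Analysis.Analysis" "HOL-Algebra.Group"
begin

section \<open>Boolean algebras without unit and their duals\<close>

record 'b boolalg = "'b partial_object" +
  bmeet :: "'b \<Rightarrow> 'b \<Rightarrow> 'b" (infixl "\<^bold>\<inter>\<index>" 70)
  bjoin :: "'b \<Rightarrow> 'b \<Rightarrow> 'b" (infixl "\<^bold>\<union>\<index>" 65)
  bdiff :: "'b \<Rightarrow> 'b \<Rightarrow> 'b" (infixl "\<^bold>-\<index>" 65)
  bempty :: 'b ("\<^bold>\<emptyset>\<index>")

definition ble :: "('b, 'm) boolalg_scheme \<Rightarrow> 'b \<Rightarrow> 'b \<Rightarrow> bool" (infix "\<^bold>\<subseteq>\<index>" 50) where
  "A \<^bold>\<subseteq>\<^bsub>\<B>\<^esub> B \<longleftrightarrow> A \<^bold>\<inter>\<^bsub>\<B>\<^esub> B = A"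

locale gen_boolean_algebra =
  fixes \<B> :: "'b boolalg" (structure)
  assumes meet_closed: "\<lbrakk>A \<in> carrier \<B>; B \<in> carrier \<B>\<rbrakk> \<Longrightarrow> A \<^bold>\<inter> B \<in> carrier \<B>"
    and join_closed: "\<lbrakk>A \<in> carrier \<B>; B \<in> carrier \<B>\<rbrakk> \<Longrightarrow> A \<^bold>\<union> B \<in> carrier \<B>"
    and diff_closed: "\<lbrakk>A \<in> carrier \<B>; B \<in> carrier \<B>\<rbrakk> \<Longrightarrow> A \<^bold>- B \<in> carrier \<B>"
    and empty_closed: "\<^bold>\<emptyset> \<in> carrier \<B>"
    and meet_assoc: "\<lbrakk>A \<in> carrier \<B>; B \<in> carrier \<B>; C \<in> carrier \<B>\<rbrakk>
      \<Longrightarrow> (A \<^bold>\<inter> B) \<^bold>\<inter> C = A \<^bold>\<inter> (B \<^bold>\<inter> C)"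
    and meet_commute: "\<lbrakk>A \<in> carrier \<B>; B \<in> carrier \<B>\<rbrakk> \<Longrightarrow> A \<^bold>\<inter> B = B \<^bold>\<inter> A"
    and join_assoc: "\<lbrakk>A \<in> carrier \<B>; B \<in> carrier \<B>; C \<in> carrier \<B>\<rbrakk>
      \<Longrightarrow> (A \<^bold>\<union> B) \<^bold>\<union> C = A \<^bold>\<union> (B \<^bold>\<union> C)"
    and join_commute: "\<lbrakk>A \<in> carrier \<B>; B \<in> carrier \<B>\<rbrakk> \<Longrightarrow> A \<^bold>\<union> B = B \<^bold>\<union> A"
    and meet_absorb: "\<lbrakk>A \<in> carrier \<B>; B \<in> carrier \<B>\<rbrakk> \<Longrightarrow> A \<^bold>\<inter> (A \<^bold>\<union> B) = A"
    and join_absorb: "\<lbrakk>A \<in> carrier \<B>; B \<in> carrier \<B>\<rbrakk> \<Longrightarrow> A \<^bold>\<union> (A \<^bold>\<inter> B) = A"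
    and distrib: "\<lbrakk>A \<in> carrier \<B>; B \<in> carrier \<B>; C \<in> carrier \<B>\<rbrakk>
      \<Longrightarrow> A \<^bold>\<inter> (B \<^bold>\<union> C) = (A \<^bold>\<inter> B) \<^bold>\<union> (A \<^bold>\<inter> C)"
    and meet_empty: "A \<in> carrier \<B> \<Longrightarrow> A \<^bold>\<inter> \<^bold>\<emptyset> = \<^bold>\<emptyset>"
    and meet_join_diff: "\<lbrakk>A \<in> carrier \<B>; B \<in> carrier \<B>\<rbrakk> \<Longrightarrow> (A \<^bold>\<inter> B) \<^bold>\<union> (A \<^bold>- B) = A"
    and meet_meet_diff: "\<lbrakk>A \<in> carrier \<B>; B \<in> carrier \<B>\<rbrakk> \<Longrightarrow> (A \<^bold>\<inter> B) \<^bold>\<inter> (A \<^bold>- B) = \<^bold>\<emptyset>"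

definition unital :: "'b boolalg \<Rightarrow> bool" where
  "unital \<B> \<longleftrightarrow> (\<exists>E \<in> carrier \<B>. \<forall>A \<in> carrier \<B>. A \<^bold>\<subseteq>\<^bsub>\<B>\<^esub> E)"

definition ba_filter :: "'b boolalg \<Rightarrow> 'b set \<Rightarrow> bool" where
  "ba_filter \<B> \<xi> \<longleftrightarrow>
     \<xi> \<noteq> {} \<and> \<xi> \<subseteq> carrier \<B> \<and> \<^bold>\<emptyset>\<^bsub>\<B>\<^esub> \<notin> \<xi> \<and>
     (\<forall>A \<in> \<xi>. \<forall>B \<in> carrier \<B>. A \<^bold>\<subseteq>\<^bsub>\<B>\<^esub> B \<longrightarrow> B \<in> \<xi>) \<and>
     (\<forall>A \<in> \<xi>. \<forall>B \<in> \<xi>. A \<^bold>\<inter>\<^bsub>\<B>\<^esub> B \<in> \<xi>)"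

definition ultrafilters :: "'b boolalg \<Rightarrow> 'b set set" where
  "ultrafilters \<B> = {\<xi>. ba_filter \<B> \<xi> \<and> (\<forall>\<xi>'. ba_filter \<B> \<xi>' \<and> \<xi> \<subseteq> \<xi>' \<longrightarrow> \<xi>' = \<xi>)}"

definition stone_dual :: "'b boolalg \<Rightarrow> 'b set topology" where
  "stone_dual \<B> = topology_generated_by {{\<xi> \<in> ultrafilters \<B>. A \<in> \<xi>} | A. A \<in> carrier \<B>}"

definition ba_action :: "'b boolalg \<Rightarrow> ('b \<Rightarrow> 'b) \<Rightarrow> bool" where
  "ba_action \<B> h \<longleftrightarrow>
     h \<in> carrier \<B> \<rightarrow> carrier \<B> \<and> h \<^bold>\<emptyset>\<^bsub>\<B>\<^esub> = \<^bold>\<emptyset>\<^bsub>\<B>\<^esub> \<and>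
     (\<forall>A \<in> carrier \<B>. \<forall>B \<in> carrier \<B>.
        h (A \<^bold>\<inter>\<^bsub>\<B>\<^esub> B) = h A \<^bold>\<inter>\<^bsub>\<B>\<^esub> h B \<and>
        h (A \<^bold>\<union>\<^bsub>\<B>\<^esub> B) = h A \<^bold>\<union>\<^bsub>\<B>\<^esub> h B \<and>
        h (A \<^bold>-\<^bsub>\<B>\<^esub> B) = h A \<^bold>-\<^bsub>\<B>\<^esub> h B)"


section \<open>The free group\<close>

text \<open>A letter \<open>(a, True)\<close> stands for the generator \<open>a\<close>, and \<open>(a, False)\<close> for its inverse.
  The elements of the free group are the reduced words, so the length \<open>|t|\<close> of
  an element is the length of the list.\<close>

definition inv_letter :: "'l \<times> bool \<Rightarrow> 'l \<times> bool" where
  "inv_letter x = (fst x, \<not> snd x)"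

definition reduced :: "('l \<times> bool) list \<Rightarrow> bool" where
  "reduced w \<longleftrightarrow> successively (\<lambda>x y. y \<noteq> inv_letter x) w"

definition cons_reduce :: "'l \<times> bool \<Rightarrow> ('l \<times> bool) list \<Rightarrow> ('l \<times> bool) list" where
  "cons_reduce x w = (if w \<noteq> [] \<and> hd w = inv_letter x then tl w else x # w)"

definition free_group :: "'l set \<Rightarrow> ('l \<times> bool) list monoid" where
  "free_group L =
     \<lparr>carrier = {w \<in> lists (L \<times> UNIV). reduced w}, mult = foldr cons_reduce, one = []\<rparr>"

definition gen :: "'l \<Rightarrow> ('l \<times> bool) list" where
  "gen a = [(a, True)]"

definition frac :: "'l list \<Rightarrow> 'l list \<Rightarrow> ('l \<times> bool) list" where
  \<comment> \<open>the unreduced concatenation \<open>\<alpha>\<beta>\<inverse>\<close>\<close>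
  "frac \<alpha> \<beta> = map (\<lambda>a. (a, True)) \<alpha> @ map (\<lambda>b. (b, False)) (rev \<beta>)"

lemma inv_letter_inv_letter [simp]: "inv_letter (inv_letter x) = x"
  by (simp add: inv_letter_def)

lemma reduced_Nil [simp]: "reduced []"
  by (simp add: reduced_def)

lemma reduced_Cons: "reduced (x # w) \<longleftrightarrow> reduced w \<and> (w \<noteq> [] \<longrightarrow> hd w \<noteq> inv_letter x)"
  by (cases w) (auto simp: reduced_def)

lemma cons_reduce_in:
  assumes "x \<in> L \<times> UNIV" "w \<in> lists (L \<times> UNIV)" "reduced w"
  shows "cons_reduce x w \<in> lists (L \<times> UNIV)" "reduced (cons_reduce x w)"
  using assms by (cases w; auto simp: cons_reduce_def reduced_Cons)+

lemma cons_reduce_inv: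
  assumes "reduced w"
  shows "cons_reduce (inv_letter x) (cons_reduce x w) = w"
  using assms by (cases w) (auto simp: cons_reduce_def reduced_Cons)

lemma foldr_cons_reduce_in:
  assumes "u \<in> lists (L \<times> UNIV)" "w \<in> lists (L \<times> UNIV)" "reduced w"
  shows "foldr cons_reduce u w \<in> lists (L \<times> UNIV) \<and> reduced (foldr cons_reduce u w)"
  using assms(1)
proof (induction u)
  case (Cons x u)
  then show ?case using cons_reduce_in[of x L "foldr cons_reduce u w"] by simp
qed (use assms in auto)

lemma foldr_reduced_Nil: "reduced u \<Longrightarrow> foldr cons_reduce u [] = u"
  by (induction u) (auto simp: reduced_Cons cons_reduce_def)

lemma foldr_cons_reduce_assoc:
  assumes "reduced v" "reduced w"
  shows "foldr cons_reduce (foldr cons_reduce u v) w = foldr cons_reduce u (foldr cons_reduce v w)"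
proof (induction u)
  case (Cons x u)
  let ?q = "foldr cons_reduce u v"
  have red: "reduced (foldr cons_reduce p w)" if "reduced w" for p and w :: "('a \<times> bool) list"
    using foldr_cons_reduce_in[of p UNIV w] that by simp
  have "foldr cons_reduce (cons_reduce x ?q) w = cons_reduce x (foldr cons_reduce ?q w)"
  proof (cases "?q \<noteq> [] \<and> hd ?q = inv_letter x")
    case True
    then obtain q' where q': "?q = inv_letter x # q'" by (metis list.collapse)
    have "foldr cons_reduce q' w
        = cons_reduce x (cons_reduce (inv_letter x) (foldr cons_reduce q' w))"
      using cons_reduce_inv[OF red[OF assms(2)], of "inv_letter x"] by simp
    then show ?thesis by (simp add: q' cons_reduce_def[of x "inv_letter x # q'"])
  next
    case False
    then show ?thesis by (auto simp: cons_reduce_def[of x ?q])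
  qed
  then show ?case by (simp add: Cons.IH)
qed simp

lemma group_free_group: "group (free_group L)"
proof (rule groupI)
  fix u assume u: "u \<in> carrier (free_group L)"
  have "\<exists>v \<in> lists (L \<times> UNIV). foldr cons_reduce v u = []"
    using u unfolding free_group_def
  proof (simp, induction u)
    case Nil
    show ?case by (rule bexI[of _ "[]"]) auto
  next
    case (Cons x u)
    then obtain v where v: "v \<in> lists (L \<times> UNIV)" "foldr cons_reduce v u = []"
      by (auto simp: reduced_Cons)
    have "foldr cons_reduce (v @ [inv_letter x]) (x # u) = []"
      using v by (simp add: cons_reduce_def)
    moreover have "v @ [inv_letter x] \<in> lists (L \<times> UNIV)"
      using v Cons.prems by (auto simp: inv_letter_def)
    ultimately show ?case by blast
  qed
  then obtain v where v: "v \<in> lists (L \<times> UNIV)" "foldr cons_reduce v u = []" by blast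
  let ?v = "foldr cons_reduce v []"
  have "foldr cons_reduce ?v u = []"
    using foldr_cons_reduce_assoc[of "[]" u v] u v by (simp add: free_group_def)
  then show "\<exists>y \<in> carrier (free_group L). y \<otimes>\<^bsub>free_group L\<^esub> u = \<one>\<^bsub>free_group L\<^esub>"
    using foldr_cons_reduce_in[OF v(1), of "[]"] by (auto simp: free_group_def)
next
  fix u v assume "u \<in> carrier (free_group L)" "v \<in> carrier (free_group L)"
  then show "u \<otimes>\<^bsub>free_group L\<^esub> v \<in> carrier (free_group L)"
    using foldr_cons_reduce_in[of u L v] by (auto simp: free_group_def)
qed (auto simp: free_group_def foldr_cons_reduce_assoc)


section \<open>Partial actions and their groupoids\<close>

locale topological_partial_action = group G for G :: "('g, 'm) monoid_scheme" (structure) +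
  fixes X :: "'x topology" and U :: "'g \<Rightarrow> 'x set" and \<phi> :: "'g \<Rightarrow> 'x \<Rightarrow> 'x"
  assumes dom_open: "t \<in> carrier G \<Longrightarrow> openin X (U t)"
    and homeo: "t \<in> carrier G \<Longrightarrow>
      homeomorphic_map (subtopology X (U (inv t))) (subtopology X (U t)) (\<phi> t)"
    and dom_one: "U \<one> = topspace X"
    and act_one: "x \<in> topspace X \<Longrightarrow> \<phi> \<one> x = x"
    and image_dom: "\<lbrakk>s \<in> carrier G; t \<in> carrier G\<rbrakk>
      \<Longrightarrow> \<phi> s ` (U (inv s) \<inter> U t) = U s \<inter> U (s \<otimes> t)"
    and act_mult: "\<lbrakk>s \<in> carrier G; t \<in> carrier G; x \<in> U (inv t) \<inter> U (inv (s \<otimes> t))\<rbrakk>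
      \<Longrightarrow> \<phi> s (\<phi> t x) = \<phi> (s \<otimes> t) x"

text \<open>Equality of the partially defined maps \<open>\<phi> s \<circ> \<phi> t\<close> and \<open>\<phi> (st)\<close> means equality of
  the domains and of the values there.\<close>

definition semi_saturated ::
    "'l set \<Rightarrow> (('l \<times> bool) list \<Rightarrow> 'x set) \<Rightarrow> (('l \<times> bool) list \<Rightarrow> 'x \<Rightarrow> 'x) \<Rightarrow> bool" where
  "semi_saturated L U \<phi> \<longleftrightarrow>
     (let F = free_group L in
      \<forall>s \<in> carrier F. \<forall>t \<in> carrier F.
        length (s \<otimes>\<^bsub>F\<^esub> t) = length s + length t \<longrightarrow>
          {x \<in> U (inv\<^bsub>F\<^esub> t). \<phi> t x \<in> U (inv\<^bsub>F\<^esub> s)} = U (inv\<^bsub>F\<^esub> (s \<otimes>\<^bsub>F\<^esub> t)) \<and>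
          (\<forall>x \<in> U (inv\<^bsub>F\<^esub> (s \<otimes>\<^bsub>F\<^esub> t)). \<phi> s (\<phi> t x) = \<phi> (s \<otimes>\<^bsub>F\<^esub> t) x))"

definition orthogonal_action :: "'l set \<Rightarrow> (('l \<times> bool) list \<Rightarrow> 'x set) \<Rightarrow> bool" where
  "orthogonal_action L U \<longleftrightarrow> (\<forall>a \<in> L. \<forall>b \<in> L. a \<noteq> b \<longrightarrow> U (gen a) \<inter> U (gen b) = {})"

definition equivariant ::
    "('g, 'm) monoid_scheme \<Rightarrow> ('g \<Rightarrow> 'x set) \<Rightarrow> ('g \<Rightarrow> 'x \<Rightarrow> 'x) \<Rightarrow>
     ('g \<Rightarrow> 'y set) \<Rightarrow> ('g \<Rightarrow> 'y \<Rightarrow> 'y) \<Rightarrow> ('x \<Rightarrow> 'y) \<Rightarrow> bool" where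
  "equivariant G V \<rho> U \<phi> f \<longleftrightarrow>
     (\<forall>t \<in> carrier G. f ` V t = U t \<and> (\<forall>x \<in> V (inv\<^bsub>G\<^esub> t). f (\<rho> t x) = \<phi> t (f x)))"

record 'g tgroupoid =
  arrows :: "'g topology"
  composable :: "('g \<times> 'g) set"
  gmult :: "'g \<Rightarrow> 'g \<Rightarrow> 'g"
  ginv :: "'g \<Rightarrow> 'g"

definition action_groupoid ::
    "('g, 'm) monoid_scheme \<Rightarrow> 'x topology \<Rightarrow> ('g \<Rightarrow> 'x set) \<Rightarrow> ('g \<Rightarrow> 'x \<Rightarrow> 'x) \<Rightarrow>
     ('x \<times> 'g \<times> 'x) tgroupoid" where
  "action_groupoid G X U \<phi> =
     (let S = {(x, t, y). t \<in> carrier G \<and> y \<in> U (inv\<^bsub>G\<^esub> t) \<and> x = \<phi> t y} in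
      \<lparr>arrows = subtopology (prod_topology X (prod_topology (discrete_topology (carrier G)) X)) S,
       composable = {((x, t, y), (y', s, z)). (x, t, y) \<in> S \<and> (y', s, z) \<in> S \<and> y = y'},
       gmult = (\<lambda>(x, t, y) (y', s, z). (x, t \<otimes>\<^bsub>G\<^esub> s, z)),
       ginv = (\<lambda>(x, t, y). (y, inv\<^bsub>G\<^esub> t, x))\<rparr>)"

definition isomorphic_tgroupoids :: "'g tgroupoid \<Rightarrow> 'h tgroupoid \<Rightarrow> bool" where
  "isomorphic_tgroupoids \<G> \<H> \<longleftrightarrow>
     (\<exists>h. homeomorphic_map (arrows \<G>) (arrows \<H>) h \<and>
        (\<forall>g \<in> topspace (arrows \<G>). \<forall>k \<in> topspace (arrows \<G>).
           (g, k) \<in> composable \<G> \<longleftrightarrow> (h g, h k) \<in> composable \<H>) \<and>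
        (\<forall>(g, k) \<in> composable \<G>. h (gmult \<G> g k) = gmult \<H> (h g) (h k)) \<and>
        (\<forall>g \<in> topspace (arrows \<G>). h (ginv \<G> g) = ginv \<H> (h g)))"


section \<open>Paths\<close>

text \<open>The edge \<open>e\<^sup>\<alpha>\<^sub>\<eta>\<close> is the pair \<open>(\<alpha>, \<eta>)\<close>. Edges of a path are numbered from \<open>0\<close>; a
  \<open>FinPath\<close> is meant to carry a nonempty list, the paths of length \<open>0\<close> being the vertices.\<close>

datatype ('l, 'b) gpath =
    Vertex "'b set"
  | FinPath "('l \<times> 'b set) list"
  | InfPath "nat \<Rightarrow> 'l \<times> 'b set"

primrec path_len :: "('l, 'b) gpath \<Rightarrow> enat" where
  "path_len (Vertex v) = 0"
| "path_len (FinPath es) = enat (length es)"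
| "path_len (InfPath s) = \<infinity>"

primrec path_edge :: "('l, 'b) gpath \<Rightarrow> nat \<Rightarrow> 'l \<times> 'b set" where
  "path_edge (Vertex v) = (\<lambda>i. undefined)"
| "path_edge (FinPath es) = (\<lambda>i. es ! i)"
| "path_edge (InfPath s) = s"

primrec add_edges :: "('l \<times> 'b set) list \<Rightarrow> ('l, 'b) gpath \<Rightarrow> ('l, 'b) gpath" where
  "add_edges es (Vertex v) = (if es = [] then Vertex v else FinPath es)"
| "add_edges es (FinPath fs) = FinPath (es @ fs)"
| "add_edges es (InfPath s) = InfPath (\<lambda>i. if i < length es then es ! i else s (i - length es))"

definition has_prefix :: "'l list \<Rightarrow> ('l, 'b) gpath \<Rightarrow> bool" where
  "has_prefix \<alpha> \<mu> \<longleftrightarrow>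
     enat (length \<alpha>) \<le> path_len \<mu> \<and> (\<forall>i < length \<alpha>. fst (path_edge \<mu> i) = \<alpha> ! i)"


section \<open>Boolean dynamical systems and the boundary path space\<close>

locale boolean_dynamical_system = gen_boolean_algebra \<B> for \<B> :: "'b boolalg" (structure) +
  fixes L :: "'l set" and \<theta> :: "'l \<Rightarrow> 'b \<Rightarrow> 'b"
  assumes action: "\<alpha> \<in> L \<Longrightarrow> ba_action \<B> (\<theta> \<alpha>)"
begin

definition range_ideal :: "'l \<Rightarrow> 'b set" where
  "range_ideal \<alpha> = {A \<in> carrier \<B>. \<exists>B \<in> carrier \<B>. A \<^bold>\<subseteq> \<theta> \<alpha> B}"

text \<open>\<open>fold \<theta> [\<alpha>\<^sub>1, \<dots>, \<alpha>\<^sub>n]\<close> is \<open>\<theta> \<alpha>\<^sub>n \<circ> \<dots> \<circ> \<theta> \<alpha>\<^sub>1\<close>. The ideals attached to the letters are the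
  range ideals throughout.\<close>

definition \<theta>_word :: "'l list \<Rightarrow> 'b \<Rightarrow> 'b" where
  "\<theta>_word = fold \<theta>"

primrec word_ideal :: "'l list \<Rightarrow> 'b set" where
  "word_ideal [] = carrier \<B>"
| "word_ideal (a # as) = {A \<in> carrier \<B>. \<exists>B \<in> range_ideal a. A \<^bold>\<subseteq> \<theta>_word as B}"

definition words :: "'l list set" where
  "words = {\<alpha> \<in> lists L. word_ideal \<alpha> \<noteq> {\<^bold>\<emptyset>}}"

definition words1 :: "'l list set" where
  "words1 = {\<alpha> \<in> words. length \<alpha> \<ge> 1}"

definition X_space :: "'l list \<Rightarrow> 'b set topology" where
  "X_space \<alpha> = stone_dual (\<B>\<lparr>carrier := word_ideal \<alpha>\<rparr>)"

definition E0 :: "'b set topology" where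
  "E0 = X_space []"

text \<open>The extra point of \<open>F\<^sup>0\<close> is the empty set, which is not an ultrafilter.\<close>

definition F0 :: "'b set topology" where
  "F0 = (if unital \<B>
         then topology_generated_by (insert {{}} {W. openin E0 W})
         else pullback_topology (insert {} (topspace E0)) (\<lambda>\<xi>. if \<xi> = {} then None else Some \<xi>)
                (Alexandroff_compactification E0))"

definition E1 :: "('l \<times> 'b set) topology" where
  "E1 = sum_topology (\<lambda>\<alpha>. X_space [\<alpha>]) L"

definition f_empty :: "'l \<Rightarrow> 'b set \<Rightarrow> 'b set" where
  "f_empty \<alpha> \<eta> = {A \<in> carrier \<B>. \<theta> \<alpha> A \<in> \<eta>}"

definition d_edge :: "'l \<times> 'b set \<Rightarrow> 'b set" where
  "d_edge e = {B \<in> carrier \<B>. \<exists>A \<in> snd e. A \<^bold>\<subseteq> B}"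

definition r_edge :: "'l \<times> 'b set \<Rightarrow> 'b set" where
  "r_edge e = f_empty (fst e) (snd e)"

definition fin_edge_paths :: "nat \<Rightarrow> ('l \<times> 'b set) list set" where
  "fin_edge_paths n = {es \<in> lists (topspace E1). length es = n \<and>
     (\<forall>i. Suc i < n \<longrightarrow> d_edge (es ! i) = r_edge (es ! Suc i))}"

definition path_space :: "nat \<Rightarrow> ('l, 'b) gpath topology" where
  "path_space n =
     (if n = 0
      then pullback_topology (Vertex ` topspace E0) (\<lambda>\<mu>. THE v. \<mu> = Vertex v) E0
      else pullback_topology (FinPath ` fin_edge_paths n) (\<lambda>\<mu>. \<lambda>i\<in>{..<n}. path_edge \<mu> i)
             (product_topology (\<lambda>i. E1) {..<n}))"

text \<open>The spaces \<open>path_space n\<close> are pairwise disjoint, so this is their topological sum.\<close>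

definition Estar :: "('l, 'b) gpath topology" where
  "Estar = topology_generated_by {W. \<exists>n. openin (path_space n) W}"

definition Einf :: "('l, 'b) gpath set" where
  "Einf = {InfPath s | s. \<forall>i. s i \<in> topspace E1 \<and> d_edge (s i) = r_edge (s (Suc i))}"

primrec r_path :: "('l, 'b) gpath \<Rightarrow> 'b set" where
  "r_path (Vertex v) = v"
| "r_path (FinPath es) = r_edge (hd es)"
| "r_path (InfPath s) = r_edge (s 0)"

primrec d_path :: "('l, 'b) gpath \<Rightarrow> 'b set" where
  "d_path (Vertex v) = v"
| "d_path (FinPath es) = d_edge (last es)"
| "d_path (InfPath s) = undefined"

definition F0_sce :: "'b set set" where
  "F0_sce = topspace F0 - F0 closure_of (r_edge ` topspace E1)"

definition F0_fin :: "'b set set" where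
  "F0_fin = {v \<in> topspace F0. \<exists>V W. openin F0 W \<and> v \<in> W \<and> W \<subseteq> V \<and> V \<subseteq> topspace F0 \<and>
     compactin E1 {e \<in> topspace E1. r_edge e \<in> V}}"

definition F0_rg :: "'b set set" where
  "F0_rg = F0_fin - F0 closure_of F0_sce"

definition E0_sg :: "'b set set" where
  "E0_sg = topspace E0 - F0_rg"

definition boundary :: "('l, 'b) gpath set" where
  "boundary = Einf \<union> {\<mu> \<in> topspace Estar. d_path \<mu> \<in> E0_sg}"

definition cylinder :: "('l, 'b) gpath set \<Rightarrow> ('l, 'b) gpath set" where
  "cylinder S = {\<mu> \<in> boundary. Vertex (r_path \<mu>) \<in> S \<or>
     (\<exists>i \<ge> 1. enat i \<le> path_len \<mu> \<and> FinPath (map (path_edge \<mu>) [0..<i]) \<in> S)}"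

definition boundary_space :: "('l, 'b) gpath topology" where
  "boundary_space = topology_generated_by
     {cylinder W \<inter> (boundary - cylinder K) | W K. openin Estar W \<and> compactin Estar K}"


subsection \<open>The partial action on the boundary path space\<close>

definition \<phi>_dom :: "('l \<times> bool) list \<Rightarrow> ('l, 'b) gpath set" where
  "\<phi>_dom t =
     (if t = [] then boundary
      else {\<mu> \<in> boundary.
        (\<exists>\<alpha> \<in> words1. \<exists>\<beta> \<in> words1. t = frac \<alpha> \<beta> \<and> reduced (frac \<alpha> \<beta>) \<and>
           has_prefix \<alpha> \<mu> \<and> snd (path_edge \<mu> (length \<alpha> - 1)) \<inter> word_ideal \<beta> \<noteq> {}) \<or>
        (\<exists>\<alpha> \<in> words1. t = frac \<alpha> [] \<and> has_prefix \<alpha> \<mu>) \<or>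
        (\<exists>\<beta> \<in> words1. t = frac [] \<beta> \<and> r_path \<mu> \<inter> word_ideal \<beta> \<noteq> {})})"

fun remove_edges :: "nat \<Rightarrow> ('l, 'b) gpath \<Rightarrow> ('l, 'b) gpath" where
  "remove_edges n (Vertex v) = Vertex v"
| "remove_edges n (FinPath es) =
     (if n = length es then Vertex (d_edge (last es)) else FinPath (drop n es))"
| "remove_edges n (InfPath s) = InfPath (\<lambda>i. s (n + i))"

text \<open>The edges \<open>e\<^sup>\<alpha>\<^sup>1\<^sub>\<eta>\<^sub>1 \<dots> e\<^sup>\<alpha>\<^sup>n\<^sub>\<eta>\<^sub>n\<close> determined from right to left by the vertex \<open>\<zeta>\<close>.\<close>

fun new_edges :: "'l list \<Rightarrow> 'b set \<Rightarrow> ('l \<times> 'b set) list" where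
  "new_edges [] \<zeta> = []"
| "new_edges [a] \<zeta> = [(a, \<zeta> \<inter> word_ideal [a])]"
| "new_edges (a # b # as) \<zeta> =
     (let es = new_edges (b # as) \<zeta>
      in (a, f_empty b (snd (hd es)) \<inter> word_ideal [a]) # es)"

text \<open>Only the values of \<open>\<phi>_act t\<close> on \<open>\<phi>_dom t\<inverse>\<close> matter. There \<open>t\<close> is the identity or has the
  form \<open>\<alpha>\<beta>\<inverse>\<close> for a unique pair of words.\<close>

definition \<phi>_act :: "('l \<times> bool) list \<Rightarrow> ('l, 'b) gpath \<Rightarrow> ('l, 'b) gpath" where
  "\<phi>_act t \<mu> =
     (if t = [] then \<mu>
      else
        let (\<alpha>, \<beta>) = (THE (\<alpha>, \<beta>). t = frac \<alpha> \<beta>);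
            \<zeta> = (if \<beta> = [] then r_path \<mu> else d_edge (path_edge \<mu> (length \<beta> - 1)))
        in add_edges (new_edges \<alpha> \<zeta>) (remove_edges (length \<beta>) \<mu>))"

end

end

theory Submission
  imports Defs
begin

text \<open>Let \<open>\<B>\<close> be the algebra of compact open subsets of \<open>X\<close> and
  \<open>\<theta>\<^sub>a A = \<rho>\<^sub>a\<inverse> (A \<inter> V\<^sub>a)\<close>; this is compact because \<open>V\<^sub>a\<close> is clopen. By Stone duality
  \<open>E\<^sup>0 = X\<close> and \<open>E\<^sup>1\<close> is the disjoint union of the sets \<open>V\<^bsub>a\<inverse>\<^esub>\<close>, with \<open>d\<close> the inclusion and
  \<open>r\<close> given by the maps \<open>\<rho>\<^sub>a\<close>. By orthogonality \<open>r\<close> is a homeomorphism onto the disjoint union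
  \<open>W\<close> of the sets \<open>V\<^sub>a\<close>, and its inverse followed by \<open>d\<close> is a shift map \<open>W \<rightarrow> X\<close>. Hence a path is
  determined by its range and its length, the singular vertices are the points outside \<open>W\<close>, and
  every point of \<open>X\<close> is the range of exactly one boundary path, namely its maximal shift orbit.
  Under this bijection a cylinder set \<open>Z(S)\<close> corresponds to \<open>r(S)\<close>, so it is a homeomorphism
  because \<open>r : E\<^sup>* \<rightarrow> X\<close> is continuous and open and \<open>X\<close> is Hausdorff.\<close>

section \<open>Stone duality for Boolean algebras without unit\<close>

text \<open>The given algebra enters through two properties that a homeomorphism preserves:
  \<open>X\<close> is Hausdorff and has a base of compact open sets. The rest is done with points of
  \<open>X\<close>. The sets \<open>V [(a, False)]\<close> are open but need not be closed, so an
  edge carries an ultrafilter of the ideal of compact open subsets of such a set and not one of the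
  whole algebra. Hence duality is proved for the compact open subsets of an arbitrary open set.

  The definitions speak of words, their ideals and reduced group elements. Semi-saturation resolves
  these into letters: a negative word acts as an iterate of the shift, a positive word as an inverse
  branch of such an iterate, and a reduced word \<alpha>\<beta>^-1 as one after the other.
  Orthogonality makes the shift single-valued and leaves no other reduced words with nonempty
  domain. Ideals, domains and edges thus turn into conditions on the points
  \<open>(shift ^^ i) x\<close>, and the action on paths, which removes edges and adds others from
  right to left, follows the orbit.\<close>

definition basic_dual :: "'b boolalg \<Rightarrow> 'b \<Rightarrow> 'b set set" where
  "basic_dual \<B> A = {\<xi> \<in> ultrafilters \<B>. A \<in> \<xi>}"

context gen_boolean_algebra
begin

lemma meet_idem: "A \<in> carrier \<B> \<Longrightarrow> A \<^bold>\<inter> A = A"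
  by (metis join_absorb meet_absorb meet_closed)

lemma join_idem: "A \<in> carrier \<B> \<Longrightarrow> A \<^bold>\<union> A = A"
  by (metis join_absorb meet_idem)

lemma ble_trans:
  "\<lbrakk>A \<^bold>\<subseteq> B; B \<^bold>\<subseteq> C; A \<in> carrier \<B>; B \<in> carrier \<B>; C \<in> carrier \<B>\<rbrakk> \<Longrightarrow> A \<^bold>\<subseteq> C"
  unfolding ble_def by (metis meet_assoc)

lemma meet_ble1: "\<lbrakk>A \<in> carrier \<B>; B \<in> carrier \<B>\<rbrakk> \<Longrightarrow> A \<^bold>\<inter> B \<^bold>\<subseteq> A"
  unfolding ble_def by (metis meet_assoc meet_commute meet_idem)

lemma meet_ble2: "\<lbrakk>A \<in> carrier \<B>; B \<in> carrier \<B>\<rbrakk> \<Longrightarrow> A \<^bold>\<inter> B \<^bold>\<subseteq> B"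
  unfolding ble_def by (metis meet_assoc meet_idem)

lemma ble_empty: "\<lbrakk>A \<^bold>\<subseteq> \<^bold>\<emptyset>; A \<in> carrier \<B>\<rbrakk> \<Longrightarrow> A = \<^bold>\<emptyset>"
  unfolding ble_def by (simp add: meet_empty)

lemma meet_mono:
  assumes "A \<^bold>\<subseteq> C" "B \<^bold>\<subseteq> D" "A \<in> carrier \<B>" "B \<in> carrier \<B>" "C \<in> carrier \<B>" "D \<in> carrier \<B>"
  shows "A \<^bold>\<inter> B \<^bold>\<subseteq> C \<^bold>\<inter> D"
proof -
  have "(A \<^bold>\<inter> B) \<^bold>\<inter> (C \<^bold>\<inter> D) = (A \<^bold>\<inter> C) \<^bold>\<inter> (B \<^bold>\<inter> D)"
    by (metis assms(3-6) meet_assoc meet_closed meet_commute)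
  then show ?thesis using assms unfolding ble_def by simp
qed

lemma filterD:
  assumes "ba_filter \<B> \<xi>"
  shows "\<xi> \<noteq> {}" "\<xi> \<subseteq> carrier \<B>" "\<^bold>\<emptyset> \<notin> \<xi>"
    "\<And>A B. \<lbrakk>A \<in> \<xi>; B \<in> carrier \<B>; A \<^bold>\<subseteq> B\<rbrakk> \<Longrightarrow> B \<in> \<xi>"
    "\<And>A B. \<lbrakk>A \<in> \<xi>; B \<in> \<xi>\<rbrakk> \<Longrightarrow> A \<^bold>\<inter> B \<in> \<xi>"
  using assms unfolding ba_filter_def by auto

lemma ultrafilter_filter: "\<xi> \<in> ultrafilters \<B> \<Longrightarrow> ba_filter \<B> \<xi>"
  by (simp add: ultrafilters_def)

lemma ultrafilter_exists:
  assumes "ba_filter \<B> \<xi>"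
  shows "\<exists>\<zeta> \<in> ultrafilters \<B>. \<xi> \<subseteq> \<zeta>"
proof -
  let ?F = "{\<zeta>. ba_filter \<B> \<zeta> \<and> \<xi> \<subseteq> \<zeta>}"
  have "\<exists>M\<in>?F. \<forall>Z\<in>?F. M \<subseteq> Z \<longrightarrow> Z = M"
  proof (rule subset_Zorn_nonempty)
    show "?F \<noteq> {}" using assms by blast
  next
    fix C assume C: "C \<noteq> {}" "subset.chain ?F C"
    then have sub: "\<And>Z. Z \<in> C \<Longrightarrow> ba_filter \<B> Z \<and> \<xi> \<subseteq> Z"
      by (auto simp: subset.chain_def)
    have tot: "\<And>Y Z. \<lbrakk>Y \<in> C; Z \<in> C\<rbrakk> \<Longrightarrow> Y \<subseteq> Z \<or> Z \<subseteq> Y"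
      using C(2) unfolding subset.chain_def by blast
    have "ba_filter \<B> (\<Union>C)"
      unfolding ba_filter_def
    proof (intro conjI ballI impI)
      show "\<Union>C \<noteq> {}" using C(1) sub filterD(1) by blast
      show "\<Union>C \<subseteq> carrier \<B>" using sub filterD(2) by blast
      show "\<^bold>\<emptyset> \<notin> \<Union>C" using sub filterD(3) by blast
    next
      fix A B assume "A \<in> \<Union>C" "B \<in> carrier \<B>" "A \<^bold>\<subseteq> B"
      then show "B \<in> \<Union>C" using sub filterD(4)[of _ A B] by blast
    next
      fix A B assume "A \<in> \<Union>C" "B \<in> \<Union>C"
      then obtain Y Z where YZ: "A \<in> Y" "Y \<in> C" "B \<in> Z" "Z \<in> C" by blast
      then obtain W where "A \<in> W" "B \<in> W" "W \<in> C" using tot[of Y Z] by blast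
      then show "A \<^bold>\<inter> B \<in> \<Union>C" using sub[of W] filterD(5)[of W A B] by blast
    qed
    then show "\<Union>C \<in> ?F" using C(1) sub by blast
  qed
  then obtain M where M: "ba_filter \<B> M" "\<xi> \<subseteq> M" "\<forall>Z\<in>?F. M \<subseteq> Z \<longrightarrow> Z = M" by blast
  then have "M \<in> ultrafilters \<B>" unfolding ultrafilters_def by blast
  then show ?thesis using M by blast
qed

text \<open>Maximality in the form used below: if \<open>C\<close> meets every member of the filter,
  the elements above some meet of a member with \<open>C\<close> again form a filter, which contains
  both the old one and \<open>C\<close>.\<close>

lemma ultrafilter_memI:
  assumes \<xi>: "\<xi> \<in> ultrafilters \<B>" and C: "C \<in> carrier \<B>"
    and ne: "\<And>A. A \<in> \<xi> \<Longrightarrow> A \<^bold>\<inter> C \<noteq> \<^bold>\<emptyset>"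
  shows "C \<in> \<xi>"
proof -
  note F = filterD[OF ultrafilter_filter[OF \<xi>]]
  let ?Z = "{D \<in> carrier \<B>. \<exists>A \<in> \<xi>. A \<^bold>\<inter> C \<^bold>\<subseteq> D}"
  have sub: "\<xi> \<subseteq> ?Z" using F(2) C meet_ble1 by blast
  have "ba_filter \<B> ?Z"
    unfolding ba_filter_def
  proof (intro conjI ballI impI)
    show "?Z \<noteq> {}" using F(1) sub by blast
    show "\<^bold>\<emptyset> \<notin> ?Z" using ne F(2) C ble_empty meet_closed by blast
  next
    fix A B assume "A \<in> ?Z" "B \<in> carrier \<B>" "A \<^bold>\<subseteq> B"
    then show "B \<in> ?Z" using F(2) C ble_trans[of _ A B] meet_closed by blast
  next
    fix A B assume "A \<in> ?Z" "B \<in> ?Z"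
    then obtain P Q where PQ: "A \<in> carrier \<B>" "B \<in> carrier \<B>" "P \<in> \<xi>" "P \<^bold>\<inter> C \<^bold>\<subseteq> A" "Q \<in> \<xi>" "Q \<^bold>\<inter> C \<^bold>\<subseteq> B"
      by blast
    have c: "P \<in> carrier \<B>" "Q \<in> carrier \<B>" using PQ F(2) by auto
    have "(P \<^bold>\<inter> C) \<^bold>\<inter> (Q \<^bold>\<inter> C) \<^bold>\<subseteq> A \<^bold>\<inter> B" using PQ c C by (simp add: meet_mono meet_closed)
    moreover have "(P \<^bold>\<inter> C) \<^bold>\<inter> (Q \<^bold>\<inter> C) = (P \<^bold>\<inter> Q) \<^bold>\<inter> C"
      by (metis c C meet_assoc meet_closed meet_commute meet_idem)
    ultimately show "A \<^bold>\<inter> B \<in> ?Z" using PQ F(5) meet_closed by auto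
  qed blast
  then have "?Z = \<xi>" using \<xi> sub unfolding ultrafilters_def by blast
  moreover have "C \<in> ?Z" using F(1,2) C meet_ble2 by blast
  ultimately show ?thesis by blast
qed

text \<open>Without a unit, the complement of \<open>B\<close> is taken inside a member
  \<open>A\<close>. If both parts of \<open>A\<close> were missing, \<open>ultrafilter_memI\<close>
  would give members \<open>P\<close> and \<open>Q\<close> disjoint from one part each, and
  \<open>P\<close>, \<open>Q\<close>, \<open>A\<close> would have empty meet.\<close>

lemma ultrafilter_prime:
  assumes \<xi>: "\<xi> \<in> ultrafilters \<B>" and A: "A \<in> \<xi>" and B: "B \<in> carrier \<B>"
  shows "A \<^bold>\<inter> B \<in> \<xi> \<or> A \<^bold>- B \<in> \<xi>"
proof (rule ccontr)
  assume no: "\<not> ?thesis"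
  note F = filterD[OF ultrafilter_filter[OF \<xi>]]
  have cA: "A \<in> carrier \<B>" using A F(2) by blast
  obtain P where P: "P \<in> \<xi>" "P \<^bold>\<inter> (A \<^bold>\<inter> B) = \<^bold>\<emptyset>"
    using no ultrafilter_memI[OF \<xi>, of "A \<^bold>\<inter> B"] cA B meet_closed by blast
  obtain Q where Q: "Q \<in> \<xi>" "Q \<^bold>\<inter> (A \<^bold>- B) = \<^bold>\<emptyset>"
    using no ultrafilter_memI[OF \<xi>, of "A \<^bold>- B"] cA B diff_closed by blast
  have c: "P \<in> carrier \<B>" "Q \<in> carrier \<B>" using P Q F(2) by auto
  have "(P \<^bold>\<inter> Q) \<^bold>\<inter> A = (P \<^bold>\<inter> Q) \<^bold>\<inter> (A \<^bold>\<inter> B) \<^bold>\<union> (P \<^bold>\<inter> Q) \<^bold>\<inter> (A \<^bold>- B)"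
    using c cA B by (metis diff_closed distrib meet_closed meet_join_diff)
  moreover have "(P \<^bold>\<inter> Q) \<^bold>\<inter> (A \<^bold>\<inter> B) = \<^bold>\<emptyset>"
    using P(2) c cA B by (metis meet_assoc meet_closed meet_commute meet_empty)
  moreover have "(P \<^bold>\<inter> Q) \<^bold>\<inter> (A \<^bold>- B) = \<^bold>\<emptyset>"
    using Q(2) c cA B by (metis meet_assoc diff_closed meet_empty)
  ultimately have "(P \<^bold>\<inter> Q) \<^bold>\<inter> A = \<^bold>\<emptyset>" by (simp add: join_idem empty_closed)
  then show False using P Q A F(3,5) by metis
qed

lemma basic_dual_Int:
  assumes "A \<in> carrier \<B>" "B \<in> carrier \<B>"
  shows "basic_dual \<B> (A \<^bold>\<inter> B) = basic_dual \<B> A \<inter> basic_dual \<B> B"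
proof -
  have "A \<^bold>\<inter> B \<in> \<xi> \<longleftrightarrow> A \<in> \<xi> \<and> B \<in> \<xi>" if "\<xi> \<in> ultrafilters \<B>" for \<xi>
    using filterD(4,5)[OF ultrafilter_filter[OF that]] assms meet_ble1 meet_ble2 by blast
  then show ?thesis unfolding basic_dual_def by blast
qed

lemma basic_dual_disjoint_diff:
  assumes "A \<in> carrier \<B>" "B \<in> carrier \<B>"
  shows "basic_dual \<B> B \<inter> basic_dual \<B> (A \<^bold>- B) = {}"
proof -
  have False if \<xi>: "\<xi> \<in> ultrafilters \<B>" "B \<in> \<xi>" "A \<^bold>- B \<in> \<xi>" for \<xi>
  proof -
    note F = filterD[OF ultrafilter_filter[OF \<xi>(1)]]
    \<comment> \<open>The axiom makes the meet of \<open>A\<close> and \<open>B\<close>, not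
      \<open>B\<close> itself, disjoint from the difference. So the difference is first shown to lie
      below \<open>A\<close>, by absorption in the decomposition of \<open>A\<close>.\<close>
    have "(A \<^bold>- B) \<^bold>\<inter> A = A \<^bold>- B"
      using assms by (metis diff_closed join_commute meet_absorb meet_closed meet_join_diff)
    then have "B \<^bold>\<inter> (A \<^bold>- B) = (A \<^bold>\<inter> B) \<^bold>\<inter> (A \<^bold>- B)"
      using assms by (metis diff_closed meet_assoc meet_commute)
    then show False using assms F(3,5) \<xi> meet_meet_diff by metis
  qed
  then show ?thesis unfolding basic_dual_def by blast
qed

lemma stone_dual_basic: "stone_dual \<B> = topology_generated_by (basic_dual \<B> ` carrier \<B>)"
  unfolding stone_dual_def basic_dual_def by (simp add: image_def Bex_def conj_commute)

lemma topspace_stone_dual: "topspace (stone_dual \<B>) = ultrafilters \<B>"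
proof -
  have "\<exists>A \<in> carrier \<B>. \<xi> \<in> basic_dual \<B> A" if "\<xi> \<in> ultrafilters \<B>" for \<xi>
    using filterD(1,2)[OF ultrafilter_filter[OF that]] that unfolding basic_dual_def by blast
  then show ?thesis unfolding stone_dual_basic topology_generated_by_topspace
    by (auto simp: basic_dual_def)
qed

lemma openin_basic_dual: "A \<in> carrier \<B> \<Longrightarrow> openin (stone_dual \<B>) (basic_dual \<B> A)"
  unfolding stone_dual_basic by (rule topology_generated_by_Basis) simp

text \<open>The generating sets are closed under binary intersection by
  \<open>basic_dual_Int\<close>, so this subbase is already a base.\<close>

lemma stone_dual_base:
  assumes "openin (stone_dual \<B>) S" "\<xi> \<in> S"
  shows "\<exists>A \<in> carrier \<B>. \<xi> \<in> basic_dual \<B> A \<and> basic_dual \<B> A \<subseteq> S"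
proof -
  have "generate_topology_on (basic_dual \<B> ` carrier \<B>) S"
    using assms(1) by (simp add: stone_dual_basic openin_topology_generated_by_iff)
  then show ?thesis using assms(2)
  proof (induction arbitrary: \<xi> rule: generate_topology_on.induct)
    case (Int a b)
    then obtain A B where "A \<in> carrier \<B>" "\<xi> \<in> basic_dual \<B> A" "basic_dual \<B> A \<subseteq> a"
      "B \<in> carrier \<B>" "\<xi> \<in> basic_dual \<B> B" "basic_dual \<B> B \<subseteq> b" by (meson IntE)
    then show ?case using basic_dual_Int[of A B] meet_closed[of A B] by blast
  next
    case (UN K)
    then show ?case by (meson Union_iff Union_upper subset_trans)
  qed blast+
qed

lemma Hausdorff_stone_dual: "Hausdorff_space (stone_dual \<B>)"
  unfolding Hausdorff_space_def topspace_stone_dual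
proof (intro allI impI, elim conjE)
  fix \<xi> \<zeta> assume \<xi>: "\<xi> \<in> ultrafilters \<B>" and \<zeta>: "\<zeta> \<in> ultrafilters \<B>" and ne: "\<xi> \<noteq> \<zeta>"
  note F = filterD[OF ultrafilter_filter[OF \<xi>]] and G = filterD[OF ultrafilter_filter[OF \<zeta>]]
  \<comment> \<open>Distinct ultrafilters are not nested, which gives \<open>A\<close>. Its missing
    complement is replaced by the difference of \<open>B\<close> and \<open>A\<close>, for any
    member \<open>B\<close> of the other ultrafilter.\<close>
  obtain A where A: "A \<in> \<xi>" "A \<notin> \<zeta>"
    using \<xi> \<zeta> ne unfolding ultrafilters_def by blast
  obtain B where B: "B \<in> \<zeta>" using G(1) by blast
  have c: "A \<in> carrier \<B>" "B \<in> carrier \<B>" using A B F G by auto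
  have "B \<^bold>\<inter> A \<notin> \<zeta>" using A(2) c G(4) meet_ble2 by blast
  then have "B \<^bold>- A \<in> \<zeta>" using ultrafilter_prime[OF \<zeta> B c(1)] by blast
  then have "\<zeta> \<in> basic_dual \<B> (B \<^bold>- A)" "\<xi> \<in> basic_dual \<B> A"
    using \<xi> \<zeta> A by (auto simp: basic_dual_def)
  then show "\<exists>S T. openin (stone_dual \<B>) S \<and> openin (stone_dual \<B>) T \<and> \<xi> \<in> S \<and> \<zeta> \<in> T \<and> disjnt S T"
    using openin_basic_dual[OF c(1)] openin_basic_dual[OF diff_closed[OF c(2,1)]]
      basic_dual_disjoint_diff[OF c(2,1)] unfolding disjnt_def by blast
qed

text \<open>A cover of \<open>basic_dual \<B> A\<close> without finite subcover yields the filter of all \<open>C\<close> such that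
  finitely many members of the cover contain \<open>basic_dual \<B> A\<close> outside \<open>basic_dual \<B> C\<close>; no
  ultrafilter extending it can lie in a member of the cover.\<close>

lemma compactin_basic_dual:
  assumes A: "A \<in> carrier \<B>"
  shows "compactin (stone_dual \<B>) (basic_dual \<B> A)"
  unfolding compactin_def
proof (intro conjI allI impI)
  show "basic_dual \<B> A \<subseteq> topspace (stone_dual \<B>)"
    by (auto simp: topspace_stone_dual basic_dual_def)
next
  fix \<U> assume U: "(\<forall>U\<in>\<U>. openin (stone_dual \<B>) U) \<and> basic_dual \<B> A \<subseteq> \<Union>\<U>"
  show "\<exists>\<F>. finite \<F> \<and> \<F> \<subseteq> \<U> \<and> basic_dual \<B> A \<subseteq> \<Union>\<F>"
  proof (rule ccontr)
    assume no: "\<not> ?thesis"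
    let ?Z = "{C \<in> carrier \<B>. \<exists>\<F>. finite \<F> \<and> \<F> \<subseteq> \<U> \<and> basic_dual \<B> A \<subseteq> basic_dual \<B> C \<union> \<Union>\<F>}"
    have mono: "basic_dual \<B> C \<subseteq> basic_dual \<B> D"
      if "C \<in> carrier \<B>" "D \<in> carrier \<B>" "C \<^bold>\<subseteq> D" for C D
      using basic_dual_Int[OF that(1,2)] that(3) by (simp add: ble_def) blast
    have e0: "basic_dual \<B> \<^bold>\<emptyset> = {}"
      using filterD(3)[OF ultrafilter_filter] by (auto simp: basic_dual_def)
    have AZ: "A \<in> ?Z" using A by (auto intro!: exI[of _ "{}"])
    have "ba_filter \<B> ?Z"
      unfolding ba_filter_def
    proof (intro conjI ballI impI)
      show "?Z \<noteq> {}" using AZ by blast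
      show "\<^bold>\<emptyset> \<notin> ?Z" using no e0 by auto
    next
      fix C D assume "C \<in> ?Z" "D \<in> carrier \<B>" "C \<^bold>\<subseteq> D"
      then show "D \<in> ?Z" using mono[of C D] by blast
    next
      fix C D assume "C \<in> ?Z" "D \<in> ?Z"
      then obtain \<F> \<G> where "C \<in> carrier \<B>" "D \<in> carrier \<B>" "finite \<F>" "\<F> \<subseteq> \<U>"
        "basic_dual \<B> A \<subseteq> basic_dual \<B> C \<union> \<Union>\<F>" "finite \<G>" "\<G> \<subseteq> \<U>"
        "basic_dual \<B> A \<subseteq> basic_dual \<B> D \<union> \<Union>\<G>" by blast
      then have "finite (\<F> \<union> \<G>) \<and> \<F> \<union> \<G> \<subseteq> \<U> \<and> basic_dual \<B> A \<subseteq> basic_dual \<B> (C \<^bold>\<inter> D) \<union> \<Union>(\<F> \<union> \<G>)"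
        using basic_dual_Int[of C D] by auto
      then show "C \<^bold>\<inter> D \<in> ?Z" using \<open>C \<in> carrier \<B>\<close> \<open>D \<in> carrier \<B>\<close> meet_closed by blast
    qed blast
    then obtain \<zeta> where \<zeta>: "\<zeta> \<in> ultrafilters \<B>" "?Z \<subseteq> \<zeta>" using ultrafilter_exists by blast
    then have "\<zeta> \<in> basic_dual \<B> A" using AZ by (auto simp: basic_dual_def)
    then obtain U where U': "U \<in> \<U>" "\<zeta> \<in> U" using U by blast
    then obtain B where B: "B \<in> carrier \<B>" "\<zeta> \<in> basic_dual \<B> B" "basic_dual \<B> B \<subseteq> U"
      using stone_dual_base U by meson
    have "basic_dual \<B> A \<subseteq> basic_dual \<B> (A \<^bold>- B) \<union> basic_dual \<B> B"
      using ultrafilter_prime[of _ A B] B(1) A basic_dual_Int[of A B]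
      unfolding basic_dual_def by blast
    then have "basic_dual \<B> A \<subseteq> basic_dual \<B> (A \<^bold>- B) \<union> \<Union>{U}" using B(3) by auto
    moreover have "finite {U}" "{U} \<subseteq> \<U>" using U'(1) by auto
    ultimately have "A \<^bold>- B \<in> ?Z" using diff_closed[OF A B(1)] by blast
    then have "\<zeta> \<in> basic_dual \<B> (A \<^bold>- B)" using \<zeta> by (auto simp: basic_dual_def)
    then show False using B basic_dual_disjoint_diff[OF A, of B] by blast
  qed
qed

end

text \<open>Local compactness and zero-dimensionality in one condition that a homeomorphism visibly
  transports. With the Hausdorff property it is all that \<open>stone_space\<close> asks.\<close>

definition compact_open_base :: "'x topology \<Rightarrow> bool" where
  "compact_open_base X \<longleftrightarrow>
     (\<forall>S x. openin X S \<and> x \<in> S \<longrightarrow> (\<exists>K. compactin X K \<and> openin X K \<and> x \<in> K \<and> K \<subseteq> S))"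

lemma (in gen_boolean_algebra) compact_open_base_stone_dual: "compact_open_base (stone_dual \<B>)"
  unfolding compact_open_base_def
  by (meson compactin_basic_dual openin_basic_dual stone_dual_base)

lemma homeomorphic_compact_open_base:
  assumes "X homeomorphic_space Y" "compact_open_base Y"
  shows "compact_open_base X"
  unfolding compact_open_base_def
proof (intro allI impI, elim conjE)
  fix S x assume S: "openin X S" "x \<in> S"
  obtain g where g: "homeomorphic_map X Y g"
    using assms(1) by (meson homeomorphic_map_maps homeomorphic_space_def)
  have SX: "S \<subseteq> topspace X" using S(1) openin_subset by blast
  then have "openin Y (g ` S)" using g S(1) homeomorphic_map_openness by blast
  then obtain K where K: "compactin Y K" "openin Y K" "g x \<in> K" "K \<subseteq> g ` S"
    using assms(2) S(2) unfolding compact_open_base_def by (meson imageI)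
  then obtain K' where K': "K' \<subseteq> S" "K = g ` K'" by (meson subset_imageE)
  have inj: "inj_on g (topspace X)" using g homeomorphic_map_def by blast
  have "x \<in> K'" using K(3) K' S(2) SX inj_onD[OF inj] by blast
  then show "\<exists>K. compactin X K \<and> openin X K \<and> x \<in> K \<and> K \<subseteq> S"
    using K K' SX g homeomorphic_map_openness homeomorphic_map_compactness
    by (metis subset_trans)
qed

section \<open>The algebra of compact open sets\<close>

text \<open>The bound \<open>S\<close> lets one construction cover the whole algebra and, for open
  \<open>S\<close>, its ideals; the dual of such an ideal turns out to be \<open>S\<close>.\<close>

definition compact_opens :: "'x topology \<Rightarrow> 'x set \<Rightarrow> 'x set set" where
  "compact_opens X S = {A. compactin X A \<and> openin X A \<and> A \<subseteq> S}"

definition co_algebra :: "'x topology \<Rightarrow> 'x set \<Rightarrow> 'x set boolalg" where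
  "co_algebra X S = \<lparr>carrier = compact_opens X S,
     bmeet = (\<inter>), bjoin = (\<union>), bdiff = (-), bempty = {}\<rparr>"

definition point_filter :: "'x topology \<Rightarrow> 'x set \<Rightarrow> 'x \<Rightarrow> 'x set set" where
  "point_filter X S x = {A \<in> compact_opens X S. x \<in> A}"

text \<open>The sixth equation serves \<open>X_space\<close>, which restricts the carrier to an
  ideal: the result is again an algebra of compact open sets.\<close>

lemma co_algebra_simps [simp]:
  "carrier (co_algebra X S) = compact_opens X S"
  "A \<^bold>\<inter>\<^bsub>co_algebra X S\<^esub> B = A \<inter> B" "A \<^bold>\<union>\<^bsub>co_algebra X S\<^esub> B = A \<union> B"
  "A \<^bold>-\<^bsub>co_algebra X S\<^esub> B = A - B" "\<^bold>\<emptyset>\<^bsub>co_algebra X S\<^esub> = {}"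
  "co_algebra X S\<lparr>carrier := compact_opens X T\<rparr> = co_algebra X T"
  "A \<^bold>\<subseteq>\<^bsub>co_algebra X S\<^esub> B \<longleftrightarrow> A \<subseteq> B"
  by (auto simp: co_algebra_def ble_def)

locale stone_space =
  fixes X :: "'x topology"
  assumes Hausdorff: "Hausdorff_space X" and base: "compact_open_base X"
begin

lemma compact_openE:
  assumes "openin X S" "x \<in> S"
  obtains K where "K \<in> compact_opens X S" "x \<in> K"
  using assms base unfolding compact_open_base_def compact_opens_def by blast

lemma compact_opens_Int: "\<lbrakk>A \<in> compact_opens X S; B \<in> compact_opens X T\<rbrakk> \<Longrightarrow> A \<inter> B \<in> compact_opens X S"
  unfolding compact_opens_def
  by (auto intro: openin_Int compact_Int_closedin compactin_imp_closedin[OF Hausdorff])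

lemma compact_opens_Un: "\<lbrakk>A \<in> compact_opens X S; B \<in> compact_opens X S\<rbrakk> \<Longrightarrow> A \<union> B \<in> compact_opens X S"
  unfolding compact_opens_def by (auto intro: compactin_Un)

lemma compact_opens_Diff:
  assumes "A \<in> compact_opens X S" "B \<in> compact_opens X T"
  shows "A - B \<in> compact_opens X S"
proof -
  have AB: "compactin X A" "openin X A" "openin X B" "closedin X B" "A \<subseteq> S"
    using assms compactin_imp_closedin[OF Hausdorff] by (auto simp: compact_opens_def)
  have "A - B = A \<inter> (topspace X - B)" using AB(2) openin_subset by blast
  then have "compactin X (A - B)" using AB by (metis compact_Int_closedin closedin_diff closedin_topspace)
  then show ?thesis using AB unfolding compact_opens_def by auto
qed

lemma empty_compact_opens: "{} \<in> compact_opens X S"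
  by (simp add: compact_opens_def)

lemma gen_boolean_algebra_co_algebra: "gen_boolean_algebra (co_algebra X S)"
  by unfold_locales
    (auto intro: compact_opens_Int compact_opens_Un compact_opens_Diff empty_compact_opens)

text \<open>A larger filter cannot have a member \<open>B\<close> missing \<open>x\<close>: for a
  compact open \<open>K\<close> around \<open>x\<close>, the set \<open>K - B\<close> is in the
  point filter and is disjoint from \<open>B\<close>.\<close>

lemma point_filter_ultrafilter:
  assumes S: "openin X S" and x: "x \<in> S"
  shows "point_filter X S x \<in> ultrafilters (co_algebra X S)"
proof -
  obtain K where K: "K \<in> compact_opens X S" "x \<in> K" using compact_openE S x by blast
  have fil: "ba_filter (co_algebra X S) (point_filter X S x)"
    unfolding ba_filter_def point_filter_def using K by (auto intro: compact_opens_Int)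
  have "\<zeta> = point_filter X S x"
    if \<zeta>: "ba_filter (co_algebra X S) \<zeta>" "point_filter X S x \<subseteq> \<zeta>" for \<zeta>
  proof -
    have "x \<in> B" if B: "B \<in> \<zeta>" for B
    proof (rule ccontr)
      assume "x \<notin> B"
      moreover have "B \<in> compact_opens X S" using \<zeta>(1) B unfolding ba_filter_def by auto
      ultimately have "K - B \<in> \<zeta>"
        using K \<zeta>(2) compact_opens_Diff[of K S B S] unfolding point_filter_def by blast
      then have "(K - B) \<inter> B \<in> \<zeta>" using \<zeta>(1) B unfolding ba_filter_def by auto
      moreover have "(K - B) \<inter> B = {}" by blast
      ultimately show False using \<zeta>(1) unfolding ba_filter_def by simp
    qed
    then show ?thesis using \<zeta> unfolding ba_filter_def point_filter_def by auto
  qed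
  then show ?thesis using fil unfolding ultrafilters_def by blast
qed

text \<open>The members are compact and closed with nonempty finite intersections, so they share a
  point \<open>x\<close>. The ultrafilter then lies in the point filter of \<open>x\<close>, and
  maximality gives equality.\<close>

lemma ultrafilter_point:
  assumes S: "openin X S" and \<xi>: "\<xi> \<in> ultrafilters (co_algebra X S)"
  shows "\<exists>x \<in> S. \<xi> = point_filter X S x"
proof -
  have F: "\<xi> \<noteq> {}" "\<xi> \<subseteq> compact_opens X S" "{} \<notin> \<xi>" "\<And>A B. \<lbrakk>A \<in> \<xi>; B \<in> \<xi>\<rbrakk> \<Longrightarrow> A \<inter> B \<in> \<xi>"
    using \<xi> unfolding ultrafilters_def ba_filter_def by auto
  obtain A where A: "A \<in> \<xi>" using F(1) by blast
  have fin: "\<Inter>\<F> \<in> \<xi>" if "finite \<F>" "\<F> \<noteq> {}" "\<F> \<subseteq> \<xi>" for \<F>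
    using that by (induction rule: finite_ne_induct) (auto intro: F(4))
  have "A \<inter> \<Inter>\<xi> \<noteq> {}"
  proof (rule compactin_fip[THEN iffD1, THEN conjunct2, rule_format, of X A \<xi>])
    show "compactin X A" using A F(2) by (auto simp: compact_opens_def)
    show "(\<forall>C\<in>\<xi>. closedin X C) \<and> (\<forall>\<F>. finite \<F> \<and> \<F> \<subseteq> \<xi> \<longrightarrow> A \<inter> \<Inter>\<F> \<noteq> {})"
    proof (intro conjI ballI allI impI)
      fix C assume "C \<in> \<xi>" then show "closedin X C"
        using F(2) compactin_imp_closedin[OF Hausdorff] by (auto simp: compact_opens_def)
    next
      fix \<F> assume "finite \<F> \<and> \<F> \<subseteq> \<xi>"
      then have "\<Inter>(insert A \<F>) \<in> \<xi>" using fin[of "insert A \<F>"] A by blast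
      then show "A \<inter> \<Inter>\<F> \<noteq> {}" using F(3) by auto
    qed
  qed
  then obtain x where x: "x \<in> A" "\<forall>B\<in>\<xi>. x \<in> B" by blast
  have xS: "x \<in> S" using x A F(2) by (auto simp: compact_opens_def)
  have "\<xi> \<subseteq> point_filter X S x" using x F(2) by (auto simp: point_filter_def)
  moreover have "ba_filter (co_algebra X S) (point_filter X S x)"
    using point_filter_ultrafilter[OF S xS] by (simp add: ultrafilters_def)
  ultimately have "point_filter X S x = \<xi>" using \<xi> unfolding ultrafilters_def by blast
  then show ?thesis using xS by blast
qed

lemma ultrafilters_co_algebra:
  "openin X S \<Longrightarrow> ultrafilters (co_algebra X S) = point_filter X S ` S"
  using ultrafilter_point point_filter_ultrafilter by blast

lemma inj_point_filter:
  assumes "openin X S"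
  shows "inj_on (point_filter X S) S"
proof (rule inj_onI, rule ccontr)
  fix x y assume xy: "x \<in> S" "y \<in> S" "point_filter X S x = point_filter X S y" "x \<noteq> y"
  have "x \<in> topspace X" "y \<in> topspace X" using xy(1,2) assms openin_subset by blast+
  then obtain U U' where "openin X U" "x \<in> U" "y \<in> U'" "disjnt U U'"
    using Hausdorff xy(4) unfolding Hausdorff_space_def by blast
  then have U: "openin X U" "x \<in> U" "y \<notin> U" by (auto simp: disjnt_iff)
  then obtain K where "K \<in> compact_opens X (S \<inter> U)" "x \<in> K"
    using compact_openE[of "S \<inter> U" x] assms xy(1) by blast
  then have "K \<in> point_filter X S x" "K \<notin> point_filter X S y"
    using U(3) by (auto simp: point_filter_def compact_opens_def)
  then show False using xy(3) by blast
qed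

text \<open>The basic set of \<open>A\<close> is the image of \<open>A\<close> itself, so open sets
  correspond in both directions. The case \<open>S = topspace X\<close> yields \<open>E0\<close>,
  and \<open>S = V [(a, False)]\<close> yields the piece of \<open>E1\<close> with label
  \<open>a\<close>.\<close>

lemma homeomorphic_map_point_filter:
  assumes S: "openin X S"
  shows "homeomorphic_map (subtopology X S) (stone_dual (co_algebra X S)) (point_filter X S)"
proof -
  interpret co: gen_boolean_algebra "co_algebra X S" by (rule gen_boolean_algebra_co_algebra)
  have top: "topspace (subtopology X S) = S" using S openin_subset by fastforce
  have bas: "basic_dual (co_algebra X S) A = point_filter X S ` A" if "A \<in> compact_opens X S" for A
    using that unfolding basic_dual_def ultrafilters_co_algebra[OF S]
    by (auto simp: point_filter_def compact_opens_def)
  show ?thesis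
  proof (rule bijective_open_imp_homeomorphic_map)
    show "point_filter X S ` topspace (subtopology X S) = topspace (stone_dual (co_algebra X S))"
      by (simp only: top co.topspace_stone_dual ultrafilters_co_algebra[OF S])
    show "inj_on (point_filter X S) (topspace (subtopology X S))"
      using inj_point_filter[OF S] by (simp only: top)
    show "open_map (subtopology X S) (stone_dual (co_algebra X S)) (point_filter X S)"
      unfolding open_map_def
    proof (intro allI impI)
      fix U assume "openin (subtopology X S) U"
      then have U: "openin X U" "U \<subseteq> S" using S openin_open_subtopology by blast+
      show "openin (stone_dual (co_algebra X S)) (point_filter X S ` U)"
      proof (subst openin_subopen, intro ballI)
        fix \<xi> assume "\<xi> \<in> point_filter X S ` U"
        then obtain x where x: "x \<in> U" "\<xi> = point_filter X S x" by blast
        then obtain K where K: "K \<in> compact_opens X U" "x \<in> K" using compact_openE U(1) by blast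
        then have "K \<in> compact_opens X S" "K \<subseteq> U" using U(2) by (auto simp: compact_opens_def)
        then show "\<exists>T. openin (stone_dual (co_algebra X S)) T \<and> \<xi> \<in> T \<and> T \<subseteq> point_filter X S ` U"
          using co.openin_basic_dual[of K] bas[of K] K(2) x(2) by (metis co_algebra_simps(1) image_eqI image_mono)
      qed
    qed
    show "continuous_map (subtopology X S) (stone_dual (co_algebra X S)) (point_filter X S)"
      unfolding co.stone_dual_basic
    proof (rule continuous_on_generated_topo)
      show "point_filter X S ` topspace (subtopology X S) \<subseteq> \<Union>(basic_dual (co_algebra X S) ` carrier (co_algebra X S))"
        using co.topspace_stone_dual
        unfolding top co.stone_dual_basic topology_generated_by_topspace ultrafilters_co_algebra[OF S] by simp
    next
      fix U assume "U \<in> basic_dual (co_algebra X S) ` carrier (co_algebra X S)"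
      then obtain A where A: "A \<in> compact_opens X S" "U = basic_dual (co_algebra X S) A" by auto
      have "point_filter X S -` U \<inter> S = A"
        using A point_filter_ultrafilter[OF S] by (auto simp: basic_dual_def point_filter_def compact_opens_def)
      then show "openin (subtopology X S) (point_filter X S -` U \<inter> topspace (subtopology X S))"
        unfolding top using A(1) S by (simp add: openin_open_subtopology compact_opens_def)
    qed
  qed
qed

end

section \<open>Semi-saturated partial actions of free groups\<close>

definition pos_word :: "'l list \<Rightarrow> ('l \<times> bool) list" where
  "pos_word \<alpha> = map (\<lambda>a. (a, True)) \<alpha>"

definition neg_word :: "'l list \<Rightarrow> ('l \<times> bool) list" where
  "neg_word \<beta> = map (\<lambda>b. (b, False)) (rev \<beta>)"

lemma inv_letter_pair [simp]: "inv_letter (a, b) = (a, \<not> b)"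
  by (simp add: inv_letter_def)

text \<open>A syntactic inverse, an involution on all lists; on the carrier it is the group inverse
  by \<open>inv_free_group\<close>.\<close>

definition inv_word :: "('l \<times> bool) list \<Rightarrow> ('l \<times> bool) list" where
  "inv_word t = rev (map inv_letter t)"

lemma pos_word_simps [simp]: "pos_word [] = []" "pos_word (a # \<alpha>) = (a, True) # pos_word \<alpha>"
  by (simp_all add: pos_word_def)

lemma neg_word_simps [simp]: "neg_word [] = []" "neg_word (a # \<alpha>) = neg_word \<alpha> @ [(a, False)]"
  "neg_word (\<alpha> @ [a]) = (a, False) # neg_word \<alpha>"
  by (simp_all add: neg_word_def)

lemma frac_eq: "Defs.frac \<alpha> \<beta> = pos_word \<alpha> @ neg_word \<beta>"
  by (simp add: Defs.frac_def pos_word_def neg_word_def)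

text \<open>The letters tagged \<open>True\<close> spell the first word and those tagged
  \<open>False\<close> the reverse of the second. This resolves the \<open>THE\<close> in
  \<open>\<phi>_act\<close>.\<close>

lemma frac_inject: "Defs.frac \<alpha> \<beta> = Defs.frac \<gamma> \<delta> \<longleftrightarrow> \<alpha> = \<gamma> \<and> \<beta> = \<delta>"
proof
  assume eq: "Defs.frac \<alpha> \<beta> = Defs.frac \<gamma> \<delta>"
  have p: "map fst (filter snd (Defs.frac \<alpha> \<beta>)) = \<alpha>" for \<alpha> \<beta> :: "'a list"
    by (simp add: Defs.frac_def filter_map o_def)
  have n: "map fst (filter (\<lambda>x. \<not> snd x) (Defs.frac \<alpha> \<beta>)) = rev \<beta>" for \<alpha> \<beta> :: "'a list"
    by (simp add: Defs.frac_def filter_map o_def)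
  show "\<alpha> = \<gamma> \<and> \<beta> = \<delta>" using p n by (metis eq rev_rev_ident)
qed simp

lemma inv_word_simps [simp]:
  "inv_word [] = []" "inv_word (x # t) = inv_word t @ [inv_letter x]" "inv_word (inv_word t) = t"
  "inv_word (pos_word \<alpha>) = neg_word \<alpha>" "inv_word (neg_word \<alpha>) = pos_word \<alpha>"
  "inv_word (s @ t) = inv_word t @ inv_word s"
  by (simp_all add: inv_word_def pos_word_def neg_word_def rev_map o_def inv_letter_def)

lemma inv_word_frac [simp]: "inv_word (Defs.frac \<alpha> \<beta>) = Defs.frac \<beta> \<alpha>"
  by (simp add: frac_eq)

lemma reduced_inv_word: "reduced t \<Longrightarrow> reduced (inv_word t)"
  unfolding reduced_def inv_word_def successively_rev successively_map
  by (erule successively_mono) auto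

lemma reduced_append: "reduced (s @ t) \<Longrightarrow> reduced s \<and> reduced t"
  by (simp add: reduced_def successively_append_iff)

lemma reduced_pos_word [simp]: "reduced (pos_word \<alpha>)"
  unfolding reduced_def pos_word_def successively_map by (simp add: inv_letter_def successively_conv_nth)

lemma reduced_neg_word [simp]: "reduced (neg_word \<alpha>)"
  by (metis inv_word_simps(4) reduced_inv_word reduced_pos_word)

lemma mult_free_group: "s \<otimes>\<^bsub>free_group L\<^esub> t = foldr cons_reduce s t"
  by (simp add: free_group_def)

lemma mult_reduced: "reduced (s @ t) \<Longrightarrow> s \<otimes>\<^bsub>free_group L\<^esub> t = s @ t"
  unfolding mult_free_group
  by (induction s) (auto simp: reduced_Cons cons_reduce_def)

lemma carrier_free_group: "t \<in> carrier (free_group L) \<longleftrightarrow> t \<in> lists (L \<times> UNIV) \<and> reduced t"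
  by (simp add: free_group_def)

lemma one_free_group [simp]: "\<one>\<^bsub>free_group L\<^esub> = []"
  by (simp add: free_group_def)

lemma inv_word_carrier:
  "t \<in> carrier (free_group L) \<Longrightarrow> inv_word t \<in> carrier (free_group L)"
  by (auto simp: carrier_free_group reduced_inv_word) (auto simp: inv_word_def inv_letter_def)

lemma inv_free_group:
  assumes "t \<in> carrier (free_group L)"
  shows "inv\<^bsub>free_group L\<^esub> t = inv_word t"
proof -
  interpret group "free_group L" by (rule group_free_group)
  \<comment> \<open>Holds for unreduced \<open>w\<close> too: the innermost pair
    \<open>inv_letter x\<close>, \<open>x\<close> cancels first, which leaves the claim for the
    tail.\<close>
  have "foldr cons_reduce (inv_word w) w = []" for w :: "('a \<times> bool) list"
    by (induction w) (simp_all add: inv_word_def cons_reduce_def)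
  then show ?thesis
    using assms inv_word_carrier[OF assms] by (intro inv_equality) (simp_all add: mult_free_group)
qed

lemma pos_word_carrier [simp]: "pos_word \<alpha> \<in> carrier (free_group L) \<longleftrightarrow> \<alpha> \<in> lists L"
  unfolding carrier_free_group by (simp add: in_lists_conv_set) (simp add: pos_word_def)

lemma neg_word_carrier [simp]: "neg_word \<alpha> \<in> carrier (free_group L) \<longleftrightarrow> \<alpha> \<in> lists L"
  unfolding carrier_free_group by (simp add: in_lists_conv_set) (simp add: neg_word_def)

lemma letter_carrier [simp]: "[(a, b)] \<in> carrier (free_group L) \<longleftrightarrow> a \<in> L"
  by (simp add: carrier_free_group reduced_def)

lemma append_carrierD:
  "s @ t \<in> carrier (free_group L) \<Longrightarrow> s \<in> carrier (free_group L) \<and> t \<in> carrier (free_group L)"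
  by (auto simp: carrier_free_group dest: reduced_append)

locale stone_partial_action =
  stone_space X + topological_partial_action "free_group L" X V \<rho>
  for L :: "'l set" and X :: "'x topology"
    and V :: "('l \<times> bool) list \<Rightarrow> 'x set" and \<rho> :: "('l \<times> bool) list \<Rightarrow> 'x \<Rightarrow> 'x" +
  assumes semi_saturated: "semi_saturated L V \<rho>"
    and orthogonal: "orthogonal_action L V"
    and clopen: "\<alpha> \<in> L \<Longrightarrow> openin X (V (gen \<alpha>)) \<and> closedin X (V (gen \<alpha>))"
begin

text \<open>The domain of \<open>\<rho> t\<close>, written with \<open>inv_word\<close> so that it
  computes on concrete lists, unlike the group inverse.\<close>

abbreviation dom :: "('l \<times> bool) list \<Rightarrow> 'x set" where
  "dom t \<equiv> V (inv_word t)"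

lemma V_Nil: "V [] = topspace X"
  using dom_one by simp

lemma V_subset: "t \<in> carrier (free_group L) \<Longrightarrow> V t \<subseteq> topspace X"
  by (simp add: dom_open openin_subset)

lemma homeo_dom:
  "t \<in> carrier (free_group L) \<Longrightarrow> homeomorphic_map (subtopology X (dom t)) (subtopology X (V t)) (\<rho> t)"
  using homeo[of t] by (simp add: inv_free_group)

lemma topspace_subtopology_V: "t \<in> carrier (free_group L) \<Longrightarrow> topspace (subtopology X (V t)) = V t"
  using V_subset by auto

lemma image_dom_V:
  assumes "t \<in> carrier (free_group L)"
  shows "\<rho> t ` dom t = V t"
  using homeomorphic_imp_surjective_map[OF homeo_dom[OF assms]]
  by (simp only: topspace_subtopology_V assms inv_word_carrier)

lemma act_in: "\<lbrakk>t \<in> carrier (free_group L); x \<in> dom t\<rbrakk> \<Longrightarrow> \<rho> t x \<in> V t"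
  using image_dom_V by blast

lemma act_inverse:
  assumes "t \<in> carrier (free_group L)" "x \<in> dom t"
  shows "\<rho> (inv_word t) (\<rho> t x) = x"
proof -
  have x: "x \<in> topspace X" using assms V_subset inv_word_carrier by blast
  have "inv_word t \<otimes>\<^bsub>free_group L\<^esub> t = []"
    using l_inv[OF assms(1)] by (simp add: inv_free_group assms(1))
  then show ?thesis
    using act_mult[of "inv_word t" t x] assms x act_one[of x] V_Nil inv_word_carrier[OF assms(1)]
      inv_free_group[of "[]" L]
    by (simp add: inv_free_group carrier_free_group)
qed

text \<open>The working form of semi-saturation. Membership in the carrier says that
  \<open>s @ t\<close> is reduced, so the product is the concatenation and lengths add.\<close>

lemma dom_append:
  assumes "s @ t \<in> carrier (free_group L)"
  shows "dom (s @ t) = {x \<in> dom t. \<rho> t x \<in> dom s}"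
    and "\<And>x. x \<in> dom (s @ t) \<Longrightarrow> \<rho> (s @ t) x = \<rho> s (\<rho> t x)"
proof -
  have c: "s \<in> carrier (free_group L)" "t \<in> carrier (free_group L)"
    using append_carrierD[OF assms] by auto
  have m: "s \<otimes>\<^bsub>free_group L\<^esub> t = s @ t" using assms by (simp add: mult_reduced carrier_free_group)
  have "{x \<in> V (inv\<^bsub>free_group L\<^esub> t). \<rho> t x \<in> V (inv\<^bsub>free_group L\<^esub> s)} = V (inv\<^bsub>free_group L\<^esub> (s @ t)) \<and>
      (\<forall>x \<in> V (inv\<^bsub>free_group L\<^esub> (s @ t)). \<rho> s (\<rho> t x) = \<rho> (s @ t) x)"
    using semi_saturated[unfolded semi_saturated_def Let_def, rule_format, OF c] unfolding m by simp
  then show "dom (s @ t) = {x \<in> dom t. \<rho> t x \<in> dom s}"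
    and "\<And>x. x \<in> dom (s @ t) \<Longrightarrow> \<rho> (s @ t) x = \<rho> s (\<rho> t x)"
    using assms c by (simp_all only: inv_free_group)
qed

lemma compact_opens_image:
  assumes t: "t \<in> carrier (free_group L)" and A: "A \<in> compact_opens X (dom t)"
  shows "\<rho> t ` A \<in> compact_opens X (V t)"
proof -
  have A': "A \<subseteq> dom t" "openin (subtopology X (dom t)) A" "compactin (subtopology X (dom t)) A"
    using A by (auto simp: compact_opens_def compactin_subtopology subset_openin_subtopology)
  have "A \<subseteq> topspace (subtopology X (dom t))" using A'(2) by (rule openin_subset)
  then have "openin (subtopology X (V t)) (\<rho> t ` A)"
    using homeomorphic_map_openness[OF homeo_dom[OF t]] A'(2) by simp
  moreover have "compactin (subtopology X (V t)) (\<rho> t ` A)"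
    using image_compactin[OF A'(3) homeomorphic_imp_continuous_map[OF homeo_dom[OF t]]] .
  ultimately show ?thesis using dom_open[OF t]
    by (auto simp: compact_opens_def compactin_subtopology openin_open_subtopology)
qed

subsection \<open>The shift\<close>

definition shift_dom :: "'x set" where
  "shift_dom = (\<Union>a\<in>L. V (gen a))"

definition label :: "'x \<Rightarrow> 'l" where
  "label x = (THE a. a \<in> L \<and> x \<in> V (gen a))"

text \<open>The inverse letters glued into one partial map: on \<open>V (gen a)\<close> it is
  \<open>\<rho> [(a, False)]\<close>, since orthogonality makes \<open>label\<close> well defined
  there. Values outside \<open>shift_dom\<close> are meaningless.\<close>

definition shift :: "'x \<Rightarrow> 'x" where
  "shift x = \<rho> [(label x, False)] x"

text \<open>The domain of the n-fold composite of the partial map. As \<open>shift\<close> is a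
  total function, the condition must be imposed on all earlier iterates.\<close>

definition shift_dom_iter :: "nat \<Rightarrow> 'x set" where
  "shift_dom_iter n = {x \<in> topspace X. \<forall>i<n. (shift ^^ i) x \<in> shift_dom}"

lemma label_eq: "\<lbrakk>a \<in> L; x \<in> V (gen a)\<rbrakk> \<Longrightarrow> label x = a"
  unfolding label_def using orthogonal by (intro the_equality) (auto simp: orthogonal_action_def)

lemma shift_in:
  assumes "a \<in> L" "x \<in> V (gen a)"
  shows "shift x \<in> V [(a, False)]" "\<rho> [(a, True)] (shift x) = x" "shift x = \<rho> [(a, False)] x"
proof -
  show s: "shift x = \<rho> [(a, False)] x" using label_eq assms by (simp add: shift_def)
  show "shift x \<in> V [(a, False)]" "\<rho> [(a, True)] (shift x) = x"
    using act_in[of "[(a, False)]" x] act_inverse[of "[(a, False)]" x] assms s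
    by (simp_all add: gen_def)
qed

lemma unshift:
  assumes "a \<in> L" "y \<in> V [(a, False)]"
  shows "\<rho> [(a, True)] y \<in> V (gen a)" "shift (\<rho> [(a, True)] y) = y"
proof -
  show v: "\<rho> [(a, True)] y \<in> V (gen a)"
    using act_in[of "[(a, True)]" y] assms by (simp add: gen_def)
  show "shift (\<rho> [(a, True)] y) = y"
    using act_inverse[of "[(a, True)]" y] assms shift_in(3)[OF assms(1) v] by (simp)
qed

lemma shift_dom_label: "x \<in> shift_dom \<Longrightarrow> label x \<in> L \<and> x \<in> V (gen (label x))"
  unfolding shift_dom_def using label_eq by auto

lemma openin_shift_dom: "openin X shift_dom"
  unfolding shift_dom_def using clopen by auto

lemma shift_dom_subset: "shift_dom \<subseteq> topspace X"
  using openin_shift_dom openin_subset by blast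

lemma shift_topspace: "x \<in> shift_dom \<Longrightarrow> shift x \<in> topspace X"
  using shift_in(1)[of "label x" x] shift_dom_label[of x] V_subset[of "[(label x, False)]"] by auto

lemma shift_iter_topspace:
  assumes "x \<in> shift_dom_iter n" "i \<le> n"
  shows "(shift ^^ i) x \<in> topspace X"
proof (cases i)
  case (Suc j)
  then show ?thesis using assms shift_topspace[of "(shift ^^ j) x"] by (simp add: shift_dom_iter_def)
qed (use assms in \<open>simp add: shift_dom_iter_def\<close>)

lemma shift_dom_iter_0: "shift_dom_iter 0 = topspace X"
  by (simp add: shift_dom_iter_def)

lemma shift_dom_iter_Suc: "x \<in> shift_dom_iter (Suc n) \<longleftrightarrow> x \<in> shift_dom_iter n \<and> (shift ^^ n) x \<in> shift_dom"
  by (auto simp: shift_dom_iter_def less_Suc_eq)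

text \<open>In \<open>neg_word (a # \<alpha>)\<close> the inverse of \<open>a\<close> is the last
  letter, hence the map applied first, and on its domain it is \<open>shift\<close>. Splitting it
  off by \<open>dom_append\<close> drives the induction.\<close>

lemma V_pos_word:
  assumes "\<alpha> \<in> lists L"
  shows "V (pos_word \<alpha>) = {x \<in> topspace X. \<forall>i<length \<alpha>. (shift ^^ i) x \<in> V (gen (\<alpha> ! i))}"
    and "\<And>x. x \<in> V (pos_word \<alpha>) \<Longrightarrow> \<rho> (neg_word \<alpha>) x = (shift ^^ length \<alpha>) x"
proof -
  have "V (pos_word \<alpha>) = {x \<in> topspace X. \<forall>i<length \<alpha>. (shift ^^ i) x \<in> V (gen (\<alpha> ! i))} \<and>
    (\<forall>x. x \<in> V (pos_word \<alpha>) \<longrightarrow> \<rho> (neg_word \<alpha>) x = (shift ^^ length \<alpha>) x)"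
    using assms
  proof (induction \<alpha> rule: list.induct)
    case Nil
    then show ?case using V_Nil act_one by simp
  next
    case (Cons a \<alpha>)
    then have a: "a \<in> L" "\<alpha> \<in> lists L" by auto
    note IH = Cons.IH[OF a(2), THEN conjunct1, THEN set_eq_iff[THEN iffD1], rule_format, unfolded mem_Collect_eq]
      Cons.IH[OF a(2), THEN conjunct2, rule_format]
    have "neg_word (a # \<alpha>) \<in> carrier (free_group L)" using Cons.prems by (simp only: neg_word_carrier)
    then have c: "neg_word \<alpha> @ [(a, False)] \<in> carrier (free_group L)" by (simp only: neg_word_simps)
    note d = dom_append[OF c]
    have eq: "dom [(a, False)] = V (gen a)" "dom (neg_word \<alpha>) = V (pos_word \<alpha>)"
      "dom (neg_word \<alpha> @ [(a, False)]) = V (pos_word (a # \<alpha>))"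
      by (simp_all add: gen_def)
    have sh: "shift x = \<rho> [(a, False)] x" if "x \<in> V (gen a)" for x
      by (rule shift_in(3)[OF a(1) that])
    have V1: "V (pos_word (a # \<alpha>)) = {x \<in> V (gen a). shift x \<in> V (pos_word \<alpha>)}"
      using d(1) sh unfolding eq by auto
    have V2: "\<rho> (neg_word (a # \<alpha>)) x = \<rho> (neg_word \<alpha>) (shift x)" if "x \<in> V (pos_word (a # \<alpha>))" for x
      using d(2)[of x] that sh[of x] V1 unfolding eq neg_word_simps by auto
    have top: "V (gen a) \<subseteq> topspace X" using a(1) clopen openin_subset by blast
    have "x \<in> V (pos_word (a # \<alpha>)) \<longleftrightarrow>
        x \<in> topspace X \<and> (\<forall>i<length (a # \<alpha>). (shift ^^ i) x \<in> V (gen ((a # \<alpha>) ! i)))" for x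
    proof -
      have "shift x \<in> topspace X" if "x \<in> V (gen a)"
        using that shift_in(1)[OF a(1)] V_subset[of "[(a, False)]"] a(1) by auto
      moreover have "(\<forall>i<length (a # \<alpha>). (shift ^^ i) x \<in> V (gen ((a # \<alpha>) ! i))) \<longleftrightarrow>
          x \<in> V (gen a) \<and> (\<forall>i<length \<alpha>. (shift ^^ i) (shift x) \<in> V (gen (\<alpha> ! i)))"
        by (simp add: All_less_Suc2 funpow_swap1)
      ultimately show ?thesis using IH(1) top unfolding V1 by blast
    qed
    moreover have "\<rho> (neg_word (a # \<alpha>)) x = (shift ^^ length (a # \<alpha>)) x" if "x \<in> V (pos_word (a # \<alpha>))" for x
    proof -
      have "\<rho> (neg_word \<alpha>) (shift x) = (shift ^^ length \<alpha>) (shift x)" using that V1 IH(2) by blast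
      then show ?thesis using V2[OF that] by (simp add: funpow_swap1)
    qed
    ultimately show ?case by blast
  qed
  then show "V (pos_word \<alpha>) = {x \<in> topspace X. \<forall>i<length \<alpha>. (shift ^^ i) x \<in> V (gen (\<alpha> ! i))}"
    and "\<And>x. x \<in> V (pos_word \<alpha>) \<Longrightarrow> \<rho> (neg_word \<alpha>) x = (shift ^^ length \<alpha>) x" by blast+
qed

text \<open>Orthogonality turns membership of an iterate in \<open>V (gen a)\<close> into an
  equation for its label, so a positive word prescribes an itinerary.\<close>

lemma V_pos_word_label:
  assumes "\<alpha> \<in> lists L"
  shows "x \<in> V (pos_word \<alpha>) \<longleftrightarrow>
    x \<in> shift_dom_iter (length \<alpha>) \<and> (\<forall>i<length \<alpha>. label ((shift ^^ i) x) = \<alpha> ! i)"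
proof -
  have "\<alpha> ! i \<in> L" if "i < length \<alpha>" for i using assms that by auto
  then have "(shift ^^ i) x \<in> V (gen (\<alpha> ! i)) \<longleftrightarrow>
      (shift ^^ i) x \<in> shift_dom \<and> label ((shift ^^ i) x) = \<alpha> ! i" if "i < length \<alpha>" for i
    using that label_eq shift_dom_label unfolding shift_dom_def by (metis UN_I)
  then show ?thesis using V_pos_word(1)[OF assms] by (auto simp: shift_dom_iter_def)
qed

lemma V_neg_word_Cons:
  assumes "a # \<alpha> \<in> lists L"
  shows "V (neg_word (a # \<alpha>)) = {y \<in> V (neg_word \<alpha>). \<rho> (pos_word \<alpha>) y \<in> V [(a, False)]}"
    and "\<And>y. y \<in> V (neg_word (a # \<alpha>)) \<Longrightarrow>
      \<rho> (pos_word (a # \<alpha>)) y = \<rho> [(a, True)] (\<rho> (pos_word \<alpha>) y)"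
proof -
  have c: "[(a, True)] @ pos_word \<alpha> \<in> carrier (free_group L)"
    using pos_word_carrier[of "a # \<alpha>" L] assms by simp
  show "V (neg_word (a # \<alpha>)) = {y \<in> V (neg_word \<alpha>). \<rho> (pos_word \<alpha>) y \<in> V [(a, False)]}"
    and "\<And>y. y \<in> V (neg_word (a # \<alpha>)) \<Longrightarrow>
      \<rho> (pos_word (a # \<alpha>)) y = \<rho> [(a, True)] (\<rho> (pos_word \<alpha>) y)"
    using dom_append[OF c] by (simp_all add: inv_letter_def)
qed

lemma unshift_word:
  assumes "\<alpha> \<in> lists L" "y \<in> V (neg_word \<alpha>)"
  shows "\<rho> (pos_word \<alpha>) y \<in> V (pos_word \<alpha>)" "(shift ^^ length \<alpha>) (\<rho> (pos_word \<alpha>) y) = y"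
proof -
  show v: "\<rho> (pos_word \<alpha>) y \<in> V (pos_word \<alpha>)"
    using act_in[of "pos_word \<alpha>" y] assms by simp
  show "(shift ^^ length \<alpha>) (\<rho> (pos_word \<alpha>) y) = y"
    using V_pos_word(2)[OF assms(1) v] act_inverse[of "pos_word \<alpha>" y] assms by simp
qed

text \<open>\<open>dom_append\<close> cuts the reduced word at its turning point:
  \<open>length \<beta>\<close> shifts, then the inverse branch along \<open>\<alpha>\<close>. These
  match the two stages, removing and adding edges, of \<open>\<phi>_act\<close>.\<close>

lemma dom_frac:
  assumes "Defs.frac \<alpha> \<beta> \<in> carrier (free_group L)"
  shows "V (Defs.frac \<beta> \<alpha>) = {x \<in> V (pos_word \<beta>). (shift ^^ length \<beta>) x \<in> V (neg_word \<alpha>)}"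
    and "\<And>x. x \<in> V (Defs.frac \<beta> \<alpha>) \<Longrightarrow>
      \<rho> (Defs.frac \<alpha> \<beta>) x = \<rho> (pos_word \<alpha>) ((shift ^^ length \<beta>) x)"
proof -
  note c = assms[unfolded frac_eq]
  have b: "\<beta> \<in> lists L" using append_carrierD[OF c] by simp
  have *: "V (Defs.frac \<beta> \<alpha>) = {x \<in> V (pos_word \<beta>). \<rho> (neg_word \<beta>) x \<in> V (neg_word \<alpha>)}"
    using dom_append(1)[OF c] by (simp add: frac_eq)
  then show "V (Defs.frac \<beta> \<alpha>) = {x \<in> V (pos_word \<beta>). (shift ^^ length \<beta>) x \<in> V (neg_word \<alpha>)}"
    using V_pos_word(2)[OF b] by auto
  show "\<rho> (Defs.frac \<alpha> \<beta>) x = \<rho> (pos_word \<alpha>) ((shift ^^ length \<beta>) x)" if "x \<in> V (Defs.frac \<beta> \<alpha>)" for x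
    using dom_append(2)[OF c, of x] that * V_pos_word(2)[OF b, of x] by (simp add: frac_eq)
qed

text \<open>A reduced word that is not of the form \<open>\<alpha>\<beta>\<inverse>\<close> has a factor \<open>a\<inverse>b\<close> with \<open>a \<noteq> b\<close>, whose
  domain is empty by orthogonality.\<close>

lemma dom_nonempty_frac:
  assumes "t \<in> carrier (free_group L)" "dom t \<noteq> {}"
  shows "\<exists>\<alpha> \<beta>. t = Defs.frac \<alpha> \<beta>"
  using assms
proof (induction t)
  case Nil
  show ?case by (rule exI[of _ "[]"], rule exI[of _ "[]"]) (simp add: frac_eq)
next
  case (Cons x w)
  have c: "[x] @ w \<in> carrier (free_group L)" using Cons.prems by simp
  have w: "w \<in> carrier (free_group L)" using append_carrierD[OF c] by simp
  obtain y where y: "y \<in> dom w" "\<rho> w y \<in> dom [x]"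
    using dom_append(1)[OF c] Cons.prems(2) by auto
  then obtain \<alpha> \<beta> where \<alpha>: "w = Defs.frac \<alpha> \<beta>" using Cons.IH[OF w] by blast
  obtain a p where x: "x = (a, p)" by fastforce
  have aL: "a \<in> L" using append_carrierD[OF c] x by simp
  show ?case
  proof (cases p)
    case True
    then have "x # w = Defs.frac (a # \<alpha>) \<beta>" using \<alpha> x by (simp add: frac_eq)
    then show ?thesis by blast
  next
    case False
    show ?thesis
    proof (cases \<alpha>)
      case Nil
      then have "x # w = Defs.frac [] (\<beta> @ [a])" using \<alpha> x False by (simp add: frac_eq)
      then show ?thesis by blast
    next
      case (Cons c \<alpha>')
      then have w': "w = [(c, True)] @ Defs.frac \<alpha>' \<beta>" using \<alpha> by (simp add: frac_eq)
      have "c \<noteq> a" using \<open>[x] @ w \<in> _\<close> w' x False by (auto simp: carrier_free_group reduced_Cons inv_letter_def)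
      moreover have cL: "c \<in> L" using w w' append_carrierD by fastforce
      moreover have "\<rho> w y \<in> V (gen c)"
        using dom_append[of "[(c, True)]" "Defs.frac \<alpha>' \<beta>"] w w' y(1)
          act_in[of "[(c, True)]" "\<rho> (Defs.frac \<alpha>' \<beta>) y"] cL by (auto simp: gen_def)
      moreover have "\<rho> w y \<in> V (gen a)" using y(2) x False by (simp add: inv_letter_def gen_def)
      ultimately show ?thesis using orthogonal aL unfolding orthogonal_action_def by blast
    qed
  qed
qed

section \<open>The Boolean dynamical system of a partial action\<close>


text \<open>A preimage, so that the homomorphism laws are immediate; \<open>pull_eq_image\<close>
  recovers the image form, which gives compactness.\<close>

definition pull :: "'l \<Rightarrow> 'x set \<Rightarrow> 'x set" where
  "pull a A = {y \<in> V [(a, False)]. \<rho> [(a, True)] y \<in> A}"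

lemma pull_eq_image:
  assumes "a \<in> L"
  shows "pull a A = \<rho> [(a, False)] ` (A \<inter> V (gen a))"
proof -
  have "y \<in> shift ` (A \<inter> V (gen a))" if "y \<in> pull a A" for y
    using that unshift[OF assms, of y] by (auto simp: pull_def image_iff intro!: bexI[of _ "\<rho> [(a, True)] y"])
  then have "pull a A = shift ` (A \<inter> V (gen a))"
    using shift_in(1,2)[OF assms] by (auto simp: pull_def)
  then show ?thesis using shift_in(3)[OF assms] by auto
qed

lemma pull_compact_opens:
  assumes a: "a \<in> L" and A: "A \<in> compact_opens X T"
  shows "pull a A \<in> compact_opens X (V [(a, False)])"
proof -
  have "A \<inter> V (gen a) \<in> compact_opens X (V (gen a))"
    using A clopen[OF a] by (auto simp: compact_opens_def compact_Int_closedin)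
  then show ?thesis
    using compact_opens_image[of "[(a, False)]" "A \<inter> V (gen a)"] a
    by (simp add: pull_eq_image gen_def)
qed

lemma compact_opens_mono: "\<lbrakk>A \<in> compact_opens X S; S \<subseteq> T\<rbrakk> \<Longrightarrow> A \<in> compact_opens X T"
  by (auto simp: compact_opens_def)

lemma ba_action_pull:
  assumes "a \<in> L"
  shows "ba_action (co_algebra X (topspace X)) (pull a)"
proof -
  have "pull a A \<in> compact_opens X (topspace X)" if "A \<in> compact_opens X (topspace X)" for A
    using pull_compact_opens[OF assms that] V_subset[of "[(a, False)]"] assms compact_opens_mono by simp
  then show ?thesis unfolding ba_action_def co_algebra_simps by (auto simp: pull_def)
qed

sublocale bds: boolean_dynamical_system "co_algebra X (topspace X)" L pull
  by (rule boolean_dynamical_system.intro[OF gen_boolean_algebra_co_algebra])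
    (simp add: boolean_dynamical_system_axioms_def ba_action_pull)

text \<open>For the inclusion from right to left, the witness for \<open>A\<close> is its own image
  under \<open>\<rho> [(a, True)]\<close>.\<close>

lemma range_ideal: "a \<in> L \<Longrightarrow> bds.range_ideal a = compact_opens X (V [(a, False)])"
proof (intro equalityI subsetI)
  fix A assume a: "a \<in> L" and "A \<in> bds.range_ideal a"
  then show "A \<in> compact_opens X (V [(a, False)])"
    by (auto simp: bds.range_ideal_def compact_opens_def pull_def)
next
  fix A assume a: "a \<in> L" and A: "A \<in> compact_opens X (V [(a, False)])"
  have "\<rho> [(a, True)] ` A \<in> compact_opens X (V [(a, True)])"
    using compact_opens_image[of "[(a, True)]" A] a A by simp
  then have "\<rho> [(a, True)] ` A \<in> compact_opens X (topspace X)"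
    using compact_opens_mono V_subset[of "[(a, True)]"] a by auto
  moreover have "A \<subseteq> pull a (\<rho> [(a, True)] ` A)" using A by (auto simp: pull_def compact_opens_def)
  moreover have "A \<in> compact_opens X (topspace X)"
    using A V_subset[of "[(a, False)]"] a compact_opens_mono by auto
  ultimately show "A \<in> bds.range_ideal a" unfolding bds.range_ideal_def by auto
qed

text \<open>\<open>fold\<close> applies \<open>pull\<close> for the first letter first, so the
  induction hypothesis is needed at \<open>pull a B\<close>.\<close>

lemma \<theta>_word: "\<alpha> \<in> lists L \<Longrightarrow> B \<subseteq> topspace X \<Longrightarrow>
  bds.\<theta>_word \<alpha> B = {y \<in> V (neg_word \<alpha>). \<rho> (pos_word \<alpha>) y \<in> B}"
proof (induction \<alpha> arbitrary: B rule: list.induct)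
  case Nil
  then show ?case using V_Nil act_one by (auto simp: bds.\<theta>_word_def)
next
  case (Cons a \<alpha>)
  then have a: "a \<in> L" "\<alpha> \<in> lists L" by auto
  have "pull a B \<subseteq> topspace X" using V_subset[of "[(a, False)]"] a(1) by (auto simp: pull_def)
  then have "bds.\<theta>_word (a # \<alpha>) B = {y \<in> V (neg_word \<alpha>). \<rho> (pos_word \<alpha>) y \<in> pull a B}"
    using Cons.IH[OF a(2)] by (simp add: bds.\<theta>_word_def)
  then show ?case
    using V_neg_word_Cons[OF Cons.prems(1)] unfolding pull_def by auto
qed

text \<open>Makes \<open>X_space \<alpha>\<close> a copy of \<open>V (neg_word \<alpha>)\<close>.
  For a given \<open>A\<close> the witness in \<open>range_ideal a\<close> is the image of
  \<open>A\<close> under the rest of the word, which lies in \<open>V [(a, False)]\<close> by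
  \<open>V_neg_word_Cons\<close>.\<close>

lemma word_ideal: "\<alpha> \<in> lists L \<Longrightarrow> bds.word_ideal \<alpha> = compact_opens X (V (neg_word \<alpha>))"
proof (cases \<alpha>)
  case Nil
  then show ?thesis using V_Nil by simp
next
  case (Cons a \<alpha>')
  assume "\<alpha> \<in> lists L"
  then have a: "a \<in> L" "\<alpha>' \<in> lists L" "a # \<alpha>' \<in> lists L" using Cons by auto
  note V = V_neg_word_Cons[OF a(3)]
  have sub: "B \<subseteq> topspace X" if "B \<in> compact_opens X (V [(a, False)])" for B
    using that by (auto simp: compact_opens_def compactin_subset_topspace openin_subset)
  have neg: "V (neg_word (a # \<alpha>')) \<subseteq> V (neg_word \<alpha>')" using V(1) by auto
  have top: "V (neg_word (a # \<alpha>')) \<subseteq> topspace X" using V_subset[of "neg_word (a # \<alpha>')"] a(3) by (simp only: neg_word_carrier)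
  have "A \<in> bds.word_ideal (a # \<alpha>') \<longleftrightarrow> A \<in> compact_opens X (V (neg_word (a # \<alpha>')))" for A
  proof
    assume "A \<in> bds.word_ideal (a # \<alpha>')"
    then obtain B where B: "A \<in> compact_opens X (topspace X)" "B \<in> compact_opens X (V [(a, False)])"
      "A \<subseteq> bds.\<theta>_word \<alpha>' B"
      by (auto simp: range_ideal[OF a(1)])
    have "A \<subseteq> V (neg_word (a # \<alpha>'))"
      using B(2,3) unfolding V(1) \<theta>_word[OF a(2) sub[OF B(2)]] by (auto simp: compact_opens_def)
    then show "A \<in> compact_opens X (V (neg_word (a # \<alpha>')))"
      using B(1) by (auto simp: compact_opens_def)
  next
    assume A: "A \<in> compact_opens X (V (neg_word (a # \<alpha>')))"
    let ?B = "\<rho> (pos_word \<alpha>') ` A"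
    have "A \<in> compact_opens X (dom (pos_word \<alpha>'))" using A neg compact_opens_mono by simp
    then have "?B \<in> compact_opens X (V (pos_word \<alpha>'))" using compact_opens_image a(2) by simp
    moreover have "?B \<subseteq> V [(a, False)]" using A V(1) by (auto simp: compact_opens_def)
    ultimately have B: "?B \<in> compact_opens X (V [(a, False)])" by (auto simp: compact_opens_def)
    have "A \<subseteq> bds.\<theta>_word \<alpha>' ?B"
      using A neg unfolding \<theta>_word[OF a(2) sub[OF B]] by (auto simp: compact_opens_def)
    moreover have "A \<in> compact_opens X (topspace X)" using A top compact_opens_mono by blast
    ultimately show "A \<in> bds.word_ideal (a # \<alpha>')" using B by (auto simp: range_ideal[OF a(1)])
  qed
  then show ?thesis using Cons by blast
qed

lemma X_space: "\<alpha> \<in> lists L \<Longrightarrow> bds.X_space \<alpha> = stone_dual (co_algebra X (V (neg_word \<alpha>)))"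
  by (simp add: bds.X_space_def word_ideal)

lemma V_neg_word_empty_iff: "\<beta> \<in> lists L \<Longrightarrow> V (neg_word \<beta>) = {} \<longleftrightarrow> V (pos_word \<beta>) = {}"
  using image_dom_V[of "pos_word \<beta>"] by auto

text \<open>The base puts a nonempty compact open set into any nonempty open one, so the ideal is
  nonzero iff \<open>V (neg_word \<alpha>)\<close> is nonempty; and
  \<open>\<rho> (pos_word \<alpha>)\<close> maps that set onto
  \<open>V (pos_word \<alpha>)\<close>.\<close>

lemma words_iff:
  assumes "\<alpha> \<in> lists L"
  shows "\<alpha> \<in> bds.words \<longleftrightarrow> V (pos_word \<alpha>) \<noteq> {}"
proof -
  have "compact_opens X (V (neg_word \<alpha>)) \<noteq> {{}} \<longleftrightarrow> V (neg_word \<alpha>) \<noteq> {}"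
  proof
    assume "V (neg_word \<alpha>) \<noteq> {}"
    then obtain y where "y \<in> V (neg_word \<alpha>)" by blast
    then obtain K where "K \<in> compact_opens X (V (neg_word \<alpha>))" "y \<in> K"
      using compact_openE[of "V (neg_word \<alpha>)" y] dom_open[of "neg_word \<alpha>"] assms by auto
    then show "compact_opens X (V (neg_word \<alpha>)) \<noteq> {{}}" by blast
  next
    assume "compact_opens X (V (neg_word \<alpha>)) \<noteq> {{}}"
    then show "V (neg_word \<alpha>) \<noteq> {}" using empty_compact_opens by (auto simp: compact_opens_def)
  qed
  then show ?thesis using assms by (simp add: bds.words_def word_ideal V_neg_word_empty_iff)
qed

subsection \<open>Vertices and edges\<close>

abbreviation pt :: "'x \<Rightarrow> 'x set set" where
  "pt \<equiv> point_filter X (topspace X)"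

text \<open>Indexes edges by their range in \<open>X\<close> instead of by label and ultrafilter:
  the edge with label a over a point y of \<open>V [(a, False)]\<close> is that of
  \<open>x = \<rho> [(a, True)] y\<close>, for which \<open>shift x\<close> is y.\<close>

definition edge :: "'x \<Rightarrow> 'l \<times> 'x set set" where
  "edge x = (label x, point_filter X (V [(label x, False)]) (shift x))"

text \<open>Inverse of \<open>edge\<close>: it recovers the point of \<open>V [(a, False)]\<close>
  from the ultrafilter and moves it by \<open>\<rho>\<close>. In the graph convention the result is
  the range of the edge, where the orbit starts.\<close>

definition edge_source :: "'l \<times> 'x set set \<Rightarrow> 'x" where
  "edge_source e = \<rho> [(fst e, True)]
     (inv_into (V [(fst e, False)]) (point_filter X (V [(fst e, False)])) (snd e))"

lemma homeomorphic_map_pt: "homeomorphic_map X bds.E0 pt"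
  using homeomorphic_map_point_filter[of "topspace X"] X_space[of "[]"] V_Nil
  by (simp add: bds.E0_def)

lemma topspace_E0: "topspace bds.E0 = pt ` topspace X"
  using homeomorphic_imp_surjective_map[OF homeomorphic_map_pt] by simp

lemma inj_pt: "inj_on pt (topspace X)"
  by (simp add: inj_point_filter)

lemma pt_eq_iff: "\<lbrakk>x \<in> topspace X; y \<in> topspace X\<rbrakk> \<Longrightarrow> pt x = pt y \<longleftrightarrow> x = y"
  using inj_pt by (simp add: inj_on_eq_iff)

lemma X_space_letter: "a \<in> L \<Longrightarrow> bds.X_space [a] = stone_dual (co_algebra X (V [(a, False)]))"
  using X_space[of "[a]"] by simp

lemma homeomorphic_map_letter:
  assumes "a \<in> L"
  shows "homeomorphic_map (subtopology X (V [(a, False)])) (bds.X_space [a]) (point_filter X (V [(a, False)]))"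
  using homeomorphic_map_point_filter[of "V [(a, False)]"] dom_open[of "[(a, False)]"] assms
  by (simp add: X_space_letter)

lemma topspace_X_space_letter:
  assumes "a \<in> L"
  shows "topspace (bds.X_space [a]) = point_filter X (V [(a, False)]) ` V [(a, False)]"
  using homeomorphic_imp_surjective_map[OF homeomorphic_map_letter[OF assms]]
    topspace_subtopology_V[of "[(a, False)]"] assms by simp

lemma edge_source_edge:
  assumes "x \<in> shift_dom"
  shows "edge_source (edge x) = x"
proof -
  have l: "label x \<in> L" "x \<in> V (gen (label x))" using shift_dom_label assms by auto
  have "inj_on (point_filter X (V [(label x, False)])) (V [(label x, False)])"
    using inj_point_filter dom_open l(1) by simp
  then show ?thesis using shift_in[OF l] by (simp add: edge_source_def edge_def)
qed

lemma topspace_E1: "topspace bds.E1 = edge ` shift_dom"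
proof (intro equalityI subsetI)
  fix e assume "e \<in> topspace bds.E1"
  then obtain a y where e: "a \<in> L" "y \<in> V [(a, False)]" "e = (a, point_filter X (V [(a, False)]) y)"
    by (auto simp: bds.E1_def topspace_X_space_letter)
  then have "e = edge (\<rho> [(a, True)] y)" using unshift[OF e(1,2)] label_eq[OF e(1)] by (simp add: edge_def)
  then show "e \<in> edge ` shift_dom" using unshift(1)[OF e(1,2)] e(1) by (auto simp: shift_dom_def)
next
  fix e assume "e \<in> edge ` shift_dom"
  then obtain x where x: "x \<in> shift_dom" "e = edge x" by blast
  then show "e \<in> topspace bds.E1"
    using shift_in(1)[of "label x" x] shift_dom_label[OF x(1)]
    by (auto simp: bds.E1_def topspace_X_space_letter edge_def)
qed

text \<open>With a the label of \<open>x\<close>: \<open>pull a A\<close> contains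
  \<open>shift x\<close> iff \<open>A\<close> contains \<open>\<rho> [(a, True)] (shift x)\<close>,
  which is \<open>x\<close>.\<close>

lemma r_edge_edge:
  assumes "x \<in> shift_dom"
  shows "bds.r_edge (edge x) = pt x"
proof -
  have l: "label x \<in> L" "x \<in> V (gen (label x))" using shift_dom_label assms by auto
  then show ?thesis
    using shift_in[OF l] pull_compact_opens[OF l(1)]
    by (auto simp: bds.r_edge_def bds.f_empty_def edge_def point_filter_def pull_def)
qed

text \<open>The ultrafilter of the ideal generates one of the whole algebra: every compact open set
  around \<open>shift x\<close> contains a smaller one inside the open set
  \<open>V [(label x, False)]\<close>.\<close>

lemma d_edge_edge:
  assumes "x \<in> shift_dom"
  shows "bds.d_edge (edge x) = pt (shift x)"
proof -
  have l: "label x \<in> L" "x \<in> V (gen (label x))" using shift_dom_label assms by auto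
  let ?V = "V [(label x, False)]"
  have s: "shift x \<in> ?V" using shift_in(1)[OF l] .
  have o: "openin X ?V" using dom_open l(1) by simp
  have "\<exists>A. A \<in> compact_opens X ?V \<and> shift x \<in> A \<and> A \<subseteq> B"
    if B: "B \<in> compact_opens X (topspace X)" "shift x \<in> B" for B
  proof -
    have "openin X (?V \<inter> B)" using B(1) o by (auto simp: compact_opens_def)
    then obtain K where "K \<in> compact_opens X (?V \<inter> B)" "shift x \<in> K"
      using compact_openE[of "?V \<inter> B" "shift x"] s B(2) by blast
    then show ?thesis by (auto simp: compact_opens_def)
  qed
  then show ?thesis by (auto simp: bds.d_edge_def edge_def point_filter_def)
qed

section \<open>Continuity of the shift and of the correspondence between points and edges\<close>

lemma continuous_map_shift: "continuous_map (subtopology X shift_dom) X shift"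
proof (rule pasting_lemma[where I = L and T = "\<lambda>a. V (gen a)" and f = "\<lambda>a. \<rho> [(a, False)]"])
  fix a assume a: "a \<in> L"
  have sub: "V (gen a) \<subseteq> shift_dom" using a by (auto simp: shift_dom_def)
  then show "openin (subtopology X shift_dom) (V (gen a))"
    using clopen[OF a] openin_shift_dom by (simp add: openin_open_subtopology)
  have "subtopology (subtopology X shift_dom) (V (gen a)) = subtopology X (V (gen a))"
    using sub by (simp add: subtopology_subtopology inf.absorb2)
  moreover have "continuous_map (subtopology X (V (gen a))) X (\<rho> [(a, False)])"
    using homeomorphic_imp_continuous_map[OF homeo_dom[of "[(a, False)]"]] a
    by (simp add: gen_def continuous_map_in_subtopology)
  ultimately show "continuous_map (subtopology (subtopology X shift_dom) (V (gen a))) X (\<rho> [(a, False)])"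
    by simp
next
  fix a b x assume "a \<in> L" "b \<in> L" "x \<in> topspace (subtopology X shift_dom) \<inter> V (gen a) \<inter> V (gen b)"
  then show "\<rho> [(a, False)] x = \<rho> [(b, False)] x" using label_eq by (metis IntE)
next
  fix x assume "x \<in> topspace (subtopology X shift_dom)"
  then have "x \<in> shift_dom" by simp
  then show "\<exists>j. j \<in> L \<and> x \<in> V (gen j) \<and> shift x = \<rho> [(j, False)] x"
    using shift_dom_label by (auto simp: shift_def)
qed

lemma continuous_map_edge: "continuous_map (subtopology X shift_dom) bds.E1 edge"
proof (rule pasting_lemma[where I = L and T = "\<lambda>a. V (gen a)"
      and f = "\<lambda>a x. (a, point_filter X (V [(a, False)]) (shift x))"])
  fix a assume a: "a \<in> L"
  have sub: "V (gen a) \<subseteq> shift_dom" using a by (auto simp: shift_dom_def)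
  then show "openin (subtopology X shift_dom) (V (gen a))"
    using clopen[OF a] openin_shift_dom by (simp add: openin_open_subtopology)
  have eq: "subtopology (subtopology X shift_dom) (V (gen a)) = subtopology X (V (gen a))"
    using sub by (simp add: subtopology_subtopology inf.absorb2)
  have "continuous_map (subtopology X (V (gen a))) X shift"
    using continuous_map_from_subtopology_mono[OF continuous_map_shift sub] .
  then have "continuous_map (subtopology X (V (gen a))) (subtopology X (V [(a, False)])) shift"
    using shift_in(1)[OF a] by (auto intro!: continuous_map_into_subtopology)
  then have "continuous_map (subtopology X (V (gen a))) (bds.X_space [a]) (point_filter X (V [(a, False)]) \<circ> shift)"
    using homeomorphic_imp_continuous_map[OF homeomorphic_map_letter[OF a]] by (rule continuous_map_compose)
  then have "continuous_map (subtopology X (V (gen a))) bds.E1 (Pair a \<circ> (point_filter X (V [(a, False)]) \<circ> shift))"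
    unfolding bds.E1_def using continuous_map_component_injection[of a L "\<lambda>\<alpha>. bds.X_space [\<alpha>]"] a
    by (rule_tac continuous_map_compose) auto
  then show "continuous_map (subtopology (subtopology X shift_dom) (V (gen a))) bds.E1
      (\<lambda>x. (a, point_filter X (V [(a, False)]) (shift x)))"
    unfolding eq by (simp add: o_def)
next
  fix a b x assume "a \<in> L" "b \<in> L" "x \<in> topspace (subtopology X shift_dom) \<inter> V (gen a) \<inter> V (gen b)"
  then have "a = b" using label_eq by (metis IntE)
  then show "(a, point_filter X (V [(a, False)]) (shift x)) = (b, point_filter X (V [(b, False)]) (shift x))"
    by simp
next
  fix x assume "x \<in> topspace (subtopology X shift_dom)"
  then have "x \<in> shift_dom" by simp
  then show "\<exists>j. j \<in> L \<and> x \<in> V (gen j) \<and> edge x = (j, point_filter X (V [(j, False)]) (shift x))"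
    using shift_dom_label by (auto simp: edge_def)
qed

lemma continuous_map_edge_source: "continuous_map bds.E1 X edge_source"
  unfolding continuous_map_def
proof (intro conjI allI impI)
  show "edge_source \<in> topspace bds.E1 \<rightarrow> topspace X"
    unfolding topspace_E1 using edge_source_edge shift_dom_subset by auto
next
  fix U assume U: "openin X U"
  have "openin (bds.X_space [a]) {\<eta>. (a, \<eta>) \<in> {e \<in> topspace bds.E1. edge_source e \<in> U}}" if a: "a \<in> L" for a
  proof -
    let ?p = "point_filter X (V [(a, False)])"
    have o: "openin X (V [(a, False)])" using dom_open a by simp
    have p: "inj_on ?p (V [(a, False)])" using inj_point_filter o by blast
    have "continuous_map (subtopology X (V [(a, False)])) X (\<rho> [(a, True)])"
      using homeomorphic_imp_continuous_map[OF homeo_dom[of "[(a, True)]"]] a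
      by (simp add: continuous_map_in_subtopology)
    then have "openin (subtopology X (V [(a, False)])) {y \<in> V [(a, False)]. \<rho> [(a, True)] y \<in> U}"
      using openin_continuous_map_preimage[OF _ U, of "subtopology X (V [(a, False)])" "\<rho> [(a, True)]"]
        topspace_subtopology_V[of "[(a, False)]"] a by (simp del: topspace_subtopology)
    then have "openin (bds.X_space [a]) (?p ` {y \<in> V [(a, False)]. \<rho> [(a, True)] y \<in> U})"
      using homeomorphic_map_openness[OF homeomorphic_map_letter[OF a]] openin_subset by blast
    moreover have "{\<eta>. (a, \<eta>) \<in> {e \<in> topspace bds.E1. edge_source e \<in> U}} =
        ?p ` {y \<in> V [(a, False)]. \<rho> [(a, True)] y \<in> U}"
      using a p by (auto simp: bds.E1_def topspace_X_space_letter edge_source_def)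
    ultimately show ?thesis by simp
  qed
  then show "openin bds.E1 {e \<in> topspace bds.E1. edge_source e \<in> U}"
    unfolding bds.E1_def openin_sum_topology by (auto simp: bds.E1_def)
qed

section \<open>The boundary path space\<close>


lemma pt_nonempty: "x \<in> topspace X \<Longrightarrow> pt x \<noteq> {}"
  using compact_openE[of "topspace X" x] by (auto simp: point_filter_def)

lemma empty_notin_E0: "{} \<notin> topspace bds.E0"
  using pt_nonempty by (auto simp: topspace_E0)

text \<open>With \<open>openin_E0_F0\<close> this makes \<open>E0\<close> an open subspace of
  \<open>F0\<close> in both cases of the definition, so the added point causes no further case
  split.\<close>

lemma openin_F0_E0:
  assumes Z: "openin bds.E0 Z"
  shows "openin bds.F0 Z"
proof (cases "unital (co_algebra X (topspace X))")
  case True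
  then show ?thesis unfolding bds.F0_def using Z by (simp add: topology_generated_by_Basis)
next
  case False
  have "Z \<subseteq> topspace bds.E0" using Z openin_subset by blast
  then have "Z = (\<lambda>\<xi>. if \<xi> = {} then None else Some \<xi>) -` (Some ` Z) \<inter> insert {} (topspace bds.E0)"
    using empty_notin_E0 by (auto split: if_splits)
  then show ?thesis unfolding bds.F0_def using Z False
    by (auto simp: openin_pullback_topology intro!: exI[of _ "Some ` Z"])
qed

lemma openin_E0_F0:
  assumes Z: "openin bds.F0 Z"
  shows "openin bds.E0 (Z \<inter> topspace bds.E0)"
proof (cases "unital (co_algebra X (topspace X))")
  case True
  then have "generate_topology_on (insert {{}} {W. openin bds.E0 W}) Z"
    using Z by (simp add: bds.F0_def openin_topology_generated_by_iff)
  then show ?thesis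
  proof (induction rule: generate_topology_on.induct)
    case (Int a b)
    then show ?case using openin_Int[of bds.E0 "a \<inter> topspace bds.E0" "b \<inter> topspace bds.E0"]
      by (simp add: Int_ac)
  next
    case (UN K)
    have "\<Union>K \<inter> topspace bds.E0 = \<Union>((\<lambda>k. k \<inter> topspace bds.E0) ` K)" by blast
    moreover have "openin bds.E0 (\<Union>((\<lambda>k. k \<inter> topspace bds.E0) ` K))"
      by (rule openin_Union) (use UN in blast)
    ultimately show ?case by (simp only:)
  next
    case (Basis s)
    then show ?case using empty_notin_E0 by auto
  qed simp
next
  case False
  then obtain U where U: "openin (Alexandroff_compactification bds.E0) U"
    "Z = (\<lambda>\<xi>. if \<xi> = {} then None else Some \<xi>) -` U \<inter> insert {} (topspace bds.E0)"
    using Z by (auto simp: bds.F0_def openin_pullback_topology)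
  have "Z \<inter> topspace bds.E0 = {\<xi> \<in> topspace bds.E0. Some \<xi> \<in> U}"
    using U(2) empty_notin_E0 by (auto split: if_splits)
  then show ?thesis using openin_continuous_map_preimage[OF continuous_map_Some U(1)] by simp
qed

lemma topspace_E0_subset_F0: "topspace bds.E0 \<subseteq> topspace bds.F0"
  using openin_F0_E0[of "topspace bds.E0"] openin_subset by blast

lemma openin_pt_image: "openin X U \<Longrightarrow> openin bds.F0 (pt ` U)"
  using homeomorphic_map_openness[OF homeomorphic_map_pt, of U] openin_subset openin_F0_E0 by blast

lemma openin_pt_preimage:
  assumes "openin bds.F0 Z"
  shows "openin X {x \<in> topspace X. pt x \<in> Z}"
proof -
  have "openin X {x \<in> topspace X. pt x \<in> Z \<inter> topspace bds.E0}"
    using openin_continuous_map_preimage[OF homeomorphic_imp_continuous_map[OF homeomorphic_map_pt]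
        openin_E0_F0[OF assms]] .
  then show ?thesis by (simp add: topspace_E0 cong: conj_cong)
qed

lemma r_edge_E1: "bds.r_edge ` topspace bds.E1 = pt ` shift_dom"
  unfolding topspace_E1 using r_edge_edge by (force simp: image_iff)

lemma pt_in_F0_sce:
  assumes "openin X U" "U \<inter> shift_dom = {}" "x \<in> U"
  shows "pt x \<in> bds.F0_sce"
proof -
  have U: "U \<subseteq> topspace X" using assms(1) openin_subset by blast
  have "pt ` U \<inter> bds.r_edge ` topspace bds.E1 = {}"
    unfolding r_edge_E1 using assms(2) U shift_dom_subset pt_eq_iff by blast
  then have "pt x \<notin> bds.F0 closure_of (bds.r_edge ` topspace bds.E1)"
    using openin_pt_image[OF assms(1)] assms(3) by (auto simp: in_closure_of)
  moreover have "pt x \<in> topspace bds.F0"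
    using topspace_E0_subset_F0 assms(3) U by (auto simp: topspace_E0)
  ultimately show ?thesis by (simp add: bds.F0_sce_def)
qed

text \<open>The range map is a homeomorphism from \<open>E\<^sup>1\<close> onto the open set \<open>shift_dom\<close>, so near a point
  outside \<open>shift_dom\<close> its image can only be compact if it stays away from that point.\<close>

lemma E0_sg: "bds.E0_sg = pt ` (topspace X - shift_dom)"
proof -
  have "pt x \<notin> bds.F0_rg" if x: "x \<in> topspace X" "x \<notin> shift_dom" for x
  proof
    assume rg: "pt x \<in> bds.F0_rg"
    then obtain Z W where ZW: "openin bds.F0 W" "pt x \<in> W" "W \<subseteq> Z"
      "compactin bds.E1 {e \<in> topspace bds.E1. bds.r_edge e \<in> Z}"
      by (auto simp: bds.F0_rg_def bds.F0_fin_def)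
    let ?C = "edge_source ` {e \<in> topspace bds.E1. bds.r_edge e \<in> Z}"
    have "compactin X ?C" by (rule image_compactin[OF ZW(4) continuous_map_edge_source])
    then have C: "closedin X ?C" by (rule compactin_imp_closedin[OF Hausdorff])
    have C_eq: "?C = {y \<in> shift_dom. pt y \<in> Z}"
    proof -
      have "{e \<in> topspace bds.E1. bds.r_edge e \<in> Z} = edge ` {y \<in> shift_dom. bds.r_edge (edge y) \<in> Z}"
        unfolding topspace_E1 by blast
      also have "\<dots> = edge ` {y \<in> shift_dom. pt y \<in> Z}" using r_edge_edge by (simp cong: conj_cong)
      finally show ?thesis using edge_source_edge by (simp add: image_image cong: image_cong_simp)
    qed
    \<comment> \<open>\<open>?C\<close> contains the part of \<open>shift_dom\<close> over
      \<open>W\<close>, since \<open>W \<subseteq> Z\<close>. Removing this closed set leaves a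
      neighbourhood of \<open>x\<close> that misses \<open>shift_dom\<close>, so \<open>pt x\<close>
      is in \<open>F0_sce\<close> and cannot be regular.\<close>
    let ?U = "{y \<in> topspace X. pt y \<in> W} - ?C"
    have "openin X ?U" using openin_pt_preimage[OF ZW(1)] C by (rule openin_diff)
    moreover have "?U \<inter> shift_dom = {}" using ZW(3) unfolding C_eq by blast
    moreover have "x \<in> ?U" using x ZW(2) unfolding C_eq by blast
    ultimately have "pt x \<in> bds.F0_sce" by (rule pt_in_F0_sce)
    then have "pt x \<in> bds.F0 closure_of bds.F0_sce"
      using closure_of_subset[of bds.F0_sce bds.F0] by (auto simp: bds.F0_sce_def)
    then show False using rg by (simp add: bds.F0_rg_def)
  qed
  moreover have "pt x \<in> bds.F0_rg" if x: "x \<in> shift_dom" for x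
  proof -
    \<comment> \<open>Over a compact open \<open>K\<close> inside \<open>shift_dom\<close>, the
      preimage under the range map is the image of \<open>K\<close> under \<open>edge\<close>, hence
      compact.\<close>
    obtain K where K: "K \<in> compact_opens X shift_dom" "x \<in> K"
      using compact_openE openin_shift_dom x by blast
    have KW: "K \<subseteq> shift_dom" "compactin X K" "openin X K" using K(1) by (auto simp: compact_opens_def)
    have e: "{e \<in> topspace bds.E1. bds.r_edge e \<in> pt ` K} = edge ` K"
    proof -
      have "pt y \<in> pt ` K \<longleftrightarrow> y \<in> K" if "y \<in> shift_dom" for y
        using inj_on_image_mem_iff[OF inj_pt, of y K] that KW(1) shift_dom_subset by blast
      then have "bds.r_edge (edge y) \<in> pt ` K \<longleftrightarrow> y \<in> K" if "y \<in> shift_dom" for y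
        using that r_edge_edge by simp
      then show ?thesis unfolding topspace_E1 using KW(1) by blast
    qed
    have "compactin bds.E1 (edge ` K)"
      by (rule image_compactin[OF _ continuous_map_edge]) (simp add: compactin_subtopology KW)
    then have "compactin bds.E1 {e \<in> topspace bds.E1. bds.r_edge e \<in> pt ` K}" by (simp only: e)
    moreover have "openin bds.F0 (pt ` K)" "pt x \<in> pt ` K" using openin_pt_image KW K(2) by auto
    moreover have "pt ` K \<subseteq> topspace bds.F0" using openin_subset calculation(2) by blast
    ultimately have "pt x \<in> bds.F0_fin" unfolding bds.F0_fin_def by blast
    \<comment> \<open>Regularity also excludes the closure of \<open>F0_sce\<close>: an open set
      inside the range of \<open>E1\<close> is disjoint from \<open>F0_sce\<close>, hence from its
      closure.\<close>
    moreover have "pt ` shift_dom \<inter> bds.F0_sce = {}"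
    proof -
      have "bds.r_edge ` topspace bds.E1 \<subseteq> topspace bds.F0"
        unfolding r_edge_E1 using openin_pt_image[OF openin_shift_dom] openin_subset by blast
      then have "pt ` shift_dom \<subseteq> bds.F0 closure_of (bds.r_edge ` topspace bds.E1)"
        using closure_of_subset[of "bds.r_edge ` topspace bds.E1" bds.F0] unfolding r_edge_E1 by blast
      then show ?thesis by (auto simp: bds.F0_sce_def)
    qed
    then have "pt x \<notin> bds.F0 closure_of bds.F0_sce"
      using openin_pt_image[OF openin_shift_dom] x by (auto simp: in_closure_of)
    ultimately show ?thesis by (simp add: bds.F0_rg_def)
  qed
  ultimately show ?thesis unfolding bds.E0_sg_def topspace_E0 by blast
qed

subsection \<open>Paths are orbit segments of the shift\<close>

definition orbit_edge :: "'x \<Rightarrow> nat \<Rightarrow> 'l \<times> 'x set set" where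
  "orbit_edge x i = edge ((shift ^^ i) x)"

text \<open>Paths of length 0 are vertices and \<open>FinPath\<close> carries nonempty lists, hence
  the case split. For \<open>x \<in> shift_dom_iter n\<close> this is the only path of length n with
  range \<open>x\<close>.\<close>

definition path_prefix :: "nat \<Rightarrow> 'x \<Rightarrow> ('l, 'x set) gpath" where
  "path_prefix n x = (if n = 0 then Vertex (pt x) else FinPath (map (orbit_edge x) [0..<n]))"

definition path_source :: "('l, 'x set) gpath \<Rightarrow> 'x" where
  "path_source \<mu> = inv_into (topspace X) pt (bds.r_path \<mu>)"

lemma shift_dom_iterD: "\<lbrakk>x \<in> shift_dom_iter n; i < n\<rbrakk> \<Longrightarrow> (shift ^^ i) x \<in> shift_dom"
  by (simp add: shift_dom_iter_def)

lemma shift_dom_iter_subset: "shift_dom_iter n \<subseteq> topspace X"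
  by (auto simp: shift_dom_iter_def)

lemma shift_dom_iter_antimono: "\<lbrakk>x \<in> shift_dom_iter n; m \<le> n\<rbrakk> \<Longrightarrow> x \<in> shift_dom_iter m"
  by (simp add: shift_dom_iter_def)

lemma orbit_edge_in_E1: "\<lbrakk>x \<in> shift_dom_iter n; i < n\<rbrakk> \<Longrightarrow> orbit_edge x i \<in> topspace bds.E1"
  by (simp add: orbit_edge_def topspace_E1 shift_dom_iterD)

lemma r_orbit_edge: "\<lbrakk>x \<in> shift_dom_iter n; i < n\<rbrakk> \<Longrightarrow> bds.r_edge (orbit_edge x i) = pt ((shift ^^ i) x)"
  by (simp add: orbit_edge_def r_edge_edge shift_dom_iterD)

lemma d_orbit_edge: "\<lbrakk>x \<in> shift_dom_iter n; i < n\<rbrakk> \<Longrightarrow> bds.d_edge (orbit_edge x i) = pt ((shift ^^ Suc i) x)"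
  by (simp add: orbit_edge_def d_edge_edge shift_dom_iterD)

text \<open>\<open>edge y\<close> has range \<open>pt y\<close> and source
  \<open>pt (shift y)\<close>, and \<open>pt\<close> is injective; so matching consecutive edges
  forces each point to be the shift of the previous one. Stated for functions, to serve both lists
  via \<open>nth\<close> and infinite paths.\<close>

lemma edge_sequence_orbit:
  assumes "\<And>j. j \<le> i \<Longrightarrow> s j \<in> topspace bds.E1"
    and "\<And>j. j < i \<Longrightarrow> bds.d_edge (s j) = bds.r_edge (s (Suc j))"
  shows "(shift ^^ i) (edge_source (s 0)) \<in> shift_dom \<and> s i = orbit_edge (edge_source (s 0)) i"
  using assms
proof (induction i)
  case 0
  then obtain y where "y \<in> shift_dom" "s 0 = edge y" unfolding topspace_E1 by blast
  then show ?case using edge_source_edge by (simp add: orbit_edge_def)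
next
  case (Suc i)
  let ?y = "(shift ^^ i) (edge_source (s 0))"
  have IH: "?y \<in> shift_dom" "s i = edge ?y" using Suc by (simp_all add: orbit_edge_def)
  obtain z where z: "z \<in> shift_dom" "s (Suc i) = edge z" using Suc.prems(1)[of "Suc i"] unfolding topspace_E1 by blast
  have "pt (shift ?y) = pt z"
    using Suc.prems(2)[of i] IH z d_edge_edge r_edge_edge by simp
  then have "shift ?y = z"
    using pt_eq_iff shift_topspace[OF IH(1)] z(1) shift_dom_subset by blast
  then show ?case using z by (simp add: orbit_edge_def)
qed

lemma fin_edge_paths_eq:
  assumes "0 < n"
  shows "bds.fin_edge_paths n = (\<lambda>x. map (orbit_edge x) [0..<n]) ` shift_dom_iter n"
proof (intro equalityI subsetI)
  fix es assume "es \<in> bds.fin_edge_paths n"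
  then have es: "length es = n" "\<And>i. i < n \<Longrightarrow> es ! i \<in> topspace bds.E1"
    "\<And>i. Suc i < n \<Longrightarrow> bds.d_edge (es ! i) = bds.r_edge (es ! Suc i)"
    by (auto simp: bds.fin_edge_paths_def in_lists_conv_set)
  let ?x = "edge_source (es ! 0)"
  have *: "(shift ^^ i) ?x \<in> shift_dom \<and> es ! i = orbit_edge ?x i" if "i < n" for i
    using edge_sequence_orbit[of i "\<lambda>j. es ! j"] es that by auto
  have "?x \<in> topspace X" using *[OF assms] shift_dom_subset by auto
  then have "?x \<in> shift_dom_iter n" using *[THEN conjunct1] by (simp add: shift_dom_iter_def)
  moreover have "es = map (orbit_edge ?x) [0..<n]"
  proof (rule nth_equalityI)
    fix i assume "i < length es"
    then show "es ! i = map (orbit_edge ?x) [0..<n] ! i" using *[of i] es(1) by simp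
  qed (simp add: es(1))
  ultimately show "es \<in> (\<lambda>x. map (orbit_edge x) [0..<n]) ` shift_dom_iter n" by blast
next
  fix es assume "es \<in> (\<lambda>x. map (orbit_edge x) [0..<n]) ` shift_dom_iter n"
  then obtain x where x: "x \<in> shift_dom_iter n" "es = map (orbit_edge x) [0..<n]" by blast
  have "set es \<subseteq> topspace bds.E1" using orbit_edge_in_E1[OF x(1)] x(2) by auto
  moreover have "bds.d_edge (es ! i) = bds.r_edge (es ! Suc i)" if "Suc i < n" for i
    using d_orbit_edge[OF x(1), of i] r_orbit_edge[OF x(1), of "Suc i"] that x(2) by simp
  ultimately show "es \<in> bds.fin_edge_paths n" using x(2) by (auto simp: bds.fin_edge_paths_def)
qed

lemma topspace_path_space: "topspace (bds.path_space n) = path_prefix n ` shift_dom_iter n"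
proof (cases "n = 0")
  case True
  have "topspace (bds.path_space n) = Vertex ` topspace bds.E0"
    using True by (auto simp: bds.path_space_def topspace_pullback_topology)
  then show ?thesis using True by (simp add: topspace_E0 path_prefix_def shift_dom_iter_0 image_image)
next
  case False
  have "(\<lambda>i\<in>{..<n}. path_edge (FinPath es) i) \<in> topspace (product_topology (\<lambda>i. bds.E1) {..<n})"
    if "es \<in> bds.fin_edge_paths n" for es
    using that by (auto simp: bds.fin_edge_paths_def in_lists_conv_set)
  then have "FinPath ` bds.fin_edge_paths n \<subseteq>
      (\<lambda>\<mu>. \<lambda>i\<in>{..<n}. path_edge \<mu> i) -` topspace (product_topology (\<lambda>i. bds.E1) {..<n})"
    by blast
  then have "topspace (bds.path_space n) = FinPath ` bds.fin_edge_paths n"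
    using False by (simp only: bds.path_space_def topspace_pullback_topology if_False Int_absorb1)
  then show ?thesis using False by (simp add: fin_edge_paths_eq path_prefix_def image_image)
qed

lemma r_path_prefix:
  assumes "x \<in> shift_dom_iter n"
  shows "bds.r_path (path_prefix n x) = pt x"
  using r_orbit_edge[OF assms, of 0] by (auto simp: path_prefix_def upt_conv_Cons)

lemma path_source_prefix:
  assumes "x \<in> shift_dom_iter n"
  shows "path_source (path_prefix n x) = x"
  using assms shift_dom_iter_subset inv_into_f_f[OF inj_pt] by (auto simp: path_source_def r_path_prefix)

section \<open>Topology of the spaces of finite paths\<close>

lemma shift_iter_continuous:
  "openin X (shift_dom_iter n) \<and> continuous_map (subtopology X (shift_dom_iter n)) X (shift ^^ n)"
proof (induction n)
  case 0
  then show ?case by (simp add: shift_dom_iter_0 id_def[symmetric] continuous_map_from_subtopology)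
next
  case (Suc n)
  have top: "topspace (subtopology X (shift_dom_iter n)) = shift_dom_iter n" using shift_dom_iter_subset by auto
  \<comment> \<open>Openness of the next domain needs continuity of the current iterate, so both
    claims share one induction.\<close>
  have "openin (subtopology X (shift_dom_iter n)) {x \<in> shift_dom_iter n. (shift ^^ n) x \<in> shift_dom}"
    using openin_continuous_map_preimage[OF conjunct2[OF Suc] openin_shift_dom] unfolding top .
  moreover have eq: "{x \<in> shift_dom_iter n. (shift ^^ n) x \<in> shift_dom} = shift_dom_iter (Suc n)"
    using shift_dom_iter_Suc by blast
  ultimately have o: "openin X (shift_dom_iter (Suc n))" "shift_dom_iter (Suc n) \<subseteq> shift_dom_iter n"
    using Suc by (auto simp: openin_open_subtopology)
  have "continuous_map (subtopology X (shift_dom_iter (Suc n))) X (shift ^^ n)"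
    using continuous_map_from_subtopology_mono[OF conjunct2[OF Suc] o(2)] .
  then have "continuous_map (subtopology X (shift_dom_iter (Suc n))) (subtopology X shift_dom) (shift ^^ n)"
    using eq by (intro continuous_map_into_subtopology) auto
  then have "continuous_map (subtopology X (shift_dom_iter (Suc n))) X (shift \<circ> (shift ^^ n))"
    using continuous_map_shift by (rule continuous_map_compose)
  then show ?case using o by (simp add: o_def)
qed

lemma continuous_map_orbit_edge:
  assumes "i < n"
  shows "continuous_map (subtopology X (shift_dom_iter n)) bds.E1 (\<lambda>x. orbit_edge x i)"
proof -
  have sub: "shift_dom_iter n \<subseteq> shift_dom_iter i" using shift_dom_iter_antimono assms by auto
  have "continuous_map (subtopology X (shift_dom_iter n)) X (shift ^^ i)"
    using continuous_map_from_subtopology_mono[OF conjunct2[OF shift_iter_continuous] sub] .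
  then have "continuous_map (subtopology X (shift_dom_iter n)) (subtopology X shift_dom) (shift ^^ i)"
    using assms shift_dom_iterD by (intro continuous_map_into_subtopology) auto
  then have "continuous_map (subtopology X (shift_dom_iter n)) bds.E1 (edge \<circ> (shift ^^ i))"
    using continuous_map_edge by (rule continuous_map_compose)
  then show ?thesis by (simp add: orbit_edge_def o_def)
qed

lemma continuous_map_path_prefix:
  "continuous_map (subtopology X (shift_dom_iter n)) (bds.path_space n) (path_prefix n)"
proof (cases "n = 0")
  case True
  have "continuous_map X bds.E0 ((\<lambda>\<mu>. THE v. \<mu> = Vertex v) \<circ> path_prefix n)"
    using homeomorphic_imp_continuous_map[OF homeomorphic_map_pt] True by (simp add: path_prefix_def o_def)
  then show ?thesis using True unfolding bds.path_space_def
    by (auto simp: shift_dom_iter_0 topspace_E0 path_prefix_def intro!: continuous_map_pullback')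
next
  case False
  let ?g = "\<lambda>\<mu>. \<lambda>i\<in>{..<n}. path_edge \<mu> i"
  have "(?g \<circ> path_prefix n) x i = (if i < n then orbit_edge x i else undefined)" for x i
    using False by (simp add: path_prefix_def)
  then have "?g \<circ> path_prefix n = (\<lambda>x. \<lambda>i\<in>{..<n}. orbit_edge x i)" by (auto simp: fun_eq_iff)
  then have "continuous_map (subtopology X (shift_dom_iter n)) (product_topology (\<lambda>i. bds.E1) {..<n}) (?g \<circ> path_prefix n)"
    using continuous_map_orbit_edge by (auto simp: continuous_map_componentwise)
  moreover have "topspace (subtopology X (shift_dom_iter n)) \<subseteq> path_prefix n -` FinPath ` bds.fin_edge_paths n"
    using False by (auto simp: fin_edge_paths_eq path_prefix_def image_image)
  ultimately show ?thesis using False unfolding bds.path_space_def by (simp add: continuous_map_pullback')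
qed

text \<open>For positive length the first edge alone determines the start, so the map is
  \<open>edge_source\<close> after a coordinate projection; for length 0 it is the inverse of
  \<open>pt\<close>.\<close>

lemma continuous_map_path_source: "continuous_map (bds.path_space n) X path_source"
proof (cases "n = 0")
  case True
  obtain g where g: "homeomorphic_maps X bds.E0 pt g"
    using homeomorphic_map_pt homeomorphic_map_maps by blast
  have "continuous_map (bds.path_space n) X (g \<circ> (\<lambda>\<mu>. THE v. \<mu> = Vertex v))"
    using True g unfolding bds.path_space_def homeomorphic_maps_def by (simp add: continuous_map_pullback)
  moreover have "(g \<circ> (\<lambda>\<mu>. THE v. \<mu> = Vertex v)) \<mu> = path_source \<mu>" if "\<mu> \<in> topspace (bds.path_space n)" for \<mu>
    using that g True path_source_prefix[of _ n] unfolding topspace_path_space homeomorphic_maps_def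
    by (auto simp: path_prefix_def shift_dom_iter_0)
  ultimately show ?thesis by (rule continuous_map_eq)
next
  case False
  let ?g = "\<lambda>\<mu>. \<lambda>i\<in>{..<n}. path_edge \<mu> i"
  have "continuous_map (product_topology (\<lambda>i. bds.E1) {..<n}) X (edge_source \<circ> (\<lambda>z. z 0))"
    using False by (intro continuous_map_compose[OF _ continuous_map_edge_source] continuous_map_product_projection) auto
  then have "continuous_map (bds.path_space n) X ((edge_source \<circ> (\<lambda>z. z 0)) \<circ> ?g)"
    using False unfolding bds.path_space_def by (simp add: continuous_map_pullback)
  moreover have "((edge_source \<circ> (\<lambda>z. z 0)) \<circ> ?g) \<mu> = path_source \<mu>" if \<mu>: "\<mu> \<in> topspace (bds.path_space n)" for \<mu>
  proof -
    obtain x where x: "x \<in> shift_dom_iter n" "\<mu> = path_prefix n x" using \<mu> topspace_path_space by auto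
    then have "x \<in> shift_dom" using shift_dom_iterD[of x n 0] False by simp
    then show ?thesis using x path_source_prefix[OF x(1)] False edge_source_edge
      by (simp add: path_prefix_def orbit_edge_def)
  qed
  ultimately show ?thesis by (rule continuous_map_eq)
qed

lemma openin_Estar: "openin (bds.path_space n) W \<Longrightarrow> openin bds.Estar W"
  unfolding bds.Estar_def by (rule topology_generated_by_Basis) blast

lemma topspace_Estar: "topspace bds.Estar = (\<Union>n. topspace (bds.path_space n))"
  unfolding bds.Estar_def topology_generated_by_topspace
  by (auto dest: openin_subset intro: openin_topspace)

lemma path_prefix_eq_imp: "path_prefix m x = path_prefix n y \<Longrightarrow> m = n"
  by (auto simp: path_prefix_def split: if_splits dest: map_eq_imp_length_eq)

text \<open>\<open>Estar\<close> is given by generators and not as a sum. A generator of another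
  length has empty trace here, because a path determines its length
  (\<open>path_prefix_eq_imp\<close>); unions and intersections preserve open traces.\<close>

lemma openin_path_space_Estar:
  assumes "openin bds.Estar W"
  shows "openin (bds.path_space n) (W \<inter> topspace (bds.path_space n))"
proof -
  have "generate_topology_on {W. \<exists>n. openin (bds.path_space n) W} W"
    using assms by (simp add: bds.Estar_def openin_topology_generated_by_iff)
  then show ?thesis
  proof (induction rule: generate_topology_on.induct)
    case (Int a b)
    then show ?case
      using openin_Int[of "bds.path_space n" "a \<inter> topspace (bds.path_space n)" "b \<inter> topspace (bds.path_space n)"]
      by (simp add: Int_ac)
  next
    case (UN K)
    have "\<Union>K \<inter> topspace (bds.path_space n) = \<Union>((\<lambda>k. k \<inter> topspace (bds.path_space n)) ` K)" by blast
    moreover have "openin (bds.path_space n) (\<Union>((\<lambda>k. k \<inter> topspace (bds.path_space n)) ` K))"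
      by (rule openin_Union) (use UN in blast)
    ultimately show ?case by (simp only:)
  next
    case (Basis s)
    then obtain m where m: "openin (bds.path_space m) s" by blast
    show ?case
    proof (cases "m = n")
      case False
      then have "s \<inter> topspace (bds.path_space n) = {}"
        using openin_subset[OF m] path_prefix_eq_imp unfolding topspace_path_space by blast
      then show ?thesis by simp
    qed (use m openin_Int in auto)
  qed simp
qed

lemma continuous_map_Estar_path_source: "continuous_map bds.Estar X path_source"
  unfolding continuous_map_def
proof (intro conjI allI impI)
  show "path_source \<in> topspace bds.Estar \<rightarrow> topspace X"
    using continuous_map_path_source unfolding topspace_Estar continuous_map_def by blast
next
  fix U assume "openin X U"
  then have "openin bds.Estar {\<mu> \<in> topspace (bds.path_space n). path_source \<mu> \<in> U}" for n
    using openin_continuous_map_preimage[OF continuous_map_path_source] openin_Estar by blast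
  moreover have "{\<mu> \<in> topspace bds.Estar. path_source \<mu> \<in> U} =
      (\<Union>n. {\<mu> \<in> topspace (bds.path_space n). path_source \<mu> \<in> U})"
    unfolding topspace_Estar by blast
  ultimately show "openin bds.Estar {\<mu> \<in> topspace bds.Estar. path_source \<mu> \<in> U}" by auto
qed

subsection \<open>The boundary path of a point\<close>

text \<open>The domains \<open>shift_dom_iter n\<close> decrease, so the \<open>LEAST\<close> picks
  the last n with \<open>x \<in> shift_dom_iter n\<close>; hence the \<open>Suc\<close>.\<close>

definition boundary_path :: "'x \<Rightarrow> ('l, 'x set) gpath" where
  "boundary_path x = (if \<forall>n. x \<in> shift_dom_iter n then InfPath (orbit_edge x)
     else path_prefix (LEAST n. x \<notin> shift_dom_iter (Suc n)) x)"

lemma boundary_path_fin: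
  assumes "x \<in> shift_dom_iter n" "(shift ^^ n) x \<notin> shift_dom"
  shows "boundary_path x = path_prefix n x"
proof -
  have "x \<notin> shift_dom_iter (Suc n)" using assms shift_dom_iter_Suc by blast
  moreover have "(LEAST n. x \<notin> shift_dom_iter (Suc n)) = n"
  proof (rule Least_equality)
    show "x \<notin> shift_dom_iter (Suc n)" by fact
    show "n \<le> m" if "x \<notin> shift_dom_iter (Suc m)" for m
      using that shift_dom_iter_antimono[OF assms(1), of "Suc m"] by linarith
  qed
  ultimately show ?thesis unfolding boundary_path_def by auto
qed

lemma boundary_path_cases:
  assumes "x \<in> topspace X"
  obtains (inf) "\<And>n. x \<in> shift_dom_iter n" "boundary_path x = InfPath (orbit_edge x)"
    | (fin) n where "x \<in> shift_dom_iter n" "(shift ^^ n) x \<notin> shift_dom" "boundary_path x = path_prefix n x"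
proof (cases "\<forall>n. x \<in> shift_dom_iter n")
  case True
  then show ?thesis using inf by (simp add: boundary_path_def)
next
  case False
  define m where "m = (LEAST n. x \<notin> shift_dom_iter n)"
  have m: "x \<notin> shift_dom_iter m" using False LeastI_ex[of "\<lambda>n. x \<notin> shift_dom_iter n"] by (simp add: m_def)
  then obtain n where n: "m = Suc n" using assms shift_dom_iter_0 by (cases m) auto
  have "x \<in> shift_dom_iter n" using not_less_Least[of n "\<lambda>n. x \<notin> shift_dom_iter n"] n by (auto simp: m_def)
  moreover have "(shift ^^ n) x \<notin> shift_dom" using m n calculation shift_dom_iter_Suc by blast
  ultimately show ?thesis using fin boundary_path_fin by blast
qed

lemma path_len_path_prefix [simp]: "path_len (path_prefix n x) = enat n"
  by (simp add: path_prefix_def zero_enat_def)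

lemma path_len_boundary_path:
  assumes "x \<in> topspace X"
  shows "enat n \<le> path_len (boundary_path x) \<longleftrightarrow> x \<in> shift_dom_iter n"
  using assms
proof (cases rule: boundary_path_cases)
  case (fin m)
  have "n \<le> m" if "x \<in> shift_dom_iter n"
    using that fin(2) shift_dom_iterD[of x n m] by (meson not_le)
  then show ?thesis using fin shift_dom_iter_antimono by auto
qed auto

lemma path_edge_boundary_path:
  assumes "x \<in> shift_dom_iter n" "i < n"
  shows "path_edge (boundary_path x) i = orbit_edge x i"
proof -
  have "x \<in> topspace X" using assms(1) shift_dom_iter_subset by blast
  then show ?thesis
  proof (cases rule: boundary_path_cases)
    case (fin m)
    then have "i < m" using assms shift_dom_iterD[of x n m] by (meson not_le less_le_trans)
    then show ?thesis using fin by (simp add: path_prefix_def)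
  qed simp
qed

lemma r_path_boundary_path:
  assumes "x \<in> topspace X"
  shows "bds.r_path (boundary_path x) = pt x"
  using assms
proof (cases rule: boundary_path_cases)
  case inf
  then show ?thesis using r_orbit_edge[of x 1 0] by simp
qed (simp add: r_path_prefix)

lemma d_path_prefix:
  assumes "x \<in> shift_dom_iter n"
  shows "bds.d_path (path_prefix n x) = pt ((shift ^^ n) x)"
proof (cases n)
  case (Suc m)
  then show ?thesis using d_orbit_edge[OF assms, of m] by (simp add: path_prefix_def)
qed (simp add: path_prefix_def)

text \<open>A path of length n with range \<open>pt x\<close> ends at \<open>pt\<close> of the n-th
  iterate. By \<open>E0_sg\<close> this vertex is singular iff the iterate is outside
  \<open>shift_dom\<close>, which is the stopping condition of \<open>boundary_path\<close>.\<close>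

lemma boundary_eq: "bds.boundary = boundary_path ` topspace X"
proof (intro equalityI subsetI)
  fix \<mu> assume "\<mu> \<in> boundary_path ` topspace X"
  then obtain x where x: "x \<in> topspace X" "\<mu> = boundary_path x" by blast
  from x(1) show "\<mu> \<in> bds.boundary"
  proof (cases rule: boundary_path_cases)
    case inf
    have "orbit_edge x i \<in> topspace bds.E1 \<and> bds.d_edge (orbit_edge x i) = bds.r_edge (orbit_edge x (Suc i))" for i
      using orbit_edge_in_E1[OF inf(1)[of "Suc (Suc i)"]] d_orbit_edge[OF inf(1)[of "Suc (Suc i)"]]
        r_orbit_edge[OF inf(1)[of "Suc (Suc i)"]] by simp
    then show ?thesis using x(2) inf(2) by (auto simp: bds.boundary_def bds.Einf_def)
  next
    case (fin n)
    have "\<mu> \<in> topspace bds.Estar"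
      using fin x(2) unfolding topspace_Estar topspace_path_space by blast
    moreover have "bds.d_path \<mu> \<in> bds.E0_sg"
      unfolding E0_sg x(2) fin(3) d_path_prefix[OF fin(1)]
      using fin(2) shift_iter_topspace[OF fin(1), of n] by blast
    ultimately show ?thesis by (simp add: bds.boundary_def)
  qed
next
  fix \<mu> assume "\<mu> \<in> bds.boundary"
  then consider "\<mu> \<in> bds.Einf" | "\<mu> \<in> topspace bds.Estar" "bds.d_path \<mu> \<in> bds.E0_sg"
    by (auto simp: bds.boundary_def)
  then show "\<mu> \<in> boundary_path ` topspace X"
  proof cases
    case 1
    then obtain s where s: "\<mu> = InfPath s" "\<And>i. s i \<in> topspace bds.E1"
      "\<And>i. bds.d_edge (s i) = bds.r_edge (s (Suc i))"
      by (auto simp: bds.Einf_def)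
    let ?x = "edge_source (s 0)"
    have *: "(shift ^^ i) ?x \<in> shift_dom \<and> s i = orbit_edge ?x i" for i
      using edge_sequence_orbit[of i s] s by blast
    have x: "?x \<in> topspace X" using *[of 0] shift_dom_subset by auto
    then have "?x \<in> shift_dom_iter n" for n using *[THEN conjunct1] by (simp add: shift_dom_iter_def)
    moreover have "s = orbit_edge ?x" by (rule ext) (rule *[THEN conjunct2])
    ultimately have "\<mu> = boundary_path ?x" using s(1) by (simp add: boundary_path_def)
    then show ?thesis using x by blast
  next
    case 2
    then obtain n x where x: "x \<in> shift_dom_iter n" "\<mu> = path_prefix n x"
      unfolding topspace_Estar topspace_path_space by blast
    then obtain z where z: "z \<in> topspace X" "z \<notin> shift_dom" "pt ((shift ^^ n) x) = pt z"
      using 2(2) d_path_prefix unfolding E0_sg by auto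
    then have "(shift ^^ n) x \<notin> shift_dom"
      using pt_eq_iff shift_iter_topspace[OF x(1), of n] by blast
    then have "\<mu> = boundary_path x" using boundary_path_fin[OF x(1)] x(2) by simp
    then show ?thesis using x(1) shift_dom_iter_subset by blast
  qed
qed

lemma boundary_path_in: "x \<in> topspace X \<Longrightarrow> boundary_path x \<in> bds.boundary"
  by (simp add: boundary_eq)

section \<open>Cylinder sets and the topology of the boundary\<close>

lemma boundary_path_cylinder:
  assumes x: "x \<in> topspace X"
  shows "boundary_path x \<in> bds.cylinder S \<longleftrightarrow> (\<exists>n. x \<in> shift_dom_iter n \<and> path_prefix n x \<in> S)"
proof -
  have "FinPath (map (path_edge (boundary_path x)) [0..<n]) = path_prefix n x"
    if "1 \<le> n" "x \<in> shift_dom_iter n" for n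
    using that path_edge_boundary_path[OF that(2)] by (auto simp: path_prefix_def)
  then have "(\<exists>i\<ge>1. enat i \<le> path_len (boundary_path x) \<and> FinPath (map (path_edge (boundary_path x)) [0..<i]) \<in> S)
      \<longleftrightarrow> (\<exists>n\<ge>1. x \<in> shift_dom_iter n \<and> path_prefix n x \<in> S)"
    unfolding path_len_boundary_path[OF x] by metis
  \<comment> \<open>The vertex clause of \<open>cylinder\<close> is the prefix of length 0, so both
    clauses merge into one quantifier over n.\<close>
  moreover have "Vertex (bds.r_path (boundary_path x)) = path_prefix 0 x"
    using r_path_boundary_path[OF x] by (simp add: path_prefix_def)
  moreover have "x \<in> shift_dom_iter 0" using x by (simp add: shift_dom_iter_0)
  ultimately show ?thesis
    using boundary_path_in[OF x] unfolding bds.cylinder_def by simp (metis One_nat_def Suc_leI neq0_conv)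
qed

lemma cylinder_preimage:
  "{x \<in> topspace X. boundary_path x \<in> bds.cylinder S} = (\<Union>n. {x \<in> shift_dom_iter n. path_prefix n x \<in> S})"
proof (rule Set.set_eqI)
  fix x
  show "x \<in> {x \<in> topspace X. boundary_path x \<in> bds.cylinder S} \<longleftrightarrow>
      x \<in> (\<Union>n. {x \<in> shift_dom_iter n. path_prefix n x \<in> S})"
    using boundary_path_cylinder[of x S] shift_dom_iter_subset by (cases "x \<in> topspace X") auto
qed

lemma inj_boundary_path: "inj_on boundary_path (topspace X)"
  by (rule inj_onI) (metis r_path_boundary_path pt_eq_iff)

lemma openin_cylinder_preimage:
  assumes "openin bds.Estar W"
  shows "openin X {x \<in> topspace X. boundary_path x \<in> bds.cylinder W}"
proof -
  have "openin X {x \<in> shift_dom_iter n. path_prefix n x \<in> W}" for n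
  proof -
    have top: "topspace (subtopology X (shift_dom_iter n)) = shift_dom_iter n" using shift_dom_iter_subset by auto
    \<comment> \<open>Openness is known for the trace of \<open>W\<close> on paths of length n; all
      these prefixes lie in \<open>path_space n\<close>, so passing to the trace changes
      nothing.\<close>
    have "openin (subtopology X (shift_dom_iter n))
        {x \<in> shift_dom_iter n. path_prefix n x \<in> W \<inter> topspace (bds.path_space n)}"
      using openin_continuous_map_preimage[OF continuous_map_path_prefix openin_path_space_Estar[OF assms], of n]
      by (simp only: top)
    then have "openin X {x \<in> shift_dom_iter n. path_prefix n x \<in> W \<inter> topspace (bds.path_space n)}"
      using shift_iter_continuous by (simp add: openin_open_subtopology)
    moreover have "{x \<in> shift_dom_iter n. path_prefix n x \<in> W \<inter> topspace (bds.path_space n)} =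
        {x \<in> shift_dom_iter n. path_prefix n x \<in> W}"
      by (auto simp: topspace_path_space)
    ultimately show ?thesis by simp
  qed
  then show ?thesis unfolding cylinder_preimage by auto
qed

text \<open>\<open>K\<close> may contain paths of several lengths, so \<open>path_source\<close> is
  used as one continuous map on all of \<open>Estar\<close>; the set in question is its image of
  \<open>K\<close>, which is compact.\<close>

lemma closedin_cylinder_preimage:
  assumes K: "compactin bds.Estar K"
  shows "closedin X {x \<in> topspace X. boundary_path x \<in> bds.cylinder K}"
proof -
  have KE: "K \<subseteq> topspace bds.Estar" using K compactin_subset_topspace by blast
  have "{x \<in> topspace X. boundary_path x \<in> bds.cylinder K} = path_source ` K"
    unfolding cylinder_preimage
  proof (intro equalityI subsetI)
    fix x assume "x \<in> (\<Union>n. {x \<in> shift_dom_iter n. path_prefix n x \<in> K})"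
    then obtain n where n: "x \<in> shift_dom_iter n" "path_prefix n x \<in> K" by blast
    then show "x \<in> path_source ` K" using path_source_prefix[OF n(1)] by (metis imageI)
  next
    fix x assume "x \<in> path_source ` K"
    then obtain \<mu> where \<mu>: "\<mu> \<in> K" "x = path_source \<mu>" by blast
    then obtain n y where y: "y \<in> shift_dom_iter n" "\<mu> = path_prefix n y"
      using KE unfolding topspace_Estar topspace_path_space by blast
    then have "x = y" using \<mu>(2) path_source_prefix by simp
    then show "x \<in> (\<Union>n. {x \<in> shift_dom_iter n. path_prefix n x \<in> K})" using y \<mu>(1) by blast
  qed
  then show ?thesis
    using compactin_imp_closedin[OF Hausdorff image_compactin[OF K continuous_map_Estar_path_source]] by simp
qed

text \<open>Exhibits the image in the form of a generator: the paths of length 0 over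
  \<open>G\<close> for the open set, the empty set for the compact one.\<close>

lemma image_boundary_path_cylinder:
  assumes "G \<subseteq> topspace X"
  shows "boundary_path ` G = bds.cylinder (Vertex ` pt ` G) \<inter> (bds.boundary - bds.cylinder {})"
proof -
  have "boundary_path x \<in> bds.cylinder (Vertex ` pt ` G) \<longleftrightarrow> x \<in> G" if x: "x \<in> topspace X" for x
  proof -
    have "path_prefix n x \<in> Vertex ` pt ` G \<longleftrightarrow> n = 0 \<and> x \<in> G" for n
      using inj_on_image_mem_iff[OF inj_pt x assms] by (auto simp: path_prefix_def)
    then show ?thesis using boundary_path_cylinder[OF x] x by (auto simp: shift_dom_iter_0)
  qed
  moreover have "bds.cylinder {} = {}" by (simp add: bds.cylinder_def)
  ultimately show ?thesis using assms unfolding boundary_eq by blast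
qed

lemma openin_image_boundary_path:
  assumes G: "openin X G"
  shows "openin bds.boundary_space (boundary_path ` G)"
proof -
  have GX: "G \<subseteq> topspace X" using G openin_subset by blast
  have "openin bds.E0 (pt ` G)" using homeomorphic_map_openness[OF homeomorphic_map_pt GX] G by blast
  moreover have "Vertex ` pt ` G = (\<lambda>\<mu>. THE v. \<mu> = Vertex v) -` pt ` G \<inter> Vertex ` topspace bds.E0"
    using GX by (auto simp: topspace_E0)
  ultimately have "openin (bds.path_space 0) (Vertex ` pt ` G)"
    unfolding bds.path_space_def by (auto simp: openin_pullback_topology)
  then have "openin bds.Estar (Vertex ` pt ` G)" by (rule openin_Estar)
  moreover have "compactin bds.Estar {}" by simp
  ultimately show ?thesis
    unfolding bds.boundary_space_def image_boundary_path_cylinder[OF GX]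
    by (intro topology_generated_by_Basis) blast
qed

lemma topspace_boundary_space: "topspace bds.boundary_space = bds.boundary"
proof
  show "topspace bds.boundary_space \<subseteq> bds.boundary"
    unfolding bds.boundary_space_def topology_generated_by_topspace by blast
  show "bds.boundary \<subseteq> topspace bds.boundary_space"
    using openin_subset[OF openin_image_boundary_path[OF openin_topspace]] by (simp add: boundary_eq)
qed

lemma homeomorphic_map_boundary_path: "homeomorphic_map X bds.boundary_space boundary_path"
proof (rule bijective_open_imp_homeomorphic_map)
  show "open_map X bds.boundary_space boundary_path"
    by (simp add: open_map_def openin_image_boundary_path)
  show "boundary_path ` topspace X = topspace bds.boundary_space"
    by (simp add: topspace_boundary_space boundary_eq)
  show "inj_on boundary_path (topspace X)" by (rule inj_boundary_path)
  show "continuous_map X bds.boundary_space boundary_path"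
    unfolding bds.boundary_space_def
  proof (rule continuous_on_generated_topo)
    show "boundary_path ` topspace X \<subseteq>
        \<Union>{bds.cylinder W \<inter> (bds.boundary - bds.cylinder K) |W K. openin bds.Estar W \<and> compactin bds.Estar K}"
      using topspace_boundary_space unfolding bds.boundary_space_def topology_generated_by_topspace
      by (simp add: boundary_eq)
  next
    fix U
    assume "U \<in> {bds.cylinder W \<inter> (bds.boundary - bds.cylinder K) |W K. openin bds.Estar W \<and> compactin bds.Estar K}"
    then obtain W K where U: "U = bds.cylinder W \<inter> (bds.boundary - bds.cylinder K)"
      "openin bds.Estar W" "compactin bds.Estar K" by blast
    have "boundary_path -` U \<inter> topspace X =
        {x \<in> topspace X. boundary_path x \<in> bds.cylinder W} - {x \<in> topspace X. boundary_path x \<in> bds.cylinder K}"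
      unfolding U(1) using boundary_path_in by blast
    then show "openin X (boundary_path -` U \<inter> topspace X)"
      using openin_cylinder_preimage[OF U(2)] closedin_cylinder_preimage[OF U(3)] by (simp add: openin_diff)
  qed
qed

section \<open>Equivariance\<close>


text \<open>Turns the conditions in \<open>\<phi>_dom\<close>, that an ultrafilter meets the ideal
  of a word, into membership of a point in an open set.\<close>

lemma point_filter_Int:
  assumes "openin X S" "openin X T"
  shows "point_filter X S y \<inter> compact_opens X T \<noteq> {} \<longleftrightarrow> y \<in> S \<inter> T"
proof
  assume "y \<in> S \<inter> T"
  then obtain K where "K \<in> compact_opens X (S \<inter> T)" "y \<in> K"
    using compact_openE[of "S \<inter> T" y] assms by blast
  then show "point_filter X S y \<inter> compact_opens X T \<noteq> {}"
    by (auto simp: point_filter_def compact_opens_def)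
qed (auto simp: point_filter_def compact_opens_def)

lemma pt_Int_compact_opens: "S \<subseteq> topspace X \<Longrightarrow> pt y \<inter> compact_opens X S = point_filter X S y"
  by (auto simp: point_filter_def compact_opens_def)

lemma funpow_shift: "(shift ^^ i) ((shift ^^ n) x) = (shift ^^ (n + i)) x"
  by (metis add.commute funpow_add comp_apply)

lemma orbit_edge_shift: "orbit_edge ((shift ^^ n) x) i = orbit_edge x (n + i)"
  by (simp add: orbit_edge_def funpow_shift)

lemma shift_dom_iter_add:
  "x \<in> shift_dom_iter (n + m) \<longleftrightarrow> x \<in> shift_dom_iter n \<and> (shift ^^ n) x \<in> shift_dom_iter m"
proof -
  have "(\<forall>i<n + m. Q i) \<longleftrightarrow> (\<forall>i<n. Q i) \<and> (\<forall>i<m. Q (n + i))" for Q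
    by (metis add_less_cancel_left le_Suc_ex not_le trans_less_add1)
  then show ?thesis
    using shift_iter_topspace[of x n n] by (auto simp: shift_dom_iter_def funpow_shift)
qed

lemma remove_edges_boundary_path:
  assumes x: "x \<in> shift_dom_iter n"
  shows "bds.remove_edges n (boundary_path x) = boundary_path ((shift ^^ n) x)"
proof -
  have "x \<in> topspace X" using x shift_dom_iter_subset by blast
  then show ?thesis
  proof (cases rule: boundary_path_cases)
    case inf
    have "(shift ^^ n) x \<in> shift_dom_iter m" for m using inf(1)[of "n + m"] shift_dom_iter_add by blast
    then show ?thesis using inf(2) by (simp add: boundary_path_def orbit_edge_shift fun_eq_iff)
  next
    case (fin m)
    have nm: "n \<le> m" using shift_dom_iterD[OF x, of m] fin(2) by (meson not_le)
    have "boundary_path ((shift ^^ n) x) = path_prefix (m - n) ((shift ^^ n) x)"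
      using fin(1,2) nm shift_dom_iter_add[of x n "m - n"] by (intro boundary_path_fin) (auto simp: funpow_shift)
    moreover have "bds.remove_edges n (path_prefix m x) = path_prefix (m - n) ((shift ^^ n) x)"
    \<comment> \<open>If \<open>m = n\<close>, no edge remains and the result is the end vertex,
      given by \<open>d_path_prefix\<close>.\<close>
    proof (cases "m = n")
      case True
      then show ?thesis
        using d_path_prefix[OF fin(1)] by (cases m) (auto simp: path_prefix_def)
    next
      case False
      have "drop n (map (orbit_edge x) [0..<m]) = map (orbit_edge ((shift ^^ n) x)) [0..<m - n]"
        by (rule nth_equalityI) (auto simp: orbit_edge_shift)
      then show ?thesis using False nm by (simp add: path_prefix_def)
    qed
    ultimately show ?thesis using fin(3) by simp
  qed
qed

lemma add_edges_boundary_path: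
  assumes z: "z \<in> shift_dom_iter n"
  shows "add_edges (map (orbit_edge z) [0..<n]) (boundary_path ((shift ^^ n) z)) = boundary_path z"
proof -
  have "(shift ^^ n) z \<in> topspace X" using shift_iter_topspace[OF z] by blast
  then show ?thesis
  proof (cases rule: boundary_path_cases)
    case inf
    have "z \<in> shift_dom_iter m" for m
      using inf(1)[of m] z shift_dom_iter_add[of z n m] shift_dom_iter_antimono[of z "n + m" m] by simp
    then have "boundary_path z = InfPath (orbit_edge z)" by (simp add: boundary_path_def)
    then show ?thesis using inf(2) by (auto simp: orbit_edge_shift fun_eq_iff)
  next
    case (fin m)
    have "boundary_path z = path_prefix (n + m) z"
      using fin(1,2) z shift_dom_iter_add[of z n m] by (intro boundary_path_fin) (auto simp: funpow_shift)
    moreover have "map (orbit_edge z) [0..<n + m] =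
        map (orbit_edge z) [0..<n] @ map (orbit_edge ((shift ^^ n) z)) [0..<m]"
      by (rule nth_equalityI) (auto simp: orbit_edge_shift nth_append)
    ultimately show ?thesis using fin(3) by (cases "n = 0") (auto simp: path_prefix_def)
  qed
qed

lemma edge_unshift:
  assumes a: "a \<in> L" and y: "y \<in> V [(a, False)]"
  shows "edge (\<rho> [(a, True)] y) = (a, pt y \<inter> bds.word_ideal [a])"
proof -
  have "bds.word_ideal [a] = compact_opens X (V [(a, False)])" using word_ideal[of "[a]"] a by simp
  then show ?thesis
    using label_eq[OF a unshift(1)[OF a y]] unshift(2)[OF a y] V_subset[of "[(a, False)]"] a
    by (simp add: edge_def pt_Int_compact_opens)
qed

text \<open>Each step of \<open>new_edges\<close> intersects the range of the edge just built with
  the ideal of a letter. That range is \<open>pt\<close> of the current point, and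
  \<open>edge_unshift\<close> identifies the intersection with the edge one letter further back, so
  the orbit is rebuilt from right to left.\<close>

lemma new_edges_pt:
  "\<lbrakk>\<alpha> \<in> lists L; y \<in> V (neg_word \<alpha>)\<rbrakk> \<Longrightarrow>
    bds.new_edges \<alpha> (pt y) = map (orbit_edge (\<rho> (pos_word \<alpha>) y)) [0..<length \<alpha>]"
proof (induction \<alpha> rule: list.induct)
  case (Cons a \<alpha>)
  then have a: "a \<in> L" "\<alpha> \<in> lists L" by auto
  let ?z' = "\<rho> (pos_word \<alpha>) y" and ?z = "\<rho> (pos_word (a # \<alpha>)) y"
  have y: "y \<in> V (neg_word \<alpha>)" "?z' \<in> V [(a, False)]" "?z = \<rho> [(a, True)] ?z'"
    using V_neg_word_Cons[OF Cons.prems(1)] Cons.prems(2) by auto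
  have sh: "shift ?z = ?z'" using unshift(2)[OF a(1) y(2)] y(3) by simp
  have e0: "orbit_edge ?z 0 = (a, pt ?z' \<inter> bds.word_ideal [a])"
    using edge_unshift[OF a(1) y(2)] y(3) by (simp add: orbit_edge_def)
  have "orbit_edge ?z (Suc i) = orbit_edge ?z' i" for i
    using sh by (simp add: orbit_edge_def funpow_swap1)
  then have m: "map (orbit_edge ?z) [0..<length (a # \<alpha>)] =
      (a, pt ?z' \<inter> bds.word_ideal [a]) # map (orbit_edge ?z') [0..<length \<alpha>]"
    using e0 by (simp only: list.size add_0_right add_Suc_right map_upt_Suc)
  show ?case
  \<comment> \<open>A single letter has its own clause, which uses the vertex itself; it agrees
    because \<open>\<rho> []\<close> is the identity.\<close>
  proof (cases \<alpha>)
    case Nil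
    have "y \<in> topspace X" using y(1) Nil V_Nil by simp
    then have "?z' = y" using act_one[of y] Nil by simp
    then show ?thesis using m Nil by simp
  next
    case (Cons b \<beta>)
    have z': "?z' \<in> V (pos_word \<alpha>)" using unshift_word(1)[OF a(2) y(1)] .
    then have s: "?z' \<in> shift_dom" "label ?z' = b"
      using V_pos_word_label[OF a(2), of ?z'] Cons shift_dom_iterD[of ?z' "length \<alpha>" 0] by auto
    have "hd (map (orbit_edge ?z') [0..<length \<alpha>]) = edge ?z'"
      using Cons by (simp add: orbit_edge_def upt_conv_Cons del: upt_Suc)
    moreover have "bds.f_empty b (snd (edge ?z')) = pt ?z'"
      using r_edge_edge[OF s(1)] s(2) by (simp add: bds.r_edge_def edge_def)
    moreover have "bds.new_edges \<alpha> (pt y) = map (orbit_edge ?z') [0..<length \<alpha>]"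
      using Cons.IH a(2) y(1) by blast
    ultimately have "bds.new_edges (a # \<alpha>) (pt y) =
        (a, pt ?z' \<inter> bds.word_ideal [a]) # map (orbit_edge ?z') [0..<length \<alpha>]"
      using Cons by (simp only: bds.new_edges.simps Let_def)
    then show ?thesis using m by (simp only:)
  qed
qed simp

lemma has_prefix_boundary_path:
  assumes "\<alpha> \<in> lists L" "x \<in> topspace X"
  shows "has_prefix \<alpha> (boundary_path x) \<longleftrightarrow> x \<in> V (pos_word \<alpha>)"
proof -
  have "fst (path_edge (boundary_path x) i) = label ((shift ^^ i) x)"
    if "x \<in> shift_dom_iter (length \<alpha>)" "i < length \<alpha>" for i
    using path_edge_boundary_path[OF that] by (simp add: orbit_edge_def edge_def)
  then show ?thesis
    unfolding has_prefix_def path_len_boundary_path[OF assms(2)] V_pos_word_label[OF assms(1)] by auto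
qed

lemma words1_iff: "\<alpha> \<in> bds.words1 \<longleftrightarrow> \<alpha> \<in> lists L \<and> \<alpha> \<noteq> [] \<and> V (pos_word \<alpha>) \<noteq> {}"
proof -
  have "\<alpha> \<in> bds.words \<Longrightarrow> \<alpha> \<in> lists L" by (simp add: bds.words_def)
  then show ?thesis using words_iff[of \<alpha>]
    by (cases "\<alpha> \<in> lists L") (auto simp: bds.words1_def Suc_le_eq)
qed

text \<open>Edges are numbered from 0: the last edge of \<open>\<alpha>\<close> has index
  \<open>length \<alpha> - 1\<close> and range at that iterate of \<open>x\<close>, and its
  ultrafilter sits one shift further.\<close>

lemma last_edge_Int_word_ideal:
  assumes \<alpha>: "\<alpha> \<in> lists L" "\<alpha> \<noteq> []" and \<beta>: "\<beta> \<in> lists L" and x: "x \<in> V (pos_word \<alpha>)"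
  shows "snd (path_edge (boundary_path x) (length \<alpha> - 1)) \<inter> bds.word_ideal \<beta> \<noteq> {} \<longleftrightarrow>
    (shift ^^ length \<alpha>) x \<in> V (neg_word \<beta>)"
proof -
  obtain n where n: "length \<alpha> = Suc n" using \<alpha>(2) by (cases \<alpha>) auto
  have xn: "x \<in> shift_dom_iter (length \<alpha>)" using x V_pos_word_label[OF \<alpha>(1)] by blast
  let ?y = "(shift ^^ n) x"
  have "?y \<in> shift_dom" using shift_dom_iterD[OF xn, of n] n by simp
  then have l: "label ?y \<in> L" "?y \<in> V (gen (label ?y))" using shift_dom_label by auto
  have "path_edge (boundary_path x) (length \<alpha> - 1) = edge ?y"
    using path_edge_boundary_path[OF xn, of n] n by (simp add: orbit_edge_def)
  then have "snd (path_edge (boundary_path x) (length \<alpha> - 1)) \<inter> bds.word_ideal \<beta> \<noteq> {} \<longleftrightarrow>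
      shift ?y \<in> V [(label ?y, False)] \<inter> V (neg_word \<beta>)"
    using point_filter_Int[of "V [(label ?y, False)]" "V (neg_word \<beta>)"] dom_open l(1) \<beta>
    by (simp add: edge_def word_ideal)
  then show ?thesis using shift_in(1)[OF l] n by simp
qed

text \<open>On words of the form \<alpha>\<beta>^-1, \<open>dom_frac\<close> describes
  \<open>V t\<close> in the same terms as the three clauses of \<open>\<phi>_dom\<close>; for any
  other \<open>t\<close>, \<open>V t\<close> is empty by \<open>dom_nonempty_frac\<close>.\<close>

lemma boundary_path_in_dom:
  assumes t: "t \<in> carrier (free_group L)" and x: "x \<in> topspace X"
  shows "boundary_path x \<in> bds.\<phi>_dom t \<longleftrightarrow> x \<in> V t"
proof (cases "t = []")
  case True
  then show ?thesis using x V_Nil boundary_path_in by (simp add: bds.\<phi>_dom_def)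
next
  case False
  have frac: "\<alpha> \<in> lists L" "\<beta> \<in> lists L"
      "V t = {x \<in> V (pos_word \<alpha>). (shift ^^ length \<alpha>) x \<in> V (neg_word \<beta>)}"
    if "t = Defs.frac \<alpha> \<beta>" for \<alpha> \<beta>
  proof -
    show "\<alpha> \<in> lists L" "\<beta> \<in> lists L"
      using t append_carrierD[of "pos_word \<alpha>" "neg_word \<beta>" L] unfolding that frac_eq by auto
    show "V t = {x \<in> V (pos_word \<alpha>). (shift ^^ length \<alpha>) x \<in> V (neg_word \<beta>)}"
      using dom_frac(1)[of \<beta> \<alpha>] inv_word_carrier[OF t] that by simp
  qed
  have neg: "bds.r_path (boundary_path x) \<inter> bds.word_ideal \<beta> \<noteq> {} \<longleftrightarrow> x \<in> V (neg_word \<beta>)"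
    if "\<beta> \<in> lists L" for \<beta>
    using point_filter_Int[of "topspace X" "V (neg_word \<beta>)" x] dom_open that x
    by (simp add: r_path_boundary_path[OF x] word_ideal)
  have dom_iff: "boundary_path x \<in> bds.\<phi>_dom t \<longleftrightarrow>
      (\<exists>\<alpha> \<in> bds.words1. \<exists>\<beta> \<in> bds.words1. t = Defs.frac \<alpha> \<beta> \<and> reduced (Defs.frac \<alpha> \<beta>) \<and>
           has_prefix \<alpha> (boundary_path x) \<and>
           snd (path_edge (boundary_path x) (length \<alpha> - 1)) \<inter> bds.word_ideal \<beta> \<noteq> {}) \<or>
        (\<exists>\<alpha> \<in> bds.words1. t = Defs.frac \<alpha> [] \<and> has_prefix \<alpha> (boundary_path x)) \<or>
        (\<exists>\<beta> \<in> bds.words1. t = Defs.frac [] \<beta> \<and> bds.r_path (boundary_path x) \<inter> bds.word_ideal \<beta> \<noteq> {})"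
    using False boundary_path_in[OF x] unfolding bds.\<phi>_dom_def by simp
  show ?thesis
  proof
    assume "boundary_path x \<in> bds.\<phi>_dom t"
    then consider
      \<alpha> \<beta> where "\<alpha> \<in> bds.words1" "\<beta> \<in> bds.words1" "t = Defs.frac \<alpha> \<beta>" "has_prefix \<alpha> (boundary_path x)"
        "snd (path_edge (boundary_path x) (length \<alpha> - 1)) \<inter> bds.word_ideal \<beta> \<noteq> {}"
      | \<alpha> where "\<alpha> \<in> bds.words1" "t = Defs.frac \<alpha> []" "has_prefix \<alpha> (boundary_path x)"
      | \<beta> where "\<beta> \<in> bds.words1" "t = Defs.frac [] \<beta>" "bds.r_path (boundary_path x) \<inter> bds.word_ideal \<beta> \<noteq> {}"
      unfolding dom_iff by blast
    then show "x \<in> V t"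
    proof cases
      case 1
      note w = 1(1,2)[unfolded words1_iff]
      have "x \<in> V (pos_word \<alpha>)" using 1(4) has_prefix_boundary_path x w by blast
      then show ?thesis using last_edge_Int_word_ideal[of \<alpha> \<beta> x] 1(5) w frac(3)[OF 1(3)] by blast
    next
      case 2
      then have "x \<in> V (pos_word \<alpha>)" using has_prefix_boundary_path x words1_iff by blast
      then show ?thesis using 2(2) by (simp add: frac_eq)
    next
      case 3
      then have "x \<in> V (neg_word \<beta>)" using neg words1_iff by blast
      then show ?thesis using 3(2) by (simp add: frac_eq)
    qed
  next
    assume xt: "x \<in> V t"
    \<comment> \<open>\<open>dom_nonempty_frac\<close> speaks of domains, so it is applied to the
      inverse, whose domain is \<open>V t\<close>.\<close>
    then have "dom (inv_word t) \<noteq> {}" by auto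
    then obtain \<alpha> \<beta> where "inv_word t = Defs.frac \<beta> \<alpha>"
      using dom_nonempty_frac[of "inv_word t"] inv_word_carrier[OF t] by blast
    then have tf: "t = Defs.frac \<alpha> \<beta>" by (metis inv_word_frac inv_word_simps(3))
    note f = frac[OF tf]
    have xa: "x \<in> V (pos_word \<alpha>)" and xb: "(shift ^^ length \<alpha>) x \<in> V (neg_word \<beta>)"
      using xt f(3) by auto
    \<comment> \<open>The point \<open>x\<close> and its iterate witness that the two words lie in
      \<open>words1\<close>.\<close>
    have wa: "\<alpha> \<in> bds.words1" if "\<alpha> \<noteq> []" using that xa f(1) words1_iff by blast
    have wb: "\<beta> \<in> bds.words1" if "\<beta> \<noteq> []" using that xb f(2) words1_iff V_neg_word_empty_iff by blast
    have p: "has_prefix \<alpha> (boundary_path x)" using has_prefix_boundary_path f(1) x xa by blast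
    have r: "reduced (Defs.frac \<alpha> \<beta>)" using t tf by (simp add: carrier_free_group)
    consider "\<alpha> \<noteq> []" "\<beta> \<noteq> []" | "\<alpha> \<noteq> []" "\<beta> = []" | "\<alpha> = []" "\<beta> \<noteq> []"
      using False tf by (cases "\<alpha> = []"; cases "\<beta> = []") (simp_all add: frac_eq)
    then show "boundary_path x \<in> bds.\<phi>_dom t"
    proof cases
      case 1
      then have "snd (path_edge (boundary_path x) (length \<alpha> - 1)) \<inter> bds.word_ideal \<beta> \<noteq> {}"
        using last_edge_Int_word_ideal f xa xb by blast
      then show ?thesis unfolding dom_iff using wa[OF 1(1)] wb[OF 1(2)] tf r p by blast
    next
      case 2
      then show ?thesis unfolding dom_iff using wa tf p by blast
    next
      case 3
      then have "bds.r_path (boundary_path x) \<inter> bds.word_ideal \<beta> \<noteq> {}" using neg[OF f(2)] xb by simp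
      then show ?thesis unfolding dom_iff using wb[OF 3(2)] tf 3(1) by blast
    qed
  qed
qed

lemma image_boundary_path_V:
  assumes "t \<in> carrier (free_group L)"
  shows "boundary_path ` V t = bds.\<phi>_dom t"
proof -
  have "bds.\<phi>_dom t \<subseteq> boundary_path ` topspace X"
    unfolding boundary_eq[symmetric] by (auto simp: bds.\<phi>_dom_def split: if_splits)
  moreover have "boundary_path x \<in> bds.\<phi>_dom t \<longleftrightarrow> x \<in> V t" if "x \<in> topspace X" for x
    using boundary_path_in_dom[OF assms that] .
  ultimately show ?thesis using V_subset[OF assms] by blast
qed

text \<open>The points \<open>x\<close> and \<open>\<rho> t x\<close> reach the same point
  \<open>?y\<close> after \<open>length \<beta>\<close> and \<open>length \<alpha>\<close> shifts.
  Removing the initial edges of the first orbit and adding those of the second therefore leads from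
  one boundary path to the other.\<close>

lemma boundary_path_act:
  assumes t: "t \<in> carrier (free_group L)" and x: "x \<in> dom t"
  shows "boundary_path (\<rho> t x) = bds.\<phi>_act t (boundary_path x)"
proof (cases "t = []")
  case True
  then show ?thesis using x V_Nil act_one by (simp add: bds.\<phi>_act_def)
next
  case False
  obtain \<alpha> \<beta> where tf: "t = Defs.frac \<alpha> \<beta>" using dom_nonempty_frac[OF t] x by blast
  have ab: "\<alpha> \<in> lists L" "\<beta> \<in> lists L"
    using t append_carrierD[of "pos_word \<alpha>" "neg_word \<beta>" L] unfolding tf frac_eq by auto
  have the: "(THE (\<alpha>, \<beta>). t = Defs.frac \<alpha> \<beta>) = (\<alpha>, \<beta>)"
    by (rule the_equality) (auto simp: tf frac_inject)
  let ?y = "(shift ^^ length \<beta>) x"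
  have xV: "x \<in> V (Defs.frac \<beta> \<alpha>)" using x tf by simp
  then have xb: "x \<in> V (pos_word \<beta>)" and y: "?y \<in> V (neg_word \<alpha>)"
    using dom_frac(1)[OF t[unfolded tf]] by auto
  have xn: "x \<in> shift_dom_iter (length \<beta>)" using xb V_pos_word_label[OF ab(2)] by blast
  have z: "\<rho> t x = \<rho> (pos_word \<alpha>) ?y" using dom_frac(2)[OF t[unfolded tf] xV] tf by simp
  have \<zeta>: "(if \<beta> = [] then bds.r_path (boundary_path x)
      else bds.d_edge (path_edge (boundary_path x) (length \<beta> - 1))) = pt ?y"
  proof (cases \<beta>)
    case Nil
    then show ?thesis using r_path_boundary_path xn shift_dom_iter_subset by auto
  next
    case (Cons b \<beta>')
    then show ?thesis
      using path_edge_boundary_path[OF xn, of "length \<beta>'"] d_orbit_edge[OF xn, of "length \<beta>'"] by simp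
  qed
  have zn: "\<rho> t x \<in> shift_dom_iter (length \<alpha>)" "(shift ^^ length \<alpha>) (\<rho> t x) = ?y"
    using unshift_word[OF ab(1) y] z V_pos_word_label[OF ab(1)] by auto
  have "bds.\<phi>_act t (boundary_path x) =
      add_edges (bds.new_edges \<alpha> (pt ?y)) (bds.remove_edges (length \<beta>) (boundary_path x))"
    using False unfolding bds.\<phi>_act_def the Let_def prod.case \<zeta> by simp
  also have "\<dots> = add_edges (map (orbit_edge (\<rho> t x)) [0..<length \<alpha>]) (boundary_path ?y)"
    using new_edges_pt[OF ab(1) y] remove_edges_boundary_path[OF xn] z by simp
  also have "\<dots> = boundary_path (\<rho> t x)"
    using add_edges_boundary_path[OF zn(1)] zn(2) by simp
  finally show ?thesis by simp
qed

lemma equivariant_boundary_path: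
  "equivariant (free_group L) V \<rho> bds.\<phi>_dom bds.\<phi>_act boundary_path"
  unfolding equivariant_def using image_boundary_path_V boundary_path_act by (simp add: inv_free_group)

end

section \<open>From an equivariant homeomorphism to an isomorphism of groupoids\<close>

lemma isomorphic_action_groupoids:
  assumes act: "topological_partial_action G X V \<rho>"
    and f: "homeomorphic_map X Y f"
    and eqv: "equivariant G V \<rho> U \<phi> f"
  shows "isomorphic_tgroupoids (action_groupoid G X V \<rho>) (action_groupoid G Y U \<phi>)"
proof -
  interpret topological_partial_action G X V \<rho> by (rule act)
  have E: "f ` V t = U t" "\<And>x. x \<in> V (inv\<^bsub>G\<^esub> t) \<Longrightarrow> f (\<rho> t x) = \<phi> t (f x)" if "t \<in> carrier G" for t
    using eqv that unfolding equivariant_def by blast+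
  have V: "V t \<subseteq> topspace X" if "t \<in> carrier G" for t using dom_open[OF that] openin_subset by blast
  have top: "topspace (subtopology X (V t)) = V t" if "t \<in> carrier G" for t using V[OF that] by auto
  have \<rho>: "\<rho> t y \<in> topspace X" if "t \<in> carrier G" "y \<in> V (inv\<^bsub>G\<^esub> t)" for t y
    using homeomorphic_imp_surjective_map[OF homeo[OF that(1)]] that V[OF that(1)]
    unfolding top[OF that(1)] top[OF inv_closed[OF that(1)]] by blast
  have inj: "inj_on f (topspace X)" and im: "f ` topspace X = topspace Y"
    using f homeomorphic_map_def homeomorphic_imp_surjective_map by blast+
  define S where "S = {(x, t, y). t \<in> carrier G \<and> y \<in> V (inv\<^bsub>G\<^esub> t) \<and> x = \<rho> t y}"
  define T where "T = {(x, t, y). t \<in> carrier G \<and> y \<in> U (inv\<^bsub>G\<^esub> t) \<and> x = \<phi> t y}"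
  define P where "P = prod_topology X (prod_topology (discrete_topology (carrier G)) X)"
  define Q where "Q = prod_topology Y (prod_topology (discrete_topology (carrier G)) Y)"
  \<comment> \<open>Applies \<open>f\<close> to both end points and keeps the group element.
    Equivariance carries \<open>S\<close> onto \<open>T\<close>, so the homeomorphism of the product
    spaces restricts to the arrows.\<close>
  define h where "h = (\<lambda>(x, t :: 'a, y). (f x, t, f y))"
  have S_top: "S \<subseteq> topspace P"
  proof
    fix a assume "a \<in> S"
    then obtain t y where a: "t \<in> carrier G" "y \<in> V (inv\<^bsub>G\<^esub> t)" "a = (\<rho> t y, t, y)" by (auto simp: S_def)
    have "y \<in> topspace X" using V[OF inv_closed[OF a(1)]] a(2) by blast
    then show "a \<in> topspace P" using a \<rho> by (simp add: P_def)
  qed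
  have hS: "h ` S = T"
  proof (intro equalityI subsetI)
    fix g assume "g \<in> h ` S"
    then obtain t y where g: "t \<in> carrier G" "y \<in> V (inv\<^bsub>G\<^esub> t)" "g = (f (\<rho> t y), t, f y)"
      by (auto simp: S_def h_def)
    then show "g \<in> T" using E(1)[of "inv\<^bsub>G\<^esub> t"] E(2) by (auto simp: T_def)
  next
    fix g assume "g \<in> T"
    then obtain t v where g: "t \<in> carrier G" "v \<in> U (inv\<^bsub>G\<^esub> t)" "g = (\<phi> t v, t, v)"
      by (auto simp: T_def)
    then obtain y where "y \<in> V (inv\<^bsub>G\<^esub> t)" "v = f y" using E(1)[of "inv\<^bsub>G\<^esub> t"] by auto
    then have "(\<rho> t y, t, y) \<in> S" "g = h (\<rho> t y, t, y)" using g E(2) by (auto simp: S_def h_def)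
    then show "g \<in> h ` S" by blast
  qed
  obtain g where g: "homeomorphic_maps X Y f g" using f homeomorphic_map_maps by blast
  have "homeomorphic_maps P Q h (\<lambda>(x, t, y). (g x, t, g y))"
    unfolding P_def Q_def h_def
    using homeomorphic_maps_prod[of X "prod_topology (discrete_topology (carrier G)) X" Y
        "prod_topology (discrete_topology (carrier G)) Y" f "\<lambda>(t, y). (t, f y)" g "\<lambda>(t, y). (t, g y)"]
      homeomorphic_maps_prod[of "discrete_topology (carrier G)" X "discrete_topology (carrier G)" Y
        "\<lambda>t. t" f "\<lambda>t. t" g] g
    by (auto simp: case_prod_unfold homeomorphic_maps_def)
  then have hPQ: "homeomorphic_map P Q h" using homeomorphic_map_maps by blast
  have T_top: "T \<subseteq> topspace Q"
    using homeomorphic_imp_surjective_map[OF hPQ] S_top hS by blast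
  have arr: "homeomorphic_map (subtopology P S) (subtopology Q T) h"
    using homeomorphic_map_subtopologies[OF hPQ, of S T] S_top T_top hS by (simp add: inf.absorb2)
  have A: "action_groupoid G X V \<rho> = \<lparr>arrows = subtopology P S,
      composable = {((x, t, y), (y', s, z)). (x, t, y) \<in> S \<and> (y', s, z) \<in> S \<and> y = y'},
      gmult = (\<lambda>(x, t, y) (y', s, z). (x, t \<otimes>\<^bsub>G\<^esub> s, z)), ginv = (\<lambda>(x, t, y). (y, inv\<^bsub>G\<^esub> t, x))\<rparr>"
    unfolding action_groupoid_def Let_def S_def P_def ..
  have B: "action_groupoid G Y U \<phi> = \<lparr>arrows = subtopology Q T,
      composable = {((x, t, y), (y', s, z)). (x, t, y) \<in> T \<and> (y', s, z) \<in> T \<and> y = y'},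
      gmult = (\<lambda>(x, t, y) (y', s, z). (x, t \<otimes>\<^bsub>G\<^esub> s, z)), ginv = (\<lambda>(x, t, y). (y, inv\<^bsub>G\<^esub> t, x))\<rparr>"
    unfolding action_groupoid_def Let_def T_def Q_def ..
  have topS: "topspace (subtopology P S) = S" using S_top by auto
  have comp: "(a, b) \<in> composable (action_groupoid G X V \<rho>) \<longleftrightarrow> (h a, h b) \<in> composable (action_groupoid G Y U \<phi>)"
    if "a \<in> S" "b \<in> S" for a b
  proof -
    obtain x t y x' t' y' where e: "a = (x, t, y)" "b = (x', t', y')" by (cases a, cases b) auto
    have "y \<in> topspace X" "x' \<in> topspace X" using S_top that e by (auto simp: P_def)
    then have "f y = f x' \<longleftrightarrow> y = x'" using inj by (simp add: inj_on_eq_iff)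
    moreover have "h a \<in> T" "h b \<in> T" using hS that by auto
    ultimately show ?thesis using that unfolding A B e by (simp add: h_def)
  qed
  show ?thesis
    unfolding isomorphic_tgroupoids_def
  proof (intro exI[of _ h] conjI)
    show "homeomorphic_map (arrows (action_groupoid G X V \<rho>)) (arrows (action_groupoid G Y U \<phi>)) h"
      using arr unfolding A B by simp
    show "\<forall>a\<in>topspace (arrows (action_groupoid G X V \<rho>)). \<forall>b\<in>topspace (arrows (action_groupoid G X V \<rho>)).
        (a, b) \<in> composable (action_groupoid G X V \<rho>) \<longleftrightarrow> (h a, h b) \<in> composable (action_groupoid G Y U \<phi>)"
      using comp topS by (simp add: A[THEN arg_cong[of _ _ arrows]])
  qed (auto simp: A B h_def)
qed

theorem theorem5p1:
  fixes A :: "'a boolalg" and X :: "'x topology" and L :: "'l set"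
    and V :: "('l \<times> bool) list \<Rightarrow> 'x set" and \<rho> :: "('l \<times> bool) list \<Rightarrow> 'x \<Rightarrow> 'x"
  assumes "gen_boolean_algebra A"
    and "X homeomorphic_space stone_dual A"
    and "topological_partial_action (free_group L) X V \<rho>"
    and "semi_saturated L V \<rho>"
    and "orthogonal_action L V"
    and "\<And>\<alpha>. \<alpha> \<in> L \<Longrightarrow> openin X (V (gen \<alpha>)) \<and> closedin X (V (gen \<alpha>))"
  shows "\<exists>(\<B> :: 'x set boolalg) (\<theta> :: 'l \<Rightarrow> 'x set \<Rightarrow> 'x set).
    boolean_dynamical_system \<B> L \<theta> \<and>
    (\<exists>f. homeomorphic_map X (boolean_dynamical_system.boundary_space \<B> L \<theta>) f \<and>
         equivariant (free_group L) V \<rho>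
           (boolean_dynamical_system.\<phi>_dom \<B> L \<theta>) (boolean_dynamical_system.\<phi>_act \<B> \<theta>) f) \<and>
    isomorphic_tgroupoids
      (action_groupoid (free_group L) X V \<rho>)
      (action_groupoid (free_group L) (boolean_dynamical_system.boundary_space \<B> L \<theta>)
        (boolean_dynamical_system.\<phi>_dom \<B> L \<theta>) (boolean_dynamical_system.\<phi>_act \<B> \<theta>))"
proof -
  interpret A: gen_boolean_algebra A by fact
  interpret topological_partial_action "free_group L" X V \<rho> by fact
  interpret stone_partial_action L X V \<rho>
  proof
    show "Hausdorff_space X"
      using assms(2) A.Hausdorff_stone_dual homeomorphic_Hausdorff_space by blast
    show "compact_open_base X"
      using assms(2) A.compact_open_base_stone_dual homeomorphic_compact_open_base by blast
  qed (use assms in auto)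
  \<comment> \<open>The witnesses are the algebra of compact open sets with \<open>pull\<close>, and
    \<open>boundary_path\<close> as the map \<open>f\<close>.\<close>
  show ?thesis
    using bds.boolean_dynamical_system_axioms homeomorphic_map_boundary_path equivariant_boundary_path
      isomorphic_action_groupoids[OF assms(3) homeomorphic_map_boundary_path equivariant_boundary_path]
    by blast
qed

end
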